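(* Let $(X,\mathrm{dist})$ be a distance space, let $P\subseteq X$ with $|P|=n$, let $0<r_1<r_2$, and let $\mathcal{H}$ be an $(r_1,r_2,p_1,p_2)$-sensitive family of hash functions on $X$. Let $\rho=\log(1/p_1)/\log(1/p_2)$. Then there exists a solution to the $(r_1,r_2)$-near neighbor problem for $P$ with the following properties: (i) the complexity of the query operation is dominated by $O(\log^2(n)/(p_1-p_2)^2)$ evaluations of hash functions from $\mathcal{H}$ and $O(n^{\rho}/(p_1-p_2)^2)$ other word-RAM operations; (ii) the solution uses $O(n^{1+\rho}/p_1+n/(p_1-p_2)^2)$ words of space in addition to the space required to store the data and $O(\log^2(n)/(p_1-p_2)^2)$ hash functions from $\mathcal{H}$.
   Context: A distribution $\mathcal{H}$ over functions $h\colon X\to R$ is $(r_1,r_2,p_1,p_2)$-sensitive if for all $x,y\in X$ and $h\sim\mathcal{H}$: if $\mathrm{dist}(x,y)\le r_1$ then $\Pr[h(x)=h(y)]\ge p_1$, and if $\mathrm{dist}(x,y)\ge r_2$ then $\Pr[h(x)=h(y)]\le p_2$. A solution to the $(r_1,r_2)$-near neighbor problem for $P$ is a data structure supporting the query: given $q\in X$, if there exists $x\in P$ with $\mathrm{dist}(q,x)\le r_1$, then with probability at least $1/2$ return some $x'\in P$ with $\mathrm{dist}(q,x')<r_2$. The model is the word RAM with word length $\Theta(\log n)$, where during preprocessing one can sample independently from $\mathcal{H}$ and seed pairwise (universal) independent hash functions.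
   Formalization: Proved for n≥2, 0<p2<p1≤1, countable R, word length at least c·log(n/(p1−p2)); other operations are O((log²n+n^ρ)/(p1−p2)²) uniformly, and O(n^ρ/(p1−p2)²) with a constant depending on p1,p2 when p1<1 (the bare bound fails at p1=1). *)

theory Defs
  imports "HOL-Probability.Probability"
begin

section \<open>Distance spaces and locality-sensitive families\<close>

definition distance_space :: "'x set \<Rightarrow> ('x \<Rightarrow> 'x \<Rightarrow> real) \<Rightarrow> bool" where
  "distance_space X d \<longleftrightarrow>
     (\<forall>x\<in>X. \<forall>y\<in>X. 0 \<le> d x y \<and> d x y = d y x) \<and> (\<forall>x\<in>X. d x x = 0)"

text \<open>
  A distribution over functions \<open>X \<Rightarrow> R\<close> is a probability measure on the function type.
  Its \<open>\<sigma>\<close>-algebra only has to make all evaluations measurable, so continuous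
  distributions (such as random projections) are included. Hash values are discrete objects:
  the range \<open>R\<close> is countable.
\<close>

definition hash_distribution :: "'x set \<Rightarrow> 'r set \<Rightarrow> ('x \<Rightarrow> 'r) measure \<Rightarrow> bool" where
  "hash_distribution X R H \<longleftrightarrow>
     prob_space H \<and> countable R \<and> (\<forall>x\<in>X. (\<lambda>h. h x) \<in> H \<rightarrow>\<^sub>M count_space R)"

definition sensitive ::
  "'x set \<Rightarrow> ('x \<Rightarrow> 'x \<Rightarrow> real) \<Rightarrow> ('x \<Rightarrow> 'r) measure \<Rightarrow> real \<Rightarrow> real \<Rightarrow> real \<Rightarrow> real \<Rightarrow> bool" where
  "sensitive X d H r1 r2 p1 p2 \<longleftrightarrow>
     (\<forall>x\<in>X. \<forall>y\<in>X.
        (d x y \<le> r1 \<longrightarrow> measure H {h \<in> space H. h x = h y} \<ge> p1) \<and>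
        (d x y \<ge> r2 \<longrightarrow> measure H {h \<in> space H. h x = h y} \<le> p2))"

definition pairwise_independent_family :: "'r set \<Rightarrow> nat \<Rightarrow> ('r \<Rightarrow> nat) measure \<Rightarrow> bool" where
  "pairwise_independent_family R N U \<longleftrightarrow>
     prob_space U \<and>
     (\<forall>a\<in>R. (\<lambda>u. u a) \<in> U \<rightarrow>\<^sub>M count_space {..<N}) \<and>
     (\<forall>a\<in>R. \<forall>i<N. measure U {u \<in> space U. u a = i} = 1 / real N) \<and>
     (\<forall>a\<in>R. \<forall>b\<in>R. a \<noteq> b \<longrightarrow>
        (\<forall>i<N. \<forall>j<N. measure U {u \<in> space U. u a = i \<and> u b = j} = 1 / real N ^ 2))"

section \<open>Word RAM\<close>

text \<open>
  Word-RAM programs in structured form. Registers and memory cells hold words, that is, numbers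
  below \<open>2 ^ w\<close>. The query point is not a word; a program accesses it only through \<open>Hash i\<close>,
  which evaluates at the query point the stored locality-sensitive function whose number is in
  register \<open>i\<close> and leaves the value, an element of \<open>R\<close>, in a dedicated register.
  \<open>Univ k i\<close> applies the stored universal hash function whose number is in register \<open>i\<close> to that
  value and puts the resulting word into register \<open>k\<close>.
\<close>

datatype binop = Add | Sub | Mul | Div | Mod | And | Or | Xor | Shl | Shr | Less | Eq

datatype com =
    Skip
  | Const nat nat
  | Op binop nat nat nat
  | Load nat nat
  | Store nat nat
  | Hash nat
  | Univ nat nat
  | Seq com com
  | If nat com com
  | While nat com

context
  includes bit_operations_syntax
begin

fun word_op :: "nat \<Rightarrow> binop \<Rightarrow> nat \<Rightarrow> nat \<Rightarrow> nat" where
  "word_op w Add a b = (a + b) mod 2 ^ w"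
| "word_op w Sub a b = (a + 2 ^ w - b) mod 2 ^ w"
| "word_op w Mul a b = (a * b) mod 2 ^ w"
| "word_op w Div a b = a div b"
| "word_op w Mod a b = a mod b"
| "word_op w And a b = a AND b"
| "word_op w Or a b = a OR b"
| "word_op w Xor a b = a XOR b"
| "word_op w Shl a b = push_bit b a mod 2 ^ w"
| "word_op w Shr a b = drop_bit b a"
| "word_op w Less a b = of_bool (a < b)"
| "word_op w Eq a b = of_bool (a = b)"

end

record 'r ram_state =
  regs :: "nat \<Rightarrow> nat"
  mem :: "nat \<Rightarrow> nat"
  hval :: "'r option"

text \<open>
  \<open>exec w S m g l v c s e t s'\<close>: with word length \<open>w\<close>, memory cells \<open>0, \<dots>, S - 1\<close>,
  \<open>m\<close> locality-sensitive functions with values \<open>g 0, \<dots>, g (m - 1)\<close> at the query point and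
  \<open>l\<close> universal functions \<open>v 0, \<dots>, v (l - 1)\<close>, program \<open>c\<close> started in state \<open>s\<close> halts in state
  \<open>s'\<close> after \<open>e\<close> evaluations of locality-sensitive functions and \<open>t\<close> other operations.
  Out-of-range accesses have no transition, so a program that makes one has no halting execution.
\<close>

inductive exec ::
  "nat \<Rightarrow> nat \<Rightarrow> nat \<Rightarrow> (nat \<Rightarrow> 'r) \<Rightarrow> nat \<Rightarrow> (nat \<Rightarrow> 'r \<Rightarrow> nat) \<Rightarrow>
   com \<Rightarrow> 'r ram_state \<Rightarrow> nat \<Rightarrow> nat \<Rightarrow> 'r ram_state \<Rightarrow> bool"
  for w S m g l v where
  Skip: "exec w S m g l v Skip s 0 1 s"
| Const: "exec w S m g l v (Const k a) s 0 1 (s\<lparr>regs := (regs s)(k := a mod 2 ^ w)\<rparr>)"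
| Op: "exec w S m g l v (Op f k i j) s 0 1
         (s\<lparr>regs := (regs s)(k := word_op w f (regs s i) (regs s j))\<rparr>)"
| Load: "regs s i < S \<Longrightarrow>
         exec w S m g l v (Load k i) s 0 1 (s\<lparr>regs := (regs s)(k := mem s (regs s i))\<rparr>)"
| Store: "regs s i < S \<Longrightarrow>
         exec w S m g l v (Store i j) s 0 1 (s\<lparr>mem := (mem s)(regs s i := regs s j)\<rparr>)"
| Hash: "regs s i < m \<Longrightarrow>
         exec w S m g l v (Hash i) s 1 0 (s\<lparr>hval := Some (g (regs s i))\<rparr>)"
| Univ: "regs s i < l \<Longrightarrow> hval s = Some a \<Longrightarrow>
         exec w S m g l v (Univ k i) s 0 1 (s\<lparr>regs := (regs s)(k := v (regs s i) a)\<rparr>)"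
| Seq: "exec w S m g l v c1 s e1 t1 s1 \<Longrightarrow> exec w S m g l v c2 s1 e2 t2 s2 \<Longrightarrow>
         exec w S m g l v (Seq c1 c2) s (e1 + e2) (t1 + t2) s2"
| IfTrue: "regs s i \<noteq> 0 \<Longrightarrow> exec w S m g l v c1 s e t s' \<Longrightarrow>
         exec w S m g l v (If i c1 c2) s e (Suc t) s'"
| IfFalse: "regs s i = 0 \<Longrightarrow> exec w S m g l v c2 s e t s' \<Longrightarrow>
         exec w S m g l v (If i c1 c2) s e (Suc t) s'"
| WhileFalse: "regs s i = 0 \<Longrightarrow> exec w S m g l v (While i c) s 0 1 s"
| WhileTrue: "regs s i \<noteq> 0 \<Longrightarrow> exec w S m g l v c s e1 t1 s1 \<Longrightarrow>
         exec w S m g l v (While i c) s1 e2 t2 s2 \<Longrightarrow>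
         exec w S m g l v (While i c) s (e1 + e2) (Suc (t1 + t2)) s2"

section \<open>Near neighbor data structures\<close>

text \<open>
  Preprocessing draws \<open>num_hash\<close> independent functions from \<open>H\<close>, \<open>num_univ\<close> independent
  functions from \<open>U\<close> and further independent random data from \<open>coins\<close>, and from these computes
  the initial contents of the memory (\<open>build\<close>). The data set is stored as the array \<open>points\<close>;
  queries answer with an index into it.
\<close>

record ('x, 'r) nn_structure =
  points :: "'x list"
  num_hash :: nat
  num_univ :: nat
  coins :: "nat pmf"
  mem_size :: nat
  build :: "(nat \<Rightarrow> 'x \<Rightarrow> 'r) \<Rightarrow> (nat \<Rightarrow> 'r \<Rightarrow> nat) \<Rightarrow> nat \<Rightarrow> nat \<Rightarrow> nat"

type_synonym ('x, 'r) sample = "(nat \<Rightarrow> 'x \<Rightarrow> 'r) \<times> (nat \<Rightarrow> 'r \<Rightarrow> nat) \<times> nat"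

definition sample_space ::
  "('x \<Rightarrow> 'r) measure \<Rightarrow> ('r \<Rightarrow> nat) measure \<Rightarrow> ('x, 'r) nn_structure \<Rightarrow> ('x, 'r) sample measure" where
  "sample_space H U D =
     (\<Pi>\<^sub>M i\<in>{..<num_hash D}. H) \<Otimes>\<^sub>M ((\<Pi>\<^sub>M i\<in>{..<num_univ D}. U) \<Otimes>\<^sub>M measure_pmf (coins D))"

definition query ::
  "nat \<Rightarrow> com \<Rightarrow> ('x, 'r) nn_structure \<Rightarrow> ('x, 'r) sample \<Rightarrow> 'x \<Rightarrow> nat \<Rightarrow> nat \<Rightarrow> nat \<Rightarrow> bool" where
  "query w prog D \<omega> q e t i \<longleftrightarrow>
     (case \<omega> of (hs, us, z) \<Rightarrow>
        \<exists>s'. exec w (mem_size D) (num_hash D) (\<lambda>j. hs j q) (num_univ D) us prog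
               \<lparr>regs = (\<lambda>_. 0), mem = build D hs us z, hval = None\<rparr> e t s' \<and>
             regs s' 0 = i)"

text \<open>An output that is not a valid index into \<open>points\<close> means that no point is returned.\<close>

definition returns ::
  "nat \<Rightarrow> com \<Rightarrow> ('x, 'r) nn_structure \<Rightarrow> ('x, 'r) sample \<Rightarrow> 'x \<Rightarrow> 'x \<Rightarrow> bool" where
  "returns w prog D \<omega> q x \<longleftrightarrow>
     (\<exists>e t i. query w prog D \<omega> q e t i \<and> i < length (points D) \<and> points D ! i = x)"

definition near_neighbor_solution ::
  "'x set \<Rightarrow> ('x \<Rightarrow> 'x \<Rightarrow> real) \<Rightarrow> 'x set \<Rightarrow> real \<Rightarrow> real \<Rightarrow> ('x \<Rightarrow> 'r) measure \<Rightarrow> ('r \<Rightarrow> nat) measure \<Rightarrow>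
   nat \<Rightarrow> com \<Rightarrow> ('x, 'r) nn_structure \<Rightarrow> bool" where
  "near_neighbor_solution X d P r1 r2 H U w prog D \<longleftrightarrow>
     distinct (points D) \<and> set (points D) = P \<and>
     (\<forall>(hs, us, z) \<in> space (sample_space H U D). \<forall>a < mem_size D. build D hs us z a < 2 ^ w) \<and>
     (\<forall>q\<in>X. (\<exists>x\<in>P. d q x \<le> r1) \<longrightarrow>
        measure (sample_space H U D)
          {\<omega> \<in> space (sample_space H U D). \<exists>x'\<in>P. d q x' < r2 \<and> returns w prog D \<omega> q x'} \<ge> 1 / 2)"

text \<open>
  Memory available to queries, including their working space; a seed of a universal hash function
  counts as one word. The data array and the functions from \<open>H\<close> are not included.
\<close>

definition space_words :: "('x, 'r) nn_structure \<Rightarrow> nat" where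
  "space_words D = mem_size D + num_univ D"

end

theory Submission
  imports Defs
begin

text \<open>
  Let \<open>k = \<lceil>ln n / ln (1 / p2)\<rceil>\<close>, so that \<open>p2 ^ k \<le> 1 / n\<close> and \<open>p1 ^ k \<ge> p1 / n powr \<rho>\<close>. There are \<open>k\<close>
  levels of \<open>m = O(k / p1)\<close> locality-sensitive functions, and a \<^emph>\<open>row\<close> picks one function per level at
  random. A second moment computation shows that the fraction of rows on which a near pair agrees is
  concentrated, so \<open>O(p1 ^ (- k / 2))\<close> rows on the first half of the levels and as many on the second
  half contain an agreeing row each. Every pair of half rows is a table; hence only the half rows,
  and not the \<open>L = O(p1 ^ (- k))\<close> tables, cost \<open>k\<close> operations each. The key of a table is the sum
  of the universal hash values, of which the low bits select a chain and the whole word is compared.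

  Matching points are verified by one-bit sketches packed into \<open>O(1 / (p1 - p2)\<^sup>2)\<close> words and compared
  with a popcount table. Points at distance between \<open>r1\<close> and \<open>r2\<close> may match often and still fail
  the verification. Therefore the search also stops at the match with a random number between
  \<open>Q\<close> and \<open>2 Q\<close>, where \<open>Q = O(n powr \<rho>)\<close>, and returns that match: as only \<open>Q / 20\<close> matches are far in
  expectation, it is far with probability at most \<open>1 / 20\<close>.

  For a fixed query all events depend on finitely many hash values in a countable set, so the
  analysis takes place in a product of discrete distributions.
\<close>

text \<open>Two budgets shape the construction. Only \<open>O(lg^2 / \<delta>^2)\<close>
  locality-sensitive functions are available, so the tables must share them and are dependent;
  independence of tables cannot be used and the variance of the fraction of agreeing rows takes its
  place. The time bound leaves constant work per table, so table keys must be composable: sums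
  modulo \<open>2 ^ w\<close> of words from independent universal functions add up over half rows,
  and one separated level already makes an accidental equality of the low \<open>B\<close> bits as
  unlikely as \<open>2 ^ (-B)\<close>. With \<open>x\<close> half rows of \<open>k\<close> steps
  each, \<open>2 * x * k \<le> x^2 + k^2\<close> splits the cost into the
  \<open>n powr \<rho>\<close> and the \<open>lg^2\<close> part of the bound; this is why the levels
  are halved.

  The stopping rank has to be random: a bound on the expected number of far matches says nothing
  about the match at one particular rank.

  Rounding the ideal number of levels up to \<open>k\<close> costs a factor \<open>1 / p1\<close> in
  the number of tables but nothing in the number of far matches, since there the ratio
  \<open>p2 / p1 < 1\<close> is raised to the power \<open>k\<close>.\<close>

unbundle bit_operations_syntax

section \<open>Total correctness with costs\<close>

locale ram =
  fixes w S m :: nat and g :: "nat \<Rightarrow> 'r" and l :: nat and v :: "nat \<Rightarrow> 'r \<Rightarrow> nat"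
begin

text \<open>A weakest precondition with the costs as arguments of the postcondition; it includes
  halting. The rules for loop-free commands below are equations, so the simplifier executes
  straight-line code symbolically and only loops need invariants.\<close>

definition cp :: "com \<Rightarrow> 'r ram_state \<Rightarrow> (nat \<Rightarrow> nat \<Rightarrow> 'r ram_state \<Rightarrow> bool) \<Rightarrow> bool" where
  "cp c s Q \<longleftrightarrow> (\<exists>e t s'. exec w S m g l v c s e t s' \<and> Q e t s')"

lemma cp_mono: "cp c s Q \<Longrightarrow> (\<And>e t s'. Q e t s' \<Longrightarrow> Q' e t s') \<Longrightarrow> cp c s Q'"
  unfolding cp_def by blast

lemma cpI: "exec w S m g l v c s e t s' \<Longrightarrow> Q e t s' \<Longrightarrow> cp c s Q"
  unfolding cp_def by blast

lemma cpE: "cp c s Q \<Longrightarrow> (\<And>e t s'. exec w S m g l v c s e t s' \<Longrightarrow> Q e t s' \<Longrightarrow> thesis) \<Longrightarrow> thesis"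
  unfolding cp_def by blast

lemma cp_Const [simp]: "cp (Const k a) s Q = Q 0 1 (s\<lparr>regs := (regs s)(k := a mod 2 ^ w)\<rparr>)"
  by (auto elim!: cpE elim: exec.cases intro: cpI[OF exec.Const])

lemma cp_Op [simp]: "cp (Op f k i j) s Q =
    Q 0 1 (s\<lparr>regs := (regs s)(k := word_op w f (regs s i) (regs s j))\<rparr>)"
  by (auto elim!: cpE elim: exec.cases intro: cpI[OF exec.Op])

lemma cp_Load [simp]: "cp (Load k i) s Q \<longleftrightarrow>
    regs s i < S \<and> Q 0 1 (s\<lparr>regs := (regs s)(k := mem s (regs s i))\<rparr>)"
  by (auto elim!: cpE elim: exec.cases intro: cpI[OF exec.Load])

lemma cp_Store [simp]: "cp (Store i j) s Q \<longleftrightarrow>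
    regs s i < S \<and> Q 0 1 (s\<lparr>mem := (mem s)(regs s i := regs s j)\<rparr>)"
  by (auto elim!: cpE elim: exec.cases intro: cpI[OF exec.Store])

lemma cp_Hash [simp]: "cp (Hash i) s Q \<longleftrightarrow>
    regs s i < m \<and> Q 1 0 (s\<lparr>hval := Some (g (regs s i))\<rparr>)"
  by (auto elim!: cpE elim: exec.cases intro: cpI[OF exec.Hash])

lemma cp_Univ [simp]: "cp (Univ k i) s Q \<longleftrightarrow>
    regs s i < l \<and> hval s \<noteq> None \<and>
    Q 0 1 (s\<lparr>regs := (regs s)(k := v (regs s i) (the (hval s)))\<rparr>)"
  by (auto elim!: cpE elim: exec.cases intro: cpI[OF exec.Univ])

lemma cp_Seq [simp]: "cp (Seq c1 c2) s Q \<longleftrightarrow>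
    cp c1 s (\<lambda>e1 t1 s1. cp c2 s1 (\<lambda>e2 t2 s2. Q (e1 + e2) (t1 + t2) s2))"
proof
  assume "cp (Seq c1 c2) s Q"
  then obtain e t s' where "exec w S m g l v (Seq c1 c2) s e t s'" "Q e t s'"
    unfolding cp_def by blast
  thus "cp c1 s (\<lambda>e1 t1 s1. cp c2 s1 (\<lambda>e2 t2 s2. Q (e1 + e2) (t1 + t2) s2))"
    unfolding cp_def by cases blast
qed (unfold cp_def, blast intro: exec.Seq)

lemma cp_If [simp]: "cp (If i c1 c2) s Q \<longleftrightarrow>
    (if regs s i \<noteq> 0 then cp c1 s (\<lambda>e t. Q e (Suc t)) else cp c2 s (\<lambda>e t. Q e (Suc t)))"
proof
  assume "cp (If i c1 c2) s Q"
  then obtain e t s' where "exec w S m g l v (If i c1 c2) s e t s'" "Q e t s'"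
    unfolding cp_def by blast
  thus "if regs s i \<noteq> 0 then cp c1 s (\<lambda>e t. Q e (Suc t)) else cp c2 s (\<lambda>e t. Q e (Suc t))"
    unfolding cp_def by cases auto
next
  assume "if regs s i \<noteq> 0 then cp c1 s (\<lambda>e t. Q e (Suc t)) else cp c2 s (\<lambda>e t. Q e (Suc t))"
  thus "cp (If i c1 c2) s Q"
    by (cases "regs s i = 0") (auto elim!: cpE intro: cpI[OF exec.IfTrue] cpI[OF exec.IfFalse])
qed

lemma cp_While_False: "regs s i = 0 \<Longrightarrow> Q 0 1 s \<Longrightarrow> cp (While i c) s Q"
  unfolding cp_def by (blast intro: exec.WhileFalse)

lemma cp_While_True:
  assumes "regs s i \<noteq> 0"
    and "cp c s (\<lambda>e1 t1 s1. cp (While i c) s1 (\<lambda>e2 t2 s2. Q (e1 + e2) (Suc (t1 + t2)) s2))"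
  shows "cp (While i c) s Q"
proof -
  from assms(2) obtain e1 t1 s1 e2 t2 s2 where
    "exec w S m g l v c s e1 t1 s1" "exec w S m g l v (While i c) s1 e2 t2 s2"
    "Q (e1 + e2) (Suc (t1 + t2)) s2"
    unfolding cp_def by blast
  thus ?thesis using exec.WhileTrue[of s i w S m g l v c e1 t1 s1 e2 t2 s2] assms(1)
    unfolding cp_def by blast
qed

text \<open>The potential \<open>\<Phi>\<close> pays for the iterations.\<close>

lemma cp_While:
  fixes \<Phi> :: "'r ram_state \<Rightarrow> nat"
  assumes "Inv s"
    and body: "\<And>s. Inv s \<Longrightarrow> regs s i \<noteq> 0 \<Longrightarrow>
      cp c s (\<lambda>e t s'. e = 0 \<and> Inv s' \<and> Suc t + \<Phi> s' \<le> \<Phi> s)"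
  shows "cp (While i c) s (\<lambda>e t s'. e = 0 \<and> t \<le> Suc (\<Phi> s) \<and> Inv s' \<and> regs s' i = 0)"
  using assms(1)
proof (induction "\<Phi> s" arbitrary: s rule: less_induct)
  case less
  show ?case
  proof (cases "regs s i = 0")
    case True
    thus ?thesis using less.prems by (intro cp_While_False) auto
  next
    case False
    show ?thesis
    proof (rule cp_While_True[OF False], rule cp_mono[OF body[OF less.prems False]])
      fix e1 t1 :: nat and s1
      assume *: "e1 = 0 \<and> Inv s1 \<and> Suc t1 + \<Phi> s1 \<le> \<Phi> s"
      have "cp (While i c) s1 (\<lambda>e t s'. e = 0 \<and> t \<le> Suc (\<Phi> s1) \<and> Inv s' \<and> regs s' i = 0)"
        using * by (intro less.hyps) auto
      thus "cp (While i c) s1 (\<lambda>e2 t2 s2. e1 + e2 = 0 \<and> Suc (t1 + t2) \<le> Suc (\<Phi> s) \<and>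
              Inv s2 \<and> regs s2 i = 0)"
        by (rule cp_mono) (use * in auto)
    qed
  qed
qed

end

text \<open>Register 1 holds the constant 1.\<close>

definition For :: "nat \<Rightarrow> nat \<Rightarrow> nat \<Rightarrow> com \<Rightarrow> com" where
  "For c i n body = Seq (Const i 0) (Seq (Op Less c i n)
     (While c (Seq body (Seq (Op Add i i 1) (Op Less c i n)))))"

context ram
begin

text \<open>The invariant is stable under changes of the counter \<open>i\<close> and of the flag
  \<open>c\<close>, so the bookkeeping of the loop preserves it; the iteration number enters as an
  argument of \<open>Inv\<close> instead. Besides the body, an iteration pays for a test, an
  increment and a comparison, hence \<open>T + 3\<close>.\<close>

lemma cp_For_loop:
  assumes N: "N < 2 ^ w" and ci: "c \<noteq> i" and ni: "n \<noteq> i"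
    and updi: "\<And>j s a. Inv j s \<Longrightarrow> Inv j (s\<lparr>regs := (regs s)(i := a)\<rparr>)"
    and updc: "\<And>j s a. Inv j s \<Longrightarrow> Inv j (s\<lparr>regs := (regs s)(c := a)\<rparr>)"
    and reg: "\<And>j s. Inv j s \<Longrightarrow> regs s n = N \<and> regs s 1 = 1"
    and body: "\<And>j s. j < N \<Longrightarrow> Inv j s \<Longrightarrow> regs s i = j \<Longrightarrow>
      cp body s (\<lambda>e t s'. e \<le> E \<and> t \<le> T \<and> Inv (Suc j) s' \<and> regs s' i = j)"
  shows "j \<le> N \<Longrightarrow> Inv j s \<Longrightarrow> regs s i = j \<Longrightarrow> regs s c = of_bool (j < N) \<Longrightarrow>
    cp (While c (Seq body (Seq (Op Add i i 1) (Op Less c i n)))) s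
      (\<lambda>e t s'. e \<le> (N - j) * E \<and> t \<le> (N - j) * (T + 3) + 1 \<and> Inv N s')"
proof (induction "N - j" arbitrary: j s)
  case 0
  thus ?case by (intro cp_While_False) auto
next
  case (Suc d)
  hence j: "j < N" by auto
  show ?case
  proof (rule cp_While_True)
    show "regs s c \<noteq> 0" using Suc.prems j by simp
    have IH: "cp (While c (Seq body (Seq (Op Add i i 1) (Op Less c i n)))) s'
        (\<lambda>e t s'. e \<le> (N - Suc j) * E \<and> t \<le> (N - Suc j) * (T + 3) + 1 \<and> Inv N s')"
      if "Inv (Suc j) s'" "regs s' i = Suc j" "regs s' c = of_bool (Suc j < N)" for s'
      using Suc.hyps that j by auto
    have nj: "N - j = Suc (N - Suc j)" using j by simp
    have "cp body s (\<lambda>e1 t1 s1. cp (Seq (Op Add i i 1) (Op Less c i n)) s1 (\<lambda>e2 t2 s2.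
        cp (While c (Seq body (Seq (Op Add i i 1) (Op Less c i n)))) s2 (\<lambda>e3 t3 s3.
          e1 + e2 + e3 \<le> (N - j) * E \<and> Suc (t1 + t2 + t3) \<le> (N - j) * (T + 3) + 1 \<and> Inv N s3)))"
    proof (rule cp_mono[OF body[OF j Suc.prems(2,3)]])
      fix e1 t1 s1 assume *: "e1 \<le> E \<and> t1 \<le> T \<and> Inv (Suc j) s1 \<and> regs s1 i = j"
      let ?s2 = "s1\<lparr>regs := (regs s1)(i := Suc j, c := of_bool (Suc j < N))\<rparr>"
      have r: "regs s1 n = N" "regs s1 1 = 1" using reg * by auto
      have i2: "Inv (Suc j) ?s2" using updc[OF updi, of "Suc j" s1] * by simp
      have "cp (While c (Seq body (Seq (Op Add i i 1) (Op Less c i n)))) ?s2 (\<lambda>e3 t3 s3.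
         e1 + e3 \<le> (N - j) * E \<and> Suc (t1 + 2 + t3) \<le> (N - j) * (T + 3) + 1 \<and> Inv N s3)"
        by (rule cp_mono[OF IH]) (use i2 ci * nj in \<open>auto simp: algebra_simps\<close>)
      moreover have "Suc j mod 2 ^ w = Suc j" using j N by simp
      ultimately show "cp (Seq (Op Add i i 1) (Op Less c i n)) s1 (\<lambda>e2 t2 s2.
        cp (While c (Seq body (Seq (Op Add i i 1) (Op Less c i n)))) s2 (\<lambda>e3 t3 s3.
          e1 + e2 + e3 \<le> (N - j) * E \<and> Suc (t1 + t2 + t3) \<le> (N - j) * (T + 3) + 1 \<and> Inv N s3))"
        using r * ni by simp
    qed
    thus "cp (Seq body (Seq (Op Add i i 1) (Op Less c i n))) s (\<lambda>e1 t1 s1.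
        cp (While c (Seq body (Seq (Op Add i i 1) (Op Less c i n)))) s1 (\<lambda>e2 t2 s2.
          e1 + e2 \<le> (N - j) * E \<and> Suc (t1 + t2) \<le> (N - j) * (T + 3) + 1 \<and> Inv N s2))"
      by (simp add: add.assoc)
  qed
qed

lemma cp_For:
  assumes "Inv 0 s" and N: "N < 2 ^ w" and ci: "c \<noteq> i" and ni: "n \<noteq> i"
    and updi: "\<And>j s a. Inv j s \<Longrightarrow> Inv j (s\<lparr>regs := (regs s)(i := a)\<rparr>)"
    and updc: "\<And>j s a. Inv j s \<Longrightarrow> Inv j (s\<lparr>regs := (regs s)(c := a)\<rparr>)"
    and reg: "\<And>j s. Inv j s \<Longrightarrow> regs s n = N \<and> regs s 1 = 1"
    and body: "\<And>j s. j < N \<Longrightarrow> Inv j s \<Longrightarrow> regs s i = j \<Longrightarrow>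
      cp body s (\<lambda>e t s'. e \<le> E \<and> t \<le> T \<and> Inv (Suc j) s' \<and> regs s' i = j)"
  shows "cp (For c i n body) s (\<lambda>e t s'. e \<le> N * E \<and> t \<le> N * (T + 3) + 3 \<and> Inv N s')"
proof -
  have rn: "((regs s)(i := 0)) n = N"
    using reg[OF updi[OF assms(1)]] by simp
  let ?s = "s\<lparr>regs := (regs s)(i := 0, c := of_bool (0 < N))\<rparr>"
  have "Inv 0 ?s" using updc[OF updi[OF assms(1)]] by simp
  hence "cp (While c (Seq body (Seq (Op Add i i 1) (Op Less c i n)))) ?s
      (\<lambda>e t s'. e \<le> (N - 0) * E \<and> t \<le> (N - 0) * (T + 3) + 1 \<and> Inv N s')"
    using ci by (intro cp_For_loop[OF assms(2-)]) auto
  thus ?thesis unfolding For_def using rn ni by simp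
qed

end

section \<open>The query program\<close>

fun horner :: "(nat \<Rightarrow> nat) \<Rightarrow> nat \<Rightarrow> nat" where
  "horner f 0 = 0"
| "horner f (Suc b) = 2 * horner f b + f b"

fun popcount :: "nat \<Rightarrow> nat" where
  "popcount a = (if a = 0 then 0 else a mod 2 + popcount (a div 2))"

declare popcount.simps [simp del]

lemma popcount_0 [simp]: "popcount 0 = 0"
  by (simp add: popcount.simps)

lemma popcount_double_add: "x < 2 \<Longrightarrow> popcount (2 * a + x) = popcount a + x"
  by (subst popcount.simps) auto

lemma horner_less: "(\<And>b. b < n \<Longrightarrow> f b < 2) \<Longrightarrow> horner f n < 2 ^ n"
proof (induction n)
  case (Suc n)
  have "f n < 2" "horner f n < 2 ^ n" using Suc by auto
  thus ?case by simp
qed simp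

text \<open>The xor has a one exactly where the packed bits differ, so its popcount is a Hamming
  distance. One table lookup thus compares a whole word of sketch bits.\<close>

lemma popcount_xor_horner:
  assumes "\<And>b. b < n \<Longrightarrow> f b < 2" "\<And>b. b < n \<Longrightarrow> h b < 2"
  shows "popcount (horner f n XOR horner h n) = card {b. b < n \<and> f b \<noteq> h b}"
  using assms
proof (induction n)
  case (Suc n)
  have x: "(2 * a + x) XOR (2 * b + y) = 2 * (a XOR b) + of_bool (x \<noteq> y)"
    if "x < 2" "y < 2" for a b x y :: nat
  proof -
    have "x = 0 \<or> x = 1" "y = 0 \<or> y = 1" using that by auto
    thus ?thesis by (subst xor_nat_rec) auto
  qed
  have set: "{b. b < Suc n \<and> f b \<noteq> h b} =
      (if f n \<noteq> h n then insert n {b. b < n \<and> f b \<noteq> h b} else {b. b < n \<and> f b \<noteq> h b})"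
    by (auto simp: less_Suc_eq)
  show ?case unfolding horner.simps using Suc
    by (subst x) (auto simp: popcount_double_add set)
qed simp

lemma popcount_less: "a < 2 ^ n \<Longrightarrow> popcount a \<le> n"
proof (induction n arbitrary: a)
  case (Suc n)
  have "popcount a = popcount (a div 2) + a mod 2"
    using popcount_double_add[of "a mod 2" "a div 2"] by simp
  moreover have "popcount (a div 2) \<le> n" using Suc by auto
  moreover have "a mod 2 \<le> 1" by simp
  ultimately show ?case by linarith
qed simp

lemma xor_less_power2: "a < 2 ^ n \<Longrightarrow> b < 2 ^ n \<Longrightarrow> a XOR b < 2 ^ n" for a b :: nat
  by (metis take_bit_nat_eq_self_iff take_bit_xor)

text \<open>Entry \<open>x\<close> is encoded as \<open>Suc x\<close>, the end of a chain as 0.\<close>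

definition next_entry :: "(nat \<Rightarrow> bool) \<Rightarrow> nat \<Rightarrow> nat \<Rightarrow> nat" where
  "next_entry P y n = (case filter P [y..<n] of [] \<Rightarrow> 0 | x # _ \<Rightarrow> Suc x)"

lemma next_entry_le: "next_entry P y n \<le> n"
proof (cases "filter P [y..<n]")
  case (Cons x xs)
  hence "x \<in> set (filter P [y..<n])" by (metis list.set_intros(1))
  hence "x < n" by simp
  thus ?thesis using Cons by (auto simp: next_entry_def)
qed (simp add: next_entry_def)

text \<open>Jumping to the first remaining member of a bucket leaves the list of remaining members
  unchanged. Hence following the stored links enumerates a bucket in increasing order, and chain
  traversal becomes a statement about lists.\<close>

lemma filter_upt_next_entry:
  "filter P [y..<n] =
     (if next_entry P y n = 0 then [] else filter P [next_entry P y n - 1..<n])"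
  "next_entry P y n \<noteq> 0 \<Longrightarrow> P (next_entry P y n - 1)"
proof -
  have "filter P [y..<n] = (if next_entry P y n = 0 then [] else filter P [next_entry P y n - 1..<n]) \<and>
    (next_entry P y n \<noteq> 0 \<longrightarrow> P (next_entry P y n - 1))"
  proof (induction "n - y" arbitrary: y)
    case 0
    thus ?case by (simp add: next_entry_def)
  next
    case (Suc d)
    hence y: "[y..<n] = y # [Suc y..<n]" by (simp add: upt_conv_Cons)
    have "next_entry P y n = (if P y then Suc y else next_entry P (Suc y) n)"
      by (simp add: next_entry_def y)
    moreover have "d = n - Suc y" using Suc by simp
    ultimately show ?case using Suc.hyps(1)[of "Suc y"] by (simp add: y)
  qed
  thus "filter P [y..<n] =
     (if next_entry P y n = 0 then [] else filter P [next_entry P y n - 1..<n])"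
  "next_entry P y n \<noteq> 0 \<Longrightarrow> P (next_entry P y n - 1)" by auto
qed

text \<open>Functional model of the search loop. In an entry \<open>(c, x)\<close> the flag
  \<open>c\<close> says that the full keys agree; \<open>acc\<close> is the verification by
  sketches; \<open>b1\<close> and \<open>b2\<close> are the remaining numbers of matches and of
  spurious entries; \<open>r\<close> is the last match so far or a default, returned when the list
  or \<open>b2\<close> runs out.\<close>

fun scan :: "(nat \<Rightarrow> bool) \<Rightarrow> (bool \<times> nat) list \<Rightarrow> nat \<Rightarrow> nat \<Rightarrow> nat \<Rightarrow> nat" where
  "scan acc [] r b1 b2 = r"
| "scan acc ((c, x) # es) r b1 b2 =
     (if c then if acc x \<or> b1 = 1 then x else scan acc es x (b1 - 1) b2
      else if b2 = 1 then r else scan acc es r b1 (b2 - 1))"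

fun Block :: "com list \<Rightarrow> com" where
  "Block [] = Skip"
| "Block [c] = c"
| "Block (c # cs) = Seq c (Block cs)"

fun load_params :: "nat \<Rightarrow> com" where
  "load_params 0 = Skip"
| "load_params (Suc r) = Seq (load_params r) (Seq (Const r r) (Load r r))"

text \<open>
  Registers 0 to 23 hold the parameters stored in the memory cells with the same numbers. In the
  search, register 40 is the answer, 41 the loop flag, 42 the next table, 43 the current entry,
  44 the offset of the current table, 45 its query key, and 46 and 47 are the remaining numbers of
  matches and of spurious entries.
\<close>

definition hash_words :: com where
  "hash_words = For 33 34 2 (Block [Hash 34, Univ 31 34, Op Add 32 3 34, Store 32 31])"

definition sketch_words :: com where
  "sketch_words = Seq (Op Add 30 2 0) (For 33 34 4 (Block [Const 37 0,
     For 36 35 5 (Block [Hash 30, Univ 31 30, Op And 31 31 1, Op Add 37 37 37, Op Add 37 37 31,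
       Op Add 30 30 1]),
     Op Add 32 6 34, Store 32 37]))"

text \<open>The array of half rows stores addresses of hash words rather than function numbers, so
  two loads fetch a summand. Register 38 walks through this array over all half rows.\<close>

definition signatures :: com where
  "signatures = Seq (Op Add 38 9 0) (For 33 34 7 (Block [Const 37 0,
     For 36 35 8 (Block [Load 32 38, Load 31 32, Op Add 37 37 31, Op Add 38 38 1]),
     Op Add 32 10 34, Store 32 37]))"

definition compare_sketch :: com where
  "compare_sketch = Block [Const 52 0, Op Mul 53 40 4, Op Add 53 53 19,
     For 36 35 4 (Block [Load 31 53, Op Add 32 6 35, Load 32 32, Op Xor 31 31 32, Op Add 31 20 31,
       Load 31 31, Op Add 52 52 31, Op Add 53 53 1])]"

text \<open>The loops over tables and over chain entries are flattened: an iteration handles one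
  entry if register 43 is nonzero and opens the next table otherwise. A single flag then ends
  everything; copying a decremented budget into it by \<open>Or\<close> stops the loop exactly when
  that budget reaches 0.\<close>

definition search_step :: com where
  "search_step = If 43
     (Block [Op Add 54 44 43, Op Add 55 17 54, Load 49 55, Op Add 55 18 54, Load 48 55,
       Op Eq 50 49 45,
       If 50 (Block [Op Sub 40 43 1, compare_sketch, Op Less 50 21 52,
                If 50 (Block [Op Sub 46 46 1, Op Or 41 46 46]) (Const 41 0)])
             (Block [Op Sub 47 47 1, Op Or 41 47 47]),
       Op Or 43 48 48])
     (Block [Op Less 50 42 11,
       If 50 (Block [Op Div 54 42 12, Op Add 54 10 54, Load 45 54, Op Mod 54 42 12, Op Add 54 13 54,
                Load 54 54, Op Add 45 45 54, Op Mod 54 45 15, Op Mul 55 42 15, Op Add 54 54 55,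
                Op Add 54 14 54, Load 43 54, Op Mul 44 42 16, Op Add 42 42 1])
             (Const 41 0)])"

definition search :: com where
  "search = Block [Op Or 46 22 22, Op Or 47 23 23, Const 40 0, Const 41 1, Const 42 0, Const 43 0,
     While 41 search_step, Op Or 0 40 40]"

definition query_prog :: com where
  "query_prog = Block [load_params 24, hash_words, sketch_words, signatures, search]"

text \<open>\<open>sg t x\<close> is the full key of point \<open>x\<close> in table
  \<open>t\<close>, \<open>sk x j\<close> its sketch word \<open>j\<close>, and
  \<open>ix r j\<close> the function that half row \<open>r\<close> uses at its level
  \<open>j\<close>. Half rows below \<open>nA\<close> serve the first half of the levels. The memory
  from address \<open>ro\<close> on is only read by the query.\<close>

locale nn_memory = ram w S m g m v
  for w S m :: nat and g :: "nat \<Rightarrow> 'r" and v :: "nat \<Rightarrow> 'r \<Rightarrow> nat" +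
  fixes par mem0 :: "nat \<Rightarrow> nat" and ix sg sk :: "nat \<Rightarrow> nat \<Rightarrow> nat" and nA ro :: nat
begin

abbreviation "nW \<equiv> par 2"
abbreviation "oW \<equiv> par 3"
abbreviation "Ns \<equiv> par 4"
abbreviation "Bb \<equiv> par 5"
abbreviation "oQ \<equiv> par 6"
abbreviation "nR \<equiv> par 7"
abbreviation "K2 \<equiv> par 8"
abbreviation "oI \<equiv> par 9"
abbreviation "oS \<equiv> par 10"
abbreviation "L \<equiv> par 11"
abbreviation "Bn \<equiv> par 12"
abbreviation "oS2 \<equiv> par 13"
abbreviation "oH \<equiv> par 14"
abbreviation "K \<equiv> par 15"
abbreviation "n \<equiv> par 16"
abbreviation "oSg \<equiv> par 17"
abbreviation "oNx \<equiv> par 18"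
abbreviation "oSk \<equiv> par 19"
abbreviation "oP \<equiv> par 20"
abbreviation "thr \<equiv> par 21"
abbreviation "bud1 \<equiv> par 22"
abbreviation "bud2 \<equiv> par 23"

definition W :: "nat \<Rightarrow> nat" where "W i = v i (g i)"
text \<open>Index \<open>nW\<close> is padding with value 0. It lets half rows of different lengths
  be summed by the same loop of \<open>K2\<close> steps.\<close>

definition Wz :: "nat \<Rightarrow> nat" where "Wz i = (if i < nW then W i else 0)"
definition qsk :: "nat \<Rightarrow> nat" where "qsk j = horner (\<lambda>b. W (nW + j * Bb + b) mod 2) Bb"
definition sigq :: "nat \<Rightarrow> nat" where "sigq r = (\<Sum>j<K2. Wz (ix r j)) mod 2 ^ w"
definition st :: "nat \<Rightarrow> nat" where "st t = (sigq (t div Bn) + sigq (nA + t mod Bn)) mod 2 ^ w"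
definition mism :: "nat \<Rightarrow> nat" where "mism x = (\<Sum>j<Ns. popcount (sk x j XOR qsk j))"
definition es :: "nat \<Rightarrow> nat \<Rightarrow> (bool \<times> nat) list" where
  "es t y = map (\<lambda>x. (sg t x = st t, x)) (filter (\<lambda>x. sg t x mod K = st t mod K) [y..<n])"
definition pars :: "(nat \<Rightarrow> nat) \<Rightarrow> bool" where "pars f \<longleftrightarrow> (\<forall>r<24. f r = par r)"

lemma pars_upd [simp]: "24 \<le> r \<Longrightarrow> pars (f(r := a)) = pars f"
  by (auto simp: pars_def)

lemma parsD: "pars (regs s) \<Longrightarrow> r < 24 \<Longrightarrow> regs s r = par r"
  by (auto simp: pars_def)

lemma parsD1: "pars (regs s) \<Longrightarrow> regs s (Suc 0) = par (Suc 0)"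
  by (auto simp: pars_def)

end

text \<open>The contract between preprocessing and query. The strict inequalities among the offsets
  leave room for the zero cell behind the hash words, for key and link arrays whose entries are
  numbered from 1, and for pointers that end one position past their array.\<close>

locale nn_layout = nn_memory w S m g v par mem0 ix sg sk nA ro
  for w S m :: nat and g :: "nat \<Rightarrow> 'r" and v :: "nat \<Rightarrow> 'r \<Rightarrow> nat"
    and par mem0 :: "nat \<Rightarrow> nat" and ix sg sk :: "nat \<Rightarrow> nat \<Rightarrow> nat" and nA ro :: nat +
  assumes par_mem: "\<And>r. r < 24 \<Longrightarrow> mem0 r = par r"
    and par0: "par 0 = 0" and par1: "par (Suc 0) = 1"
    and m_eq: "m = nW + Ns * Bb" and m_less: "m < 2 ^ w"
    and W_less: "\<And>i. i < m \<Longrightarrow> v i (g i) < 2 ^ w"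
    and K_eq: "K = 2 ^ Bb" and Bb_w: "Bb < w"
    and S_le: "S \<le> 2 ^ w"
    and lay: "24 \<le> oW" "oW + nW < oQ" "oQ + Ns \<le> oS" "oS + nR \<le> ro" "ro \<le> S"
      "ro \<le> oI" "oI + nR * K2 < S" "ro \<le> oP" "oP + K \<le> S" "ro \<le> oH" "oH + L * K \<le> S"
      "ro \<le> oSg" "oSg + L * n < S" "ro \<le> oNx" "oNx + L * n < S" "ro \<le> oSk" "oSk + n * Ns < S"
      "L < 2 ^ w" "K2 < 2 ^ w"
    and zero_cell: "mem0 (oW + nW) = 0"
    and rows: "nA + Bn = nR" "0 < Bn" "L = nA * Bn" "oS2 = oS + nA"
    and bud: "0 < bud1" "0 < bud2" "bud1 < 2 ^ w" "bud2 < 2 ^ w"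
    and ix_le: "\<And>r j. r < nR \<Longrightarrow> j < K2 \<Longrightarrow> ix r j \<le> nW"
    and sk_less: "\<And>x j. x < n \<Longrightarrow> j < Ns \<Longrightarrow> sk x j < 2 ^ Bb"
    and mem_ix: "\<And>r j. r < nR \<Longrightarrow> j < K2 \<Longrightarrow> mem0 (oI + (r * K2 + j)) = oW + ix r j"
    and mem_pc: "\<And>a. a < K \<Longrightarrow> mem0 (oP + a) = popcount a"
    and mem_head: "\<And>t b. t < L \<Longrightarrow> b < K \<Longrightarrow>
      mem0 (oH + (t * K + b)) = next_entry (\<lambda>x. sg t x mod K = b) 0 n"
    and mem_sg: "\<And>t x. t < L \<Longrightarrow> x < n \<Longrightarrow> mem0 (oSg + (t * n + Suc x)) = sg t x"
    and mem_nx: "\<And>t x. t < L \<Longrightarrow> x < n \<Longrightarrow>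
      mem0 (oNx + (t * n + Suc x)) = next_entry (\<lambda>y. sg t y mod K = sg t x mod K) (Suc x) n"
    and mem_sk: "\<And>x j. x < n \<Longrightarrow> j < Ns \<Longrightarrow> mem0 (oSk + (x * Ns + j)) = sk x j"
begin

lemma less_w: "a < S \<Longrightarrow> a < 2 ^ w"
  using S_le by simp

section \<open>Correctness and cost of the phases before the search\<close>

lemma cp_load_params:
  assumes "k \<le> 24"
  shows "cp (load_params k) s (\<lambda>e t s'. e = 0 \<and> t = 2 * k + 1 \<and> mem s' = mem s \<and>
    (\<forall>i<k. regs s' i = mem s i))"
  using assms
proof (induction k)
  case 0
  show ?case unfolding load_params.simps by (rule cpI[OF exec.Skip]) auto
next
  case (Suc k)
  have k: "k < S" using Suc.prems lay by linarith
  hence "k mod 2 ^ w = k" using less_w by auto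
  hence "cp (load_params k) s (\<lambda>e t s1. cp (Seq (Const k k) (Load k k)) s1 (\<lambda>e2 t2 s'.
     e + e2 = 0 \<and> t + t2 = 2 * Suc k + 1 \<and> mem s' = mem s \<and> (\<forall>i<Suc k. regs s' i = mem s i)))"
    using k Suc.prems by (intro cp_mono[OF Suc.IH]) (auto simp: less_Suc_eq)
  thus ?case unfolding load_params.simps cp_Seq .
qed

text \<open>The predicates \<open>mem1\<close>, \<open>mem2\<close> and \<open>mem3\<close> describe
  the memory after successive phases and keep only what later phases read. So \<open>mem2\<close>
  replaces the zero cell by the padded \<open>Wz\<close>, and \<open>mem3\<close> forgets the hash
  words once the signatures are computed.\<close>

definition mem1 :: "(nat \<Rightarrow> nat) \<Rightarrow> bool" where
  "mem1 \<mu> \<longleftrightarrow> (\<forall>i<nW. \<mu> (oW + i) = W i) \<and> (\<forall>a\<ge>oW + nW. \<mu> a = mem0 a)"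

lemma cp_hash_words:
  assumes "pars (regs s)" "mem s = mem0"
  shows "cp hash_words s (\<lambda>e t s'. e \<le> nW * 1 \<and> t \<le> nW * (3 + 3) + 3 \<and>
    (pars (regs s') \<and> mem1 (mem s')))"
proof -
  let ?I = "\<lambda>j (s :: 'r ram_state). pars (regs s) \<and> (\<forall>i<j. mem s (oW + i) = W i) \<and> (\<forall>a\<ge>oW + nW. mem s a = mem0 a)"
  have "cp hash_words s (\<lambda>e t s'. e \<le> nW * 1 \<and> t \<le> nW * (3 + 3) + 3 \<and> ?I nW s')"
    unfolding hash_words_def
  proof (rule cp_For[where Inv = ?I and N = nW])
    show "?I 0 s" using assms by auto
    show "nW < 2 ^ w" using m_less m_eq by simp
    fix j and s :: "'r ram_state" assume j: "j < nW" and I: "?I j s" and r: "regs s 34 = j"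
    have a: "oW + j < S" using j lay by linarith
    have jm: "j < m" using j m_eq by simp
    show "cp (Block [Hash 34, Univ 31 34, Op Add 32 3 34, Store 32 31]) s
      (\<lambda>e t s'. e \<le> 1 \<and> t \<le> 3 \<and> ?I (Suc j) s' \<and> regs s' 34 = j)"
      using I r a less_w[OF a] jm j by (auto simp: parsD W_def less_Suc_eq)
  qed (auto simp: par1 parsD parsD1)
  thus ?thesis by (rule cp_mono) (auto simp: mem1_def)
qed

definition mem2 :: "(nat \<Rightarrow> nat) \<Rightarrow> bool" where
  "mem2 \<mu> \<longleftrightarrow> (\<forall>i\<le>nW. \<mu> (oW + i) = Wz i) \<and> (\<forall>j<Ns. \<mu> (oQ + j) = qsk j) \<and>
     (\<forall>a\<ge>oQ + Ns. \<mu> a = mem0 a)"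

lemma cp_sketch_words:
  assumes "pars (regs s)" "mem1 (mem s)"
  shows "cp sketch_words s (\<lambda>e t s'. e \<le> Ns * (Bb * 1) \<and> t \<le> Suc (Ns * (Bb * 8 + 6 + 3) + 3) \<and>
    (pars (regs s') \<and> mem2 (mem s')))"
proof -
  let ?f = "\<lambda>j b. W (nW + j * Bb + b) mod 2"
  have f2: "?f j b < 2" for j b by simp
  have Bw: "2 ^ Bb < (2 ^ w :: nat)" using Bb_w by simp
  let ?M = "\<lambda>j \<mu>. (\<forall>i\<le>nW. \<mu> (oW + i) = Wz i) \<and> (\<forall>i<j. \<mu> (oQ + i) = qsk i) \<and>
     (\<forall>a\<ge>oQ + Ns. \<mu> a = mem0 a)"
  let ?I = "\<lambda>j (s :: 'r ram_state). pars (regs s) \<and> regs s 30 = nW + j * Bb \<and> ?M j (mem s)"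
  let ?s = "s\<lparr>regs := (regs s)(30 := nW)\<rparr>"
  have I0: "?I 0 ?s"
    using assms zero_cell lay(2) by (auto simp: mem1_def Wz_def)
  have "cp (For 33 34 4 (Block [Const 37 0,
     For 36 35 5 (Block [Hash 30, Univ 31 30, Op And 31 31 1, Op Add 37 37 37, Op Add 37 37 31,
       Op Add 30 30 1]),
     Op Add 32 6 34, Store 32 37])) ?s
     (\<lambda>e t s'. e \<le> Ns * (Bb * 1) \<and> t \<le> Ns * (Bb * 8 + 6 + 3) + 3 \<and> ?I Ns s')"
  proof (rule cp_For[where Inv = ?I and N = Ns])
    show "?I 0 ?s" by (rule I0)
    show "Ns < 2 ^ w" using lay less_w by auto
    fix j and s :: "'r ram_state" assume j: "j < Ns" and I: "?I j s" and r: "regs s 34 = j"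
    have a: "oQ + j < S" using j lay by linarith
    have jB: "nW + j * Bb + Bb \<le> m"
    proof -
      have "Suc j * Bb \<le> Ns * Bb" using j by (intro mult_le_mono1) auto
      thus ?thesis using m_eq by simp
    qed
    let ?J = "\<lambda>b (s :: 'r ram_state). pars (regs s) \<and> regs s 30 = nW + j * Bb + b \<and> regs s 34 = j \<and>
      regs s 37 = horner (?f j) b \<and> ?M j (mem s)"
    have "cp (For 36 35 5 (Block [Hash 30, Univ 31 30, Op And 31 31 1, Op Add 37 37 37,
        Op Add 37 37 31, Op Add 30 30 1])) (s\<lparr>regs := (regs s)(37 := 0)\<rparr>)
        (\<lambda>e t s'. e \<le> Bb * 1 \<and> t \<le> Bb * (5 + 3) + 3 \<and> ?J Bb s')"
    proof (rule cp_For[where Inv = ?J and N = Bb])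
      show "?J 0 (s\<lparr>regs := (regs s)(37 := 0)\<rparr>)" using I r by auto
      show "Bb < 2 ^ w" using Bb_w less_exp[of w] by linarith
      fix b and s :: "'r ram_state" assume b: "b < Bb" and J: "?J b s" and r: "regs s 35 = b"
      have i: "nW + j * Bb + b < m" using b jB by linarith
      \<comment> \<open>At most \<open>Bb < w\<close> bits go into a word, so neither doubling nor
        adding a bit wraps around.\<close>
      have h: "horner (?f j) (Suc b) < 2 ^ w"
      proof -
        have "horner (?f j) (Suc b) < 2 ^ Suc b" using f2 by (rule horner_less)
        also have "\<dots> \<le> 2 ^ w" using b Bb_w by (intro power_increasing) auto
        finally show ?thesis .
      qed
      hence h1: "horner (?f j) b + horner (?f j) b < 2 ^ w" by simp
      have h2: "horner (?f j) b + horner (?f j) b + W (nW + j * Bb + b) mod 2 < 2 ^ w"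
        using h by simp
      have i2: "Suc (nW + j * Bb + b) < 2 ^ w" using i m_less by linarith
      show "cp (Block [Hash 30, Univ 31 30, Op And 31 31 1, Op Add 37 37 37, Op Add 37 37 31,
       Op Add 30 30 1]) s (\<lambda>e t s'. e \<le> 1 \<and> t \<le> 5 \<and> ?J (Suc b) s' \<and> regs s' 35 = b)"
        using J r i h1 h2 i2 by (auto simp: parsD1 par1 and_one_eq W_def[symmetric])
    qed (auto simp: par1 parsD parsD1)
    hence "cp (For 36 35 5 (Block [Hash 30, Univ 31 30, Op And 31 31 1, Op Add 37 37 37,
        Op Add 37 37 31, Op Add 30 30 1])) (s\<lparr>regs := (regs s)(37 := 0)\<rparr>) (\<lambda>e t s.
        cp (Block [Op Add 32 6 34, Store 32 37]) s
        (\<lambda>e' t' s'. e + e' \<le> Bb * 1 \<and> Suc (t + t') \<le> Bb * 8 + 6 \<and> ?I (Suc j) s' \<and> regs s' 34 = j))"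
      using a less_w[OF a] j lay(1-2)
      by (elim cp_mono) (auto simp: parsD qsk_def[symmetric] less_Suc_eq)
    thus "cp (Block [Const 37 0,
       For 36 35 5 (Block [Hash 30, Univ 31 30, Op And 31 31 1, Op Add 37 37 37, Op Add 37 37 31,
         Op Add 30 30 1]),
       Op Add 32 6 34, Store 32 37]) s
       (\<lambda>e t s'. e \<le> Bb * 1 \<and> t \<le> Bb * 8 + 6 \<and> ?I (Suc j) s' \<and> regs s' 34 = j)"
      by simp
  qed (auto simp: par1 parsD parsD1)
  moreover have "nW mod 2 ^ w = nW" using m_less m_eq by simp
  ultimately show ?thesis
    using assms(1) unfolding sketch_words_def
    by (simp add: parsD par0 mem2_def conj_ac) (erule cp_mono, auto)
qed

definition mem3 :: "(nat \<Rightarrow> nat) \<Rightarrow> bool" where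
  "mem3 \<mu> \<longleftrightarrow> (\<forall>j<Ns. \<mu> (oQ + j) = qsk j) \<and> (\<forall>r<nR. \<mu> (oS + r) = sigq r) \<and>
     (\<forall>a\<ge>ro. \<mu> a = mem0 a)"

lemma cp_signatures:
  assumes "pars (regs s)" "mem2 (mem s)"
  shows "cp signatures s (\<lambda>e t s'. e = 0 \<and> t \<le> Suc (nR * (K2 * 7 + 6 + 3) + 3) \<and>
    (pars (regs s') \<and> mem3 (mem s')))"
proof -
  let ?M = "\<lambda>j \<mu>. (\<forall>i\<le>nW. \<mu> (oW + i) = Wz i) \<and> (\<forall>i<Ns. \<mu> (oQ + i) = qsk i) \<and>
     (\<forall>i<j. \<mu> (oS + i) = sigq i) \<and> (\<forall>a\<ge>ro. \<mu> a = mem0 a)"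
  let ?I = "\<lambda>j (s :: 'r ram_state). pars (regs s) \<and> regs s 38 = oI + j * K2 \<and> ?M j (mem s)"
  let ?s = "s\<lparr>regs := (regs s)(38 := oI)\<rparr>"
  have I0: "?I 0 ?s"
    using assms lay by (auto simp: mem2_def)
  have "cp (For 33 34 7 (Block [Const 37 0,
     For 36 35 8 (Block [Load 32 38, Load 31 32, Op Add 37 37 31, Op Add 38 38 1]),
     Op Add 32 10 34, Store 32 37])) ?s
     (\<lambda>e t s'. e \<le> nR * 0 \<and> t \<le> nR * (K2 * 7 + 6 + 3) + 3 \<and> ?I nR s')"
  proof (rule cp_For[where Inv = ?I and N = nR])
    show "?I 0 ?s" by (rule I0)
    show "nR < 2 ^ w" using lay less_w by auto
    fix j and s :: "'r ram_state" assume j: "j < nR" and I: "?I j s" and r: "regs s 34 = j"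
    have a: "oS + j < S" using j lay by linarith
    have jK: "oI + j * K2 + K2 < S"
    proof -
      have "Suc j * K2 \<le> nR * K2" using j by (intro mult_le_mono1) auto
      thus ?thesis using lay by simp
    qed
    let ?J = "\<lambda>b (s :: 'r ram_state). pars (regs s) \<and> regs s 38 = oI + j * K2 + b \<and> regs s 34 = j \<and>
      regs s 37 = (\<Sum>i<b. Wz (ix j i)) mod 2 ^ w \<and> ?M j (mem s)"
    have "cp (For 36 35 8 (Block [Load 32 38, Load 31 32, Op Add 37 37 31, Op Add 38 38 1]))
        (s\<lparr>regs := (regs s)(37 := 0)\<rparr>)
        (\<lambda>e t s'. e \<le> K2 * 0 \<and> t \<le> K2 * (4 + 3) + 3 \<and> ?J K2 s')"
    proof (rule cp_For[where Inv = ?J and N = K2])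
      show "?J 0 (s\<lparr>regs := (regs s)(37 := 0)\<rparr>)" using I r by auto
      show "K2 < 2 ^ w" by (rule lay)
      fix b and s :: "'r ram_state" assume b: "b < K2" and J: "?J b s" and r: "regs s 35 = b"
      have i: "oI + j * K2 + b < S" using b jK by linarith
      have mi: "mem s (oI + j * K2 + b) = oW + ix j b"
        using J mem_ix[OF j b] lay by (simp add: add.assoc)
      have x: "ix j b \<le> nW" using ix_le j b by simp
      hence xS: "oW + ix j b < S" using lay by linarith
      have i2: "Suc (oI + j * K2 + b) < 2 ^ w" using jK b S_le by linarith
      show "cp (Block [Load 32 38, Load 31 32, Op Add 37 37 31, Op Add 38 38 1]) s
          (\<lambda>e t s'. e \<le> 0 \<and> t \<le> 4 \<and> ?J (Suc b) s' \<and> regs s' 35 = b)"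
        using J r i x xS mi i2 by (auto simp: parsD1 par1 mod_simps)
    qed (auto simp: par1 parsD parsD1)
    hence "cp (For 36 35 8 (Block [Load 32 38, Load 31 32, Op Add 37 37 31, Op Add 38 38 1]))
        (s\<lparr>regs := (regs s)(37 := 0)\<rparr>) (\<lambda>e t s.
        cp (Block [Op Add 32 10 34, Store 32 37]) s
        (\<lambda>e' t' s'. e + e' \<le> 0 \<and> Suc (t + t') \<le> K2 * 7 + 6 \<and> ?I (Suc j) s' \<and> regs s' 34 = j))"
      using a less_w[OF a] j lay(1-6)
      by (elim cp_mono) (auto simp: parsD sigq_def[symmetric] less_Suc_eq)
    thus "cp (Block [Const 37 0,
     For 36 35 8 (Block [Load 32 38, Load 31 32, Op Add 37 37 31, Op Add 38 38 1]),
     Op Add 32 10 34, Store 32 37]) s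
       (\<lambda>e t s'. e \<le> 0 \<and> t \<le> K2 * 7 + 6 \<and> ?I (Suc j) s' \<and> regs s' 34 = j)"
      by simp
  qed (auto simp: par1 parsD parsD1)
  moreover have "oI mod 2 ^ w = oI" using lay less_w by auto
  ultimately show ?thesis
    using assms(1) unfolding signatures_def
    by (simp add: parsD par0 mem3_def conj_ac) (erule cp_mono, auto)
qed

end

context nn_layout
begin

lemma sk_qsk_less: "x < n \<Longrightarrow> j < Ns \<Longrightarrow> sk x j XOR qsk j < 2 ^ Bb"
  unfolding qsk_def by (intro xor_less_power2 sk_less horner_less) auto

lemma cp_compare_sketch:
  assumes "pars (regs s)" "mem3 (mem s)" "regs s 40 < n"
  shows "cp compare_sketch s (\<lambda>e t s'. e = 0 \<and> t \<le> Ns * 11 + 6 \<and> regs s' 52 = mism (regs s 40) \<and>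
    mem s' = mem s \<and> (\<forall>r. r \<notin> {31, 32, 35, 36, 52, 53} \<longrightarrow> regs s' r = regs s r))"
proof -
  define x where "x = regs s 40"
  have x: "x < n" using assms x_def by simp
  have xN: "x * Ns + Ns \<le> n * Ns"
  proof -
    have "Suc x * Ns \<le> n * Ns" using x by (intro mult_le_mono1) auto
    thus ?thesis by simp
  qed
  let ?I = "\<lambda>j (s' :: 'r ram_state). regs s' 52 = (\<Sum>i<j. popcount (sk x i XOR qsk i)) \<and>
    regs s' 53 = oSk + (x * Ns + j) \<and> mem s' = mem s \<and>
    (\<forall>r. r \<notin> {31, 32, 35, 36, 52, 53} \<longrightarrow> regs s' r = regs s r)"
  let ?s = "s\<lparr>regs := (regs s)(52 := 0, 53 := oSk + x * Ns)\<rparr>"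
  have mism_le: "(\<Sum>i<j. popcount (sk x i XOR qsk i)) \<le> j * Bb" if "j \<le> Ns" for j
  proof -
    have "(\<Sum>i<j. popcount (sk x i XOR qsk i)) \<le> (\<Sum>i<j. Bb)"
      using that sk_qsk_less[OF x] by (intro sum_mono popcount_less) auto
    thus ?thesis by simp
  qed
  have "cp (For 36 35 4 (Block [Load 31 53, Op Add 32 6 35, Load 32 32, Op Xor 31 31 32,
      Op Add 31 20 31, Load 31 31, Op Add 52 52 31, Op Add 53 53 1])) ?s
      (\<lambda>e t s'. e \<le> Ns * 0 \<and> t \<le> Ns * (8 + 3) + 3 \<and> ?I Ns s')"
  proof (rule cp_For[where Inv = ?I and N = Ns])
    show "?I 0 ?s" by auto
    show "Ns < 2 ^ w" using lay less_w by auto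
    show "regs s 4 = Ns \<and> regs s 1 = 1" if "?I j s" for j and s :: "'r ram_state"
      using that assms by (auto simp: parsD parsD1 par1)
    fix j and s' :: "'r ram_state" assume j: "j < Ns" and I: "?I j s'" and r: "regs s' 35 = j"
    have a1: "oSk + (x * Ns + j) < S" using lay xN j by linarith
    have a2: "oQ + j < S" using lay j by linarith
    have X: "sk x j XOR qsk j < K" using sk_qsk_less[OF x j] K_eq by simp
    have a3: "oP + (sk x j XOR qsk j) < S" using X lay by linarith
    have a4: "Suc (oSk + (x * Ns + j)) < 2 ^ w" using lay xN j S_le by linarith
    have m1: "mem s (oSk + (x * Ns + j)) = sk x j"
      using mem_sk[OF x j] assms(2) lay by (simp add: mem3_def)
    have m2: "mem s (oQ + j) = qsk j"
      using assms(2) j by (simp add: mem3_def)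
    have m3: "mem s (oP + (sk x j XOR qsk j)) = popcount (sk x j XOR qsk j)"
      using mem_pc[OF X] assms(2) lay by (simp add: mem3_def)
    \<comment> \<open>The count of mismatches is at most the number \<open>Ns * Bb\<close> of sketch
      functions, which itself fits into a word.\<close>
    have sm: "(\<Sum>i<j. popcount (sk x i XOR qsk i)) + popcount (sk x j XOR qsk j) < 2 ^ w"
    proof -
      have "(\<Sum>i<Suc j. popcount (sk x i XOR qsk i)) \<le> Suc j * Bb" using j by (intro mism_le) auto
      also have "\<dots> \<le> Ns * Bb" using j by (intro mult_le_mono1) auto
      also have "\<dots> < 2 ^ w" using m_eq m_less by linarith
      finally show ?thesis by simp
    qed
    have rs: "regs s' 6 = oQ" "regs s' 20 = oP" "regs s' (Suc 0) = 1"
      using I assms by (auto simp: parsD parsD1 par1)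
    show "cp (Block [Load 31 53, Op Add 32 6 35, Load 32 32, Op Xor 31 31 32, Op Add 31 20 31,
       Load 31 31, Op Add 52 52 31, Op Add 53 53 1]) s'
       (\<lambda>e t s'. e \<le> 0 \<and> t \<le> 8 \<and> ?I (Suc j) s' \<and> regs s' 35 = j)"
      using I r a1 a2 a3 a4 less_w[OF a2] less_w[OF a3] m1 m2 m3 sm rs
      by auto
  qed auto
  moreover have "x * Ns mod 2 ^ w = x * Ns" "(oSk + x * Ns) mod 2 ^ w = oSk + x * Ns"
    using lay xN less_w by auto
  ultimately show ?thesis
    using assms(1) x_def[symmetric] unfolding compare_sketch_def
    by (simp add: parsD mism_def add.commute[of _ oSk]) (erule cp_mono, auto)
qed

section \<open>The search loop as a scan of the concatenated chains\<close>

definition all_es :: "nat \<Rightarrow> (bool \<times> nat) list" where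
  "all_es t = concat (map (\<lambda>t. es t 0) [t..<L])"

text \<open>The entries still to be examined when \<open>t\<close> is the next table to open and
  \<open>p\<close> the encoded current entry. A nonzero \<open>p\<close> belongs to the table opened
  last, which is \<open>t - 1\<close>.\<close>

definition rest :: "nat \<Rightarrow> nat \<Rightarrow> (bool \<times> nat) list" where
  "rest t p = (if p = 0 then [] else es (t - 1) (p - 1)) @ all_es t"

definition search_result :: nat where
  "search_result = scan (\<lambda>x. mism x \<le> thr) (all_es 0) 0 bud1 bud2"

text \<open>Scanning what remains, from the current answer and budgets, still gives the final
  result. The last clause places the current entry in the bucket of the query, without which the
  links stored for the bucket of the entry would say nothing about the query.\<close>

definition SInv :: "'r ram_state \<Rightarrow> bool" where
  "SInv s \<longleftrightarrow> pars (regs s) \<and> mem3 (mem s) \<and> regs s 42 \<le> L \<and>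
     (if regs s 41 = 0 then regs s 40 = search_result
      else 0 < regs s 46 \<and> 0 < regs s 47 \<and> regs s 46 < 2 ^ w \<and> regs s 47 < 2 ^ w \<and>
        scan (\<lambda>x. mism x \<le> thr) (rest (regs s 42) (regs s 43)) (regs s 40) (regs s 46) (regs s 47)
          = search_result \<and>
        (regs s 43 \<noteq> 0 \<longrightarrow> 0 < regs s 42 \<and> regs s 43 \<le> n \<and> regs s 44 = (regs s 42 - 1) * n \<and>
           regs s 45 = st (regs s 42 - 1) \<and>
           sg (regs s 42 - 1) (regs s 43 - 1) mod K = st (regs s 42 - 1) mod K))"

text \<open>Every iteration is charged to what it consumes: a table, a match or a spurious entry. A
  match also pays for comparing \<open>Ns\<close> sketch words. The \<open>Suc\<close> covers the
  last iteration, which finds no table left.\<close>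

definition potential :: "'r ram_state \<Rightarrow> nat" where
  "potential s = (if regs s 41 = 0 then 0 else
     20 * Suc (L - regs s 42) + (Ns * 11 + 30) * regs s 46 + 20 * regs s 47)"

lemma scan_entry_mod: "(a + 2 ^ w - 1) mod 2 ^ w = a - 1" if "0 < a" "a < 2 ^ w" for a :: nat
proof -
  have "a + 2 ^ w - 1 = (a - 1) + 2 ^ w" using that by simp
  hence "(a + 2 ^ w - 1) mod 2 ^ w = ((a - 1) + 2 ^ w) mod 2 ^ w" by (rule arg_cong)
  also have "\<dots> = a - 1" using that by (simp only: mod_add_self2) (intro mod_less, simp)
  finally show ?thesis .
qed

lemma cp_search_step_table:
  assumes I: "SInv s" and go: "regs s 41 \<noteq> 0" and p: "regs s 43 = 0"
  shows "cp search_step s (\<lambda>e t s'. e = 0 \<and> SInv s' \<and> Suc t + potential s' \<le> potential s)"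
proof (cases "regs s 42 < L")
  case False
  have P: "pars (regs s)" using I by (simp add: SInv_def)
  have "regs s 42 = L" using False I by (auto simp: SInv_def)
  hence "search_result = regs s 40" using I go p by (auto simp: SInv_def rest_def all_es_def)
  thus ?thesis
    using I go p P False unfolding search_step_def potential_def
    by (simp add: parsD) (auto simp: SInv_def)
next
  case True
  define t where "t = regs s 42"
  have t: "t < L" using True t_def by simp
  have P: "pars (regs s)" and M: "mem3 (mem s)" using I by (auto simp: SInv_def)
  have dA: "t div Bn < nA" using t rows by (simp add: less_mult_imp_div_less)
  have mB: "t mod Bn < Bn" using rows by simp
  have m1: "mem s (oS + t div Bn) = sigq (t div Bn)"
    using M dA rows by (auto simp: mem3_def)
  have m2: "mem s (oS2 + t mod Bn) = sigq (nA + t mod Bn)"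
  proof -
    have "nA + t mod Bn < nR" using mB rows by linarith
    thus ?thesis using M rows(4) by (simp add: mem3_def add.assoc)
  qed
  have a1: "oS + t div Bn < S" using dA rows lay by linarith
  have a2: "oS2 + t mod Bn < S" using mB rows lay by linarith
  have kb: "st t mod K < K" using K_eq by simp
  have tK: "t * K + K \<le> L * K"
  proof -
    have "Suc t * K \<le> L * K" using t by (intro mult_le_mono1) auto
    thus ?thesis by simp
  qed
  have a3: "oH + (t * K + st t mod K) < S" using tK kb lay by linarith
  have tn: "t * n + n \<le> L * n"
  proof -
    have "Suc t * n \<le> L * n" using t by (intro mult_le_mono1) auto
    thus ?thesis by simp
  qed
  have b: "t * K < 2 ^ w" "t * n < 2 ^ w" "Suc t < 2 ^ w" "t * K + st t mod K < 2 ^ w"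
    using tK tn kb t lay S_le by linarith+
  let ?N = "next_entry (\<lambda>x. sg t x mod K = st t mod K) 0 n"
  have m3: "mem s (oH + (t * K + st t mod K)) = ?N"
    using mem_head[OF t kb] M lay by (auto simp: mem3_def)
  have all: "all_es t = es t 0 @ all_es (Suc t)"
    using t by (simp add: all_es_def upt_conv_Cons)
  have es0: "es t 0 = (if ?N = 0 then [] else es t (?N - 1))"
    unfolding es_def by (subst filter_upt_next_entry(1)) simp
  \<comment> \<open>Opening a table replaces the end marker 0 by the head of the chain and leaves
    the list of entries to be examined unchanged.\<close>
  have R: "rest t 0 = rest (Suc t) ?N"
    by (simp add: rest_def all es0)
  have N: "?N \<le> n" "?N \<noteq> 0 \<longrightarrow> sg t (?N - 1) mod K = st t mod K"
    using next_entry_le filter_upt_next_entry(2)[of "\<lambda>x. sg t x mod K = st t mod K" 0 n] by auto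
  have sm: "(sigq (t div Bn) + sigq (nA + t mod Bn)) mod 2 ^ w = st t" by (simp add: st_def)
  have L1: "Suc (L - Suc t) = L - t" using t by simp
  have r42: "regs s 42 = t" by (simp add: t_def)
  note ms = mod_less[OF less_w[OF a1]] mod_less[OF less_w[OF a2]] mod_less[OF b(1)]
    mod_less[OF b(2)] mod_less[OF b(3)] mod_less[OF b(4), unfolded add.commute[of "t * K"]]
    mod_less[OF less_w[OF a3], unfolded add.commute[of "t * K"]]
  note pr = parsD[OF P] parsD1[OF P]
  have E: "cp search_step s (\<lambda>e t' s'. e = 0 \<and> t' = 17 \<and> pars (regs s') \<and> mem s' = mem s \<and>
     regs s' 42 = Suc t \<and> regs s' 43 = ?N \<and> regs s' 44 = t * n \<and> regs s' 45 = st t \<and>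
     regs s' 40 = regs s 40 \<and> regs s' 41 = regs s 41 \<and> regs s' 46 = regs s 46 \<and>
     regs s' 47 = regs s 47)"
    unfolding search_step_def
    by (simp add: pr P p t r42 par1 m1 m2 m3[unfolded add.commute[of "t * K"]] a1 a2
      a3[unfolded add.commute[of "t * K"]] ms sm)
  show ?thesis
  proof (rule cp_mono[OF E], goal_cases)
    case (1 e t' s')
    have "SInv s'" using I go p t R N M 1 r42 by (auto simp: SInv_def)
    moreover have "Suc t' + potential s' \<le> potential s"
      using 1 go r42 t by (simp add: potential_def L1)
    ultimately show ?case using 1 by blast
  qed
qed

lemma cp_search_step_entry:
  assumes I: "SInv s" and go: "regs s 41 \<noteq> 0" and p: "regs s 43 \<noteq> 0"
  shows "cp search_step s (\<lambda>e t s'. e = 0 \<and> SInv s' \<and> Suc t + potential s' \<le> potential s)"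
proof -
  define t where "t = regs s 42 - 1"
  define x where "x = regs s 43 - 1"
  have P: "pars (regs s)" and M: "mem3 (mem s)" using I by (auto simp: SInv_def)
  have r: "regs s 42 = Suc t" "regs s 43 = Suc x" "t < L" "x < n" "regs s 44 = t * n"
     "regs s 45 = st t" "sg t x mod K = st t mod K"
    using I go p by (auto simp: SInv_def t_def x_def)
  have b12: "0 < regs s 46" "0 < regs s 47" "regs s 46 < 2 ^ w" "regs s 47 < 2 ^ w"
    and SR: "scan (\<lambda>x. mism x \<le> thr) (rest (Suc t) (Suc x)) (regs s 40) (regs s 46) (regs s 47)
          = search_result"
    using I go r by (auto simp: SInv_def)
  have tn: "t * n + n \<le> L * n"
  proof -
    have "Suc t * n \<le> L * n" using r by (intro mult_le_mono1) auto
    thus ?thesis by simp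
  qed
  have a1: "oSg + (t * n + Suc x) < S" "oNx + (t * n + Suc x) < S"
    using tn r lay by linarith+
  have a2: "Suc (t * n + x) < 2 ^ w" "Suc x < 2 ^ w"
    using less_w[OF a1(1)] by linarith+
  let ?N = "next_entry (\<lambda>y. sg t y mod K = st t mod K) (Suc x) n"
  have m1: "mem s (oSg + (t * n + Suc x)) = sg t x"
    using mem_sg[OF r(3,4)] M lay by (auto simp: mem3_def)
  \<comment> \<open>The stored link continues the bucket of the entry \<open>x\<close>; by the
    invariant this is the bucket of the query key.\<close>
  have m2: "mem s (oNx + (t * n + Suc x)) = ?N"
    using mem_nx[OF r(3,4)] M lay r(7) by (auto simp: mem3_def)
  have "[x..<n] = x # [Suc x..<n]" using r by (simp add: upt_conv_Cons)
  hence "es t x = (sg t x = st t, x) # es t (Suc x)"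
    using r by (simp add: es_def)
  also have "es t (Suc x) = (if ?N = 0 then [] else es t (?N - 1))"
    unfolding es_def by (subst filter_upt_next_entry(1)) simp
  finally have R: "rest (Suc t) (Suc x) = (sg t x = st t, x) # rest (Suc t) ?N"
    by (simp add: rest_def)
  have N: "?N \<le> n" "?N \<noteq> 0 \<longrightarrow> sg t (?N - 1) mod K = st t mod K"
    using next_entry_le filter_upt_next_entry(2)[of "\<lambda>x. sg t x mod K = st t mod K" "Suc x" n] by auto
  note w1 = scan_entry_mod[OF b12(1,3)] scan_entry_mod[OF b12(2,4)]
  have x1: "(Suc x + 2 ^ w - 1) mod 2 ^ w = x" using scan_entry_mod[of "Suc x"] a2 by simp
  note step_facts = parsD[OF P] parsD1[OF P] P p r(1-6) par1 m1[simplified] m2[simplified]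
    a1[simplified] mod_less[OF a2(1)] mod_less[OF less_w[OF a1(1)], simplified]
    mod_less[OF less_w[OF a1(2)], simplified]
  show ?thesis
  proof (cases "sg t x = st t")
    case False
    have SR': "search_result = (if regs s 47 = 1 then regs s 40 else
        scan (\<lambda>x. mism x \<le> thr) (rest (Suc t) ?N) (regs s 40) (regs s 46) (regs s 47 - 1))"
      using SR False by (simp add: R)
    have E: "cp search_step s (\<lambda>e t' s'. e = 0 \<and> t' = 11 \<and> pars (regs s') \<and> mem s' = mem s \<and>
      regs s' 42 = Suc t \<and> regs s' 43 = ?N \<and> regs s' 44 = t * n \<and> regs s' 45 = st t \<and>
      regs s' 40 = regs s 40 \<and> regs s' 41 = regs s 47 - 1 \<and> regs s' 46 = regs s 46 \<and>
      regs s' 47 = regs s 47 - 1)"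
      unfolding search_step_def using False w1 by (simp add: step_facts)
    show ?thesis
    proof (rule cp_mono[OF E], goal_cases)
      case (1 e t' s')
      have "SInv s'" using 1 r M SR' N b12 by (auto simp: SInv_def)
      moreover have "Suc t' + potential s' \<le> potential s"
        using 1 go r b12 by (cases "regs s 47") (auto simp: potential_def)
      ultimately show ?case using 1 by blast
    qed
  next
    case True
    let ?s = "s\<lparr>regs := (regs s)(54 := t * n + Suc x, 49 := sg t x, 55 := oNx + (t * n + Suc x),
      48 := ?N, 50 := 1, 40 := x)\<rparr>"
    have SR': "search_result = (if mism x \<le> thr \<or> regs s 46 = 1 then x else
        scan (\<lambda>x. mism x \<le> thr) (rest (Suc t) ?N) x (regs s 46 - 1) (regs s 47))"
      using SR True by (simp add: R)
    have cs: "cp compare_sketch ?s (\<lambda>e t s'. e = 0 \<and> t \<le> Ns * 11 + 6 \<and> regs s' 52 = mism x \<and>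
      mem s' = mem s \<and> (\<forall>r. r \<notin> {31, 32, 35, 36, 52, 53} \<longrightarrow> regs s' r = regs ?s r))"
      by (rule cp_mono[OF cp_compare_sketch]) (use P M r in auto)
    let ?go = "if mism x \<le> thr then 0 else regs s 46 - 1"
    let ?b1 = "if mism x \<le> thr then regs s 46 else regs s 46 - 1"
    have E1: "cp compare_sketch ?s (\<lambda>e1 t1 s1. cp (Block [Op Less 50 21 52,
                If 50 (Block [Op Sub 46 46 1, Op Or 41 46 46]) (Const 41 0)]) s1
            (\<lambda>e2 t2 s2. e1 + e2 = 0 \<and> t1 + t2 \<le> Ns * 11 + 10 \<and> pars (regs s2) \<and> mem s2 = mem s \<and>
      regs s2 42 = Suc t \<and> regs s2 48 = ?N \<and> regs s2 44 = t * n \<and> regs s2 45 = st t \<and>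
      regs s2 40 = x \<and> regs s2 41 = ?go \<and> regs s2 46 = ?b1 \<and> regs s2 47 = regs s 47))"
    proof (rule cp_mono[OF cs])
      fix e1 t1 :: nat and s1 :: "'r ram_state"
      assume A: "e1 = 0 \<and> t1 \<le> Ns * 11 + 6 \<and> regs s1 52 = mism x \<and>
        mem s1 = mem s \<and> (\<forall>r. r \<notin> {31, 32, 35, 36, 52, 53} \<longrightarrow> regs s1 r = regs ?s r)"
      have P1: "pars (regs s1)" using A P by (auto simp: pars_def)
      have r1: "regs s1 40 = x" "regs s1 42 = Suc t" "regs s1 44 = t * n" "regs s1 45 = st t"
         "regs s1 46 = regs s 46" "regs s1 47 = regs s 47" "regs s1 48 = ?N" "regs s1 41 = regs s 41"
         "regs s1 52 = mism x" "mem s1 = mem s" "e1 = 0" "t1 \<le> Ns * 11 + 6"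
        using A r by auto
      show "cp (Block [Op Less 50 21 52,
                If 50 (Block [Op Sub 46 46 1, Op Or 41 46 46]) (Const 41 0)]) s1
            (\<lambda>e2 t2 s2. e1 + e2 = 0 \<and> t1 + t2 \<le> Ns * 11 + 10 \<and> pars (regs s2) \<and> mem s2 = mem s \<and>
      regs s2 42 = Suc t \<and> regs s2 48 = ?N \<and> regs s2 44 = t * n \<and> regs s2 45 = st t \<and>
      regs s2 40 = x \<and> regs s2 41 = ?go \<and> regs s2 46 = ?b1 \<and> regs s2 47 = regs s 47)"
        using r1(12) w1 by (simp add: r1(1-11) P1 parsD[OF P1] parsD1[OF P1] par1)
    qed
    have E: "cp search_step s (\<lambda>e t' s'. e = 0 \<and> t' \<le> Ns * 11 + 21 \<and> pars (regs s') \<and>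
      mem s' = mem s \<and>
      regs s' 42 = Suc t \<and> regs s' 43 = ?N \<and> regs s' 44 = t * n \<and> regs s' 45 = st t \<and>
      regs s' 40 = x \<and> regs s' 41 = ?go \<and> regs s' 46 = ?b1 \<and> regs s' 47 = regs s 47)"
      using E1 x1 True unfolding search_step_def
      by (simp add: step_facts split del: if_split) (erule cp_mono, simp split: if_splits)
    show ?thesis
    proof (rule cp_mono[OF E], goal_cases)
      case (1 e t' s')
      have "SInv s'" using 1 r M SR' N b12 by (auto simp: SInv_def split: if_splits)
      moreover have "Suc t' + potential s' \<le> potential s"
        using 1 go r b12 by (cases "regs s 46") (auto simp: potential_def split: if_splits)
      ultimately show ?case using 1 by blast
    qed
  qed
qed

lemma cp_search:
  assumes "pars (regs s)" "mem3 (mem s)"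
  shows "cp search s (\<lambda>e t s'. e = 0 \<and>
    t \<le> 20 * Suc L + (Ns * 11 + 30) * bud1 + 20 * bud2 + 10 \<and> regs s' 0 = search_result)"
proof -
  have w1: "1 mod 2 ^ w = (1::nat)" using Bb_w by (intro mod_less one_less_power) auto
  let ?s = "s\<lparr>regs := (regs s)(46 := bud1, 47 := bud2, 40 := 0, 41 := 1, 42 := 0, 43 := 0)\<rparr>"
  have I: "SInv ?s" using assms bud by (simp add: SInv_def rest_def search_result_def)
  have "cp (While 41 search_step) ?s
      (\<lambda>e t s'. e = 0 \<and> t \<le> Suc (potential ?s) \<and> SInv s' \<and> regs s' 41 = 0)"
    using I cp_search_step_table cp_search_step_entry by (intro cp_While) blast+
  thus ?thesis
    using assms w1 unfolding search_def
    by (simp add: parsD) (erule cp_mono, auto simp: SInv_def potential_def)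
qed

lemma cp_query_prog:
  assumes "mem s = mem0"
  shows "cp query_prog s (\<lambda>e t s'. e \<le> nW + Ns * Bb \<and>
    t \<le> 100 + 6 * nW + Ns * (Bb * 8 + 9) + nR * (K2 * 7 + 9) + 20 * L +
      (Ns * 11 + 30) * bud1 + 20 * bud2 \<and> regs s' 0 = search_result)"
proof -
  have "cp (load_params 24) s (\<lambda>e t s'. e = 0 \<and> t = 49 \<and> pars (regs s') \<and> mem s' = mem0)"
    by (rule cp_mono[OF cp_load_params]) (use assms par_mem in \<open>auto simp: pars_def\<close>)
  thus ?thesis unfolding query_prog_def Block.simps cp_Seq
  proof (rule cp_mono, goal_cases)
    case (1 e0 t0 s0)
    hence "cp hash_words s0 (\<lambda>e t s'. e \<le> nW * 1 \<and> t \<le> nW * (3 + 3) + 3 \<and>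
      (pars (regs s') \<and> mem1 (mem s')))" by (intro cp_hash_words) auto
    thus ?case
    proof (rule cp_mono, goal_cases)
      case (1 e1 t1 s1)
      hence "cp sketch_words s1 (\<lambda>e t s'. e \<le> Ns * (Bb * 1) \<and>
        t \<le> Suc (Ns * (Bb * 8 + 6 + 3) + 3) \<and> (pars (regs s') \<and> mem2 (mem s')))"
        by (intro cp_sketch_words) auto
      thus ?case
      proof (rule cp_mono, goal_cases)
        case (1 e2 t2 s2)
        hence "cp signatures s2 (\<lambda>e t s'. e = 0 \<and> t \<le> Suc (nR * (K2 * 7 + 6 + 3) + 3) \<and>
          (pars (regs s') \<and> mem3 (mem s')))" by (intro cp_signatures) auto
        thus ?case
        proof (rule cp_mono, goal_cases)
          case (1 e3 t3 s3)
          hence "cp search s3 (\<lambda>e t s'. e = 0 \<and>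
            t \<le> 20 * Suc L + (Ns * 11 + 30) * bud1 + 20 * bud2 + 10 \<and> regs s' 0 = search_result)"
            by (intro cp_search) auto
          thus ?case 
            by (rule cp_mono) (use 1 \<open>e2 \<le> _ \<and> _\<close> \<open>e1 \<le> _ \<and> _\<close> \<open>e0 = _ \<and> _\<close> in \<open>auto simp: algebra_simps\<close>)
        qed
      qed
    qed
  qed
qed

end

section \<open>Products of discrete distributions\<close>

lemma prob_bind_pmf:
  "measure_pmf.prob (bind_pmf p f) A = measure_pmf.expectation p (\<lambda>x. measure_pmf.prob (f x) A)"
proof -
  have "ennreal (measure_pmf.prob (bind_pmf p f) A) = (\<integral>\<^sup>+x. ennreal (measure_pmf.prob (f x) A) \<partial>p)"
    by (simp flip: measure_pmf.emeasure_eq_measure)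
  also have "\<dots> = ennreal (measure_pmf.expectation p (\<lambda>x. measure_pmf.prob (f x) A))"
    by (intro nn_integral_eq_integral measure_pmf.integrable_const_bound[where B = 1]) auto
  finally show ?thesis by (simp add: integral_nonneg)
qed

lemma prob_pair_pmf:
  "measure_pmf.prob (pair_pmf p q) {z. E (fst z) (snd z)} =
     measure_pmf.expectation p (\<lambda>x. measure_pmf.prob q {y. E x y})"
proof -
  have "pair_pmf p q = bind_pmf p (\<lambda>x. map_pmf (Pair x) q)"
    by (simp add: pair_pmf_def map_pmf_def)
  thus ?thesis by (simp add: prob_bind_pmf vimage_def)
qed

lemma prob_pair_pmf_swap:
  "measure_pmf.prob (pair_pmf p q) {z. E (fst z) (snd z)} =
     measure_pmf.expectation q (\<lambda>y. measure_pmf.prob p {x. E x y})"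
proof -
  have "measure_pmf.prob (pair_pmf p q) {z. E (fst z) (snd z)} =
      measure_pmf.prob (pair_pmf q p) {z. E (snd z) (fst z)}"
    by (subst pair_commute_pmf) (simp add: vimage_def case_prod_beta)
  also have "\<dots> = measure_pmf.expectation q (\<lambda>y. measure_pmf.prob p {x. E x y})"
    by (rule prob_pair_pmf)
  finally show ?thesis .
qed

lemma pmf_expectation_mono:
  fixes f g :: "'a \<Rightarrow> real"
  assumes "\<And>x. x \<in> set_pmf p \<Longrightarrow> 0 \<le> f x" "\<And>x. x \<in> set_pmf p \<Longrightarrow> f x \<le> g x"
    "\<And>x. x \<in> set_pmf p \<Longrightarrow> g x \<le> B"
  shows "measure_pmf.expectation p f \<le> measure_pmf.expectation p g"
proof -
  have "\<bar>f x\<bar> \<le> B" "\<bar>g x\<bar> \<le> B" if "x \<in> set_pmf p" for x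
    using assms(1-3)[OF that] by auto
  thus ?thesis using assms(2)
    by (intro integral_mono_AE measure_pmf.integrable_const_bound[where B = B] AE_pmfI) auto
qed

lemma pmf_expectation_le:
  fixes f :: "'a \<Rightarrow> real"
  assumes "\<And>x. x \<in> set_pmf p \<Longrightarrow> 0 \<le> f x" "\<And>x. x \<in> set_pmf p \<Longrightarrow> f x \<le> B"
  shows "measure_pmf.expectation p f \<le> B"
  using pmf_expectation_mono[of p f "\<lambda>_. B" B] assms by simp

lemma prob_pair_pmf_le_snd:
  assumes "\<And>y. y \<in> set_pmf q \<Longrightarrow> measure_pmf.prob p {x. E x y} \<le> \<epsilon>"
  shows "measure_pmf.prob (pair_pmf p q) {z. E (fst z) (snd z)} \<le> \<epsilon>"
  unfolding prob_pair_pmf_swap using assms by (intro pmf_expectation_le) auto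

lemma prob_pair_pmf_le_split:
  assumes "measure_pmf.prob p {x. A x} \<le> \<alpha>" "0 \<le> \<beta>"
    and "\<And>x. \<not> A x \<Longrightarrow> measure_pmf.prob q {y. E x y} \<le> \<beta>"
  shows "measure_pmf.prob (pair_pmf p q) {z. E (fst z) (snd z)} \<le> \<alpha> + \<beta>"
proof -
  have "measure_pmf.prob (pair_pmf p q) {z. E (fst z) (snd z)} \<le>
      measure_pmf.expectation p (\<lambda>x. indicator {x. A x} x + \<beta>)"
    unfolding prob_pair_pmf
  proof (rule pmf_expectation_mono[where B = "1 + \<beta>"])
    fix x
    show "measure_pmf.prob q {y. E x y} \<le> indicator {x. A x} x + \<beta>"
      using assms(3)[of x] assms(2) measure_pmf.prob_le_1[of q "{y. E x y}"]
      by (cases "A x") (auto simp del: measure_pmf.prob_le_1)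
  qed (auto simp: indicator_def)
  also have "\<dots> = measure_pmf.prob p {x. A x} + \<beta>"
    by (subst Bochner_Integration.integral_add) (auto simp: measure_pmf.emeasure_eq_measure)
  finally show ?thesis using assms(1) by simp
qed

lemma prob_Pi_pmf_subset:
  assumes "finite I" "J \<subseteq> I" and "\<And>f g. (\<And>i. i \<in> J \<Longrightarrow> f i = g i) \<Longrightarrow> E f = E g"
  shows "measure_pmf.prob (Pi_pmf I d p) {f. E f} = measure_pmf.prob (Pi_pmf J d p) {f. E f}"
proof -
  have "(\<lambda>f x. if x \<in> J then f x else d) -` {f. E f} = {f. E f}"
  proof -
    have "E (\<lambda>x. if x \<in> J then f x else d) = E f" for f by (rule assms(3)) simp
    thus ?thesis by (simp add: vimage_def)
  qed
  thus ?thesis using assms(1,2) by (simp add: Pi_pmf_subset[of I J])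
qed

lemma prob_Pi_pmf_Ball:
  assumes "finite I" "J \<subseteq> I"
  shows "measure_pmf.prob (Pi_pmf I d (\<lambda>_. p)) {f. \<forall>i\<in>J. C (f i)} =
    measure_pmf.prob p {y. C y} ^ card J"
proof -
  have fJ: "finite J" using assms finite_subset by blast
  have "measure_pmf.prob (Pi_pmf I d (\<lambda>_. p)) {f. \<forall>i\<in>J. C (f i)} =
    measure_pmf.prob (Pi_pmf J d (\<lambda>_. p)) {f. \<forall>i\<in>J. C (f i)}"
    using assms by (intro prob_Pi_pmf_subset) auto
  also have "\<dots> = measure_pmf.prob (Pi_pmf J d (\<lambda>_. p)) (Pi J (\<lambda>_. {y. C y}))"
    by (rule arg_cong[where f = "measure_pmf.prob _"]) auto
  also have "\<dots> = measure_pmf.prob p {y. C y} ^ card J"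
    using fJ by (subst measure_Pi_pmf_Pi) auto
  finally show ?thesis .
qed

text \<open>\<open>c\<close> is the event that a locality-sensitive function does not separate the two points, and
  \<open>a\<close>, \<open>b\<close> are the words to which a universal function sends their two values.\<close>

locale word_hash =
  fixes D :: "'y pmf" and c :: "'y \<Rightarrow> bool" and a b :: "'y \<Rightarrow> nat" and w :: nat
  assumes coll: "\<And>y. y \<in> set_pmf D \<Longrightarrow> c y \<Longrightarrow> a y = b y"
    and unif: "\<And>B s s'. B \<le> w \<Longrightarrow>
      measure_pmf.prob D {y. \<not> c y \<and> (a y + s) mod 2 ^ B = (b y + s') mod 2 ^ B} =
        (1 - measure_pmf.prob D {y. c y}) / 2 ^ B"
begin

abbreviation "pc \<equiv> measure_pmf.prob D {y. c y}"

text \<open>Induction over the coordinates, averaging over one of them. If the points are separated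
  there, the other coordinates can be fixed and \<open>unif\<close> contributes at most
  \<open>(1 - pc) / 2 ^ B\<close>; otherwise some other coordinate separates them and the induction
  hypothesis contributes at most \<open>pc / 2 ^ B\<close>. The offsets \<open>s\<close> and
  \<open>s'\<close> are arbitrary in order to absorb the coordinates already treated.\<close>

lemma sum_collision:
  assumes "finite J" "B \<le> w"
  shows "measure_pmf.prob (Pi_pmf J d (\<lambda>_. D))
    {f. \<not> (\<forall>i\<in>J. c (f i)) \<and> ((\<Sum>i\<in>J. a (f i)) + s) mod 2 ^ B = ((\<Sum>i\<in>J. b (f i)) + s') mod 2 ^ B}
    \<le> 1 / 2 ^ B"
  using assms(1)
proof (induction J arbitrary: s s' rule: finite_induct)
  case empty
  show ?case by simp
next
  case (insert i J)
  let ?P = "Pi_pmf J d (\<lambda>_. D)"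
  let ?S = "\<lambda>f. \<Sum>i\<in>J. a (f i)" and ?T = "\<lambda>f. \<Sum>i\<in>J. b (f i)"
  let ?E1 = "{z. c (fst z) \<and> (\<not> (\<forall>i\<in>J. c (snd z i)) \<and>
    (?S (snd z) + (s + a (fst z))) mod 2 ^ B = (?T (snd z) + (s' + b (fst z))) mod 2 ^ B)}"
  let ?E2 = "{z. \<not> c (fst z) \<and> (a (fst z) + (?S (snd z) + s)) mod 2 ^ B =
    (b (fst z) + (?T (snd z) + s')) mod 2 ^ B}"
  let ?E = "{f. \<not> (\<forall>i\<in>insert i J. c (f i)) \<and>
    ((\<Sum>i\<in>insert i J. a (f i)) + s) mod 2 ^ B = ((\<Sum>i\<in>insert i J. b (f i)) + s') mod 2 ^ B}"
  have cong: "(\<Sum>j\<in>J. h ((f(i := y)) j)) = (\<Sum>j\<in>J. h (f j))" for h :: "'y \<Rightarrow> nat" and f y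
    using insert.hyps by (intro sum.cong) auto
  have cong': "(\<forall>j\<in>J. c ((f(i := y)) j)) = (\<forall>j\<in>J. c (f j))" for f y
    using insert.hyps by auto
  have "measure_pmf.prob (Pi_pmf (insert i J) d (\<lambda>_. D)) ?E =
      measure_pmf.prob (pair_pmf D ?P) ((\<lambda>(y, f). f(i := y)) -` ?E)"
    using insert.hyps by (simp add: Pi_pmf_insert)
  also have "\<dots> \<le> measure_pmf.prob (pair_pmf D ?P) (?E1 \<union> ?E2)"
  proof (rule measure_pmf.finite_measure_mono)
    show "(\<lambda>(y, f). f(i := y)) -` ?E \<subseteq> ?E1 \<union> ?E2"
    proof
      fix z assume "z \<in> (\<lambda>(y, f). f(i := y)) -` ?E"
      hence z: "\<not> (\<forall>j\<in>insert i J. c (((snd z)(i := fst z)) j))"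
        "((\<Sum>j\<in>insert i J. a (((snd z)(i := fst z)) j)) + s) mod 2 ^ B =
         ((\<Sum>j\<in>insert i J. b (((snd z)(i := fst z)) j)) + s') mod 2 ^ B"
        by (auto simp: case_prod_beta)
      show "z \<in> ?E1 \<union> ?E2"
      proof -
        have z1: "\<not> (c (fst z) \<and> (\<forall>j\<in>J. c (snd z j)))"
          using z(1) by (metis cong' fun_upd_same insert_iff)
        have z2: "(a (fst z) + ?S (snd z) + s) mod 2 ^ B = (b (fst z) + ?T (snd z) + s') mod 2 ^ B"
          using z(2) unfolding sum.insert[OF insert.hyps] cong by simp
        show ?thesis
        proof (cases "c (fst z)")
          case True
          thus ?thesis using z1 z2 by (simp add: add_ac)
        next
          case False
          thus ?thesis using z2 by (simp add: add_ac)
        qed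
      qed
    qed
  qed auto
  also have "\<dots> \<le> measure_pmf.prob (pair_pmf D ?P) ?E1 + measure_pmf.prob (pair_pmf D ?P) ?E2"
    by (rule measure_Un_le) auto
  also have "measure_pmf.prob (pair_pmf D ?P) ?E1 = measure_pmf.expectation D (\<lambda>y.
      measure_pmf.prob ?P {f. c y \<and> \<not> (\<forall>i\<in>J. c (f i)) \<and>
      (?S f + (s + a y)) mod 2 ^ B = (?T f + (s' + b y)) mod 2 ^ B})"
    by (rule prob_pair_pmf)
  also have "\<dots> \<le> measure_pmf.expectation D (\<lambda>y. indicator {y. c y} y * (1 / 2 ^ B))"
  proof (rule pmf_expectation_mono[where B = 1])
    fix y
    show "measure_pmf.prob ?P {f. c y \<and> \<not> (\<forall>i\<in>J. c (f i)) \<and>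
      (?S f + (s + a y)) mod 2 ^ B = (?T f + (s' + b y)) mod 2 ^ B} \<le> indicator {y. c y} y * (1 / 2 ^ B)"
      using insert.IH[of "s + a y" "s' + b y"] by (cases "c y") auto
  qed (auto simp: indicator_def divide_le_eq)
  also have "\<dots> = pc / 2 ^ B"
    by (simp add: measure_pmf.emeasure_eq_measure)
  also have "measure_pmf.prob (pair_pmf D ?P) ?E2 \<le> (1 - pc) / 2 ^ B"
    by (rule prob_pair_pmf_le_snd[where E = "\<lambda>y f. \<not> c y \<and> (a y + (?S f + s)) mod 2 ^ B =
      (b y + (?T f + s')) mod 2 ^ B"]) (use unif[OF assms(2)] in simp)
  finally show ?case by (simp add: diff_divide_distrib)
qed

end

section \<open>Second moment of the fraction of agreeing rows\<close>

lemma prob_pair_pmf_both: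
  "measure_pmf.prob (pair_pmf p q) {z. A (fst z) \<and> B (snd z)} =
     measure_pmf.prob p {x. A x} * measure_pmf.prob q {y. B y}"
proof -
  have "{z. A (fst z) \<and> B (snd z)} = {x. A x} \<times> {y. B y}" by auto
  moreover have "measure_pmf.prob q {y. A x \<and> B y} = indicator {x. A x} x * measure_pmf.prob q {y. B y}" for x
    by (cases "A x") auto
  ultimately show ?thesis
    by (subst prob_pair_pmf[where E = "\<lambda>x y. A x \<and> B y"])
       (simp add: measure_pmf.emeasure_eq_measure)
qed

text \<open>Level \<open>j\<close> has its own \<open>m\<close> hash functions \<open>j * m, \<dots>, j * m + m - 1\<close>, and a row \<open>v\<close> selects
  one of them at each level.\<close>

locale row_selection =
  fixes D :: "'y pmf" and C :: "'y \<Rightarrow> bool" and d :: 'y and M k m :: nat and Lv :: "nat set"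
  assumes m0: "0 < m" and kM: "k * m \<le> M" and Lv: "Lv \<subseteq> {..<k}"
begin

abbreviation "p \<equiv> measure_pmf.prob D {y. C y}"
definition "pf = Pi_pmf {..<M} d (\<lambda>_. D)"
definition "pV = Pi_pmf {..<k} (0::nat) (\<lambda>_. pmf_of_set {..<m})"
definition "hit f v \<longleftrightarrow> (\<forall>j\<in>Lv. C (f (j * m + v j)))"
text \<open>The fraction of all rows on which the pair agrees, as a random variable in the drawn
  functions \<open>f\<close>. Rows drawn later are independent given \<open>f\<close>, so a lower
  bound on \<open>Y\<close> is all that is needed from \<open>f\<close>.\<close>

definition "Y f = measure_pmf.prob pV {v. hit f v}"

lemma fin_Lv: "finite Lv" using Lv finite_subset by blast

lemma set_m: "set_pmf (pmf_of_set {..<m}) = {..<m}"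
  using m0 by (intro set_pmf_of_set) auto

lemma pV_less: "v \<in> set_pmf pV \<Longrightarrow> j < k \<Longrightarrow> v j < m"
  by (auto simp: pV_def set_Pi_pmf PiE_dflt_def set_m)

lemma pos_less: "j * m + u < M" if "j < k" "u < m" for j u
proof -
  have "Suc j * m \<le> k * m" using that by (intro mult_le_mono1) auto
  thus ?thesis using that kM by simp
qed

lemma pos_inj: "j * m + u = j' * m + u' \<Longrightarrow> u < m \<Longrightarrow> u' < m \<Longrightarrow> j = j' \<and> u = u'" for j u j' u' :: nat
proof -
  assume eq: "j * m + u = j' * m + u'" and u: "u < m" "u' < m"
  have "(j * m + u) div m = j" "(j' * m + u') div m = j'" using u by auto
  thus ?thesis using eq by simp
qed

text \<open>At each level two rows use either the same function or two independent ones, giving a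
  factor \<open>p\<close> or \<open>p^2\<close>. Levels draw from disjoint blocks, so the set of
  functions involved is a disjoint union and the exponents add.\<close>

lemma prob_hit2:
  assumes "v \<in> set_pmf pV" "v' \<in> set_pmf pV"
  shows "measure_pmf.prob pf {f. hit f v \<and> hit f v'} = (\<Prod>j\<in>Lv. if v' j = v j then p else p\<^sup>2)"
proof -
  let ?S = "\<lambda>j. {j * m + v j, j * m + v' j}"
  have lt: "v j < m" "v' j < m" if "j \<in> Lv" for j using that assms pV_less Lv by auto
  have "{f. hit f v \<and> hit f v'} = {f. \<forall>i\<in>(\<Union>j\<in>Lv. ?S j). C (f i)}"
    by (auto simp: hit_def)
  hence "measure_pmf.prob pf {f. hit f v \<and> hit f v'} = p ^ card (\<Union>j\<in>Lv. ?S j)"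
  proof -
    assume "{f. hit f v \<and> hit f v'} = {f. \<forall>i\<in>(\<Union>j\<in>Lv. ?S j). C (f i)}"
    moreover have "(\<Union>j\<in>Lv. ?S j) \<subseteq> {..<M}" using lt pos_less Lv by auto
    ultimately show ?thesis unfolding pf_def by (simp only: prob_Pi_pmf_Ball finite_lessThan)
  qed
  also have "card (\<Union>j\<in>Lv. ?S j) = (\<Sum>j\<in>Lv. card (?S j))"
  proof (intro card_UN_disjoint ballI impI)
    fix i j assume "i \<in> Lv" "j \<in> Lv" "i \<noteq> j"
    thus "?S i \<inter> ?S j = {}" using lt[of i] lt[of j] pos_inj[of j _ i] by auto
  qed (use fin_Lv in auto)
  also have "p ^ (\<Sum>j\<in>Lv. card (?S j)) = (\<Prod>j\<in>Lv. p ^ card (?S j))"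
    by (rule power_sum)
  also have "\<dots> = (\<Prod>j\<in>Lv. if v' j = v j then p else p\<^sup>2)"
    by (intro prod.cong) (auto simp: numeral_2_eq_2)
  finally show ?thesis .
qed

lemma prob_hit:
  assumes "v \<in> set_pmf pV"
  shows "measure_pmf.prob pf {f. hit f v} = p ^ card Lv"
  using prob_hit2[OF assms assms] by simp

lemma expectation_Y: "measure_pmf.expectation pf Y = p ^ card Lv"
proof -
  have "measure_pmf.expectation pf Y = measure_pmf.prob (pair_pmf pf pV) {z. hit (fst z) (snd z)}"
    unfolding Y_def by (rule prob_pair_pmf[symmetric])
  also have "\<dots> = measure_pmf.expectation pV (\<lambda>v. measure_pmf.prob pf {f. hit f v})"
    by (rule prob_pair_pmf_swap)
  also have "\<dots> = measure_pmf.expectation pV (\<lambda>v. p ^ card Lv)"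
    by (intro integral_cong_AE AE_pmfI) (auto simp: prob_hit)
  finally show ?thesis by simp
qed

text \<open>The square of \<open>Y f\<close> is the probability that two independent rows both
  agree. Exchanging the order of averaging fixes the rows first; at each level the second row
  repeats the choice of the first with probability \<open>1 / m\<close>, so the level contributes
  \<open>p / m + p^2 * (1 - 1 / m)\<close>.\<close>

lemma expectation_Y_square:
  "measure_pmf.expectation pf (\<lambda>f. (Y f)\<^sup>2) = (p\<^sup>2 + (p - p\<^sup>2) / real m) ^ card Lv"
proof -
  have reorder: "pair_pmf pV (pair_pmf pf pV) =
      map_pmf (\<lambda>z. (fst (snd z), fst z, snd (snd z))) (pair_pmf pf (pair_pmf pV pV))"
    unfolding pair_pmf_def map_pmf_def bind_assoc_pmf bind_return_pmf fst_conv snd_conv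
    by (rule bind_commute_pmf)
  have inner: "measure_pmf.prob (pair_pmf pf pV) {z. hit (fst z) v \<and> hit (fst z) (snd z)} =
      (p\<^sup>2 + (p - p\<^sup>2) / real m) ^ card Lv" if v: "v \<in> set_pmf pV" for v
  proof -
    let ?g = "\<lambda>j u. if j \<in> Lv then if u = v j then p else p\<^sup>2 else 1"
    have "measure_pmf.prob (pair_pmf pf pV) {z. hit (fst z) v \<and> hit (fst z) (snd z)} =
        measure_pmf.expectation pV (\<lambda>v'. measure_pmf.prob pf {f. hit f v \<and> hit f v'})"
      by (rule prob_pair_pmf_swap)
    also have "\<dots> = measure_pmf.expectation pV (\<lambda>v'. \<Prod>j<k. ?g j (v' j))"
    proof (intro integral_cong_AE AE_pmfI)
      fix v' assume "v' \<in> set_pmf pV"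
      hence "measure_pmf.prob pf {f. hit f v \<and> hit f v'} = (\<Prod>j\<in>Lv. if v' j = v j then p else p\<^sup>2)"
        using prob_hit2[OF v] by simp
      also have "\<dots> = (\<Prod>j<k. ?g j (v' j))"
        using Lv by (intro prod.mono_neutral_cong_left) auto
      finally show "measure_pmf.prob pf {f. hit f v \<and> hit f v'} = (\<Prod>j<k. ?g j (v' j))" .
    qed auto
    also have "\<dots> = (\<Prod>j<k. measure_pmf.expectation (pmf_of_set {..<m}) (?g j))"
      unfolding pV_def using m0
      by (intro expectation_prod_Pi_pmf) (auto intro!: integrable_measure_pmf_finite simp: set_m)
    also have "\<dots> = (\<Prod>j<k. if j \<in> Lv then p\<^sup>2 + (p - p\<^sup>2) / real m else 1)"
    proof (intro prod.cong refl)
      fix j assume j: "j \<in> {..<k}"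
      show "measure_pmf.expectation (pmf_of_set {..<m}) (?g j) =
          (if j \<in> Lv then p\<^sup>2 + (p - p\<^sup>2) / real m else 1)"
      proof (cases "j \<in> Lv")
        case True
        have vj: "v j < m" using pV_less[OF v] j by auto
        have "(\<Sum>u<m. if u = v j then p else p\<^sup>2) = (\<Sum>u<m. p\<^sup>2 + (if u = v j then p - p\<^sup>2 else 0))"
          by (intro sum.cong) auto
        also have "\<dots> = real m * p\<^sup>2 + (p - p\<^sup>2)"
          using vj by (simp add: sum.distrib)
        finally show ?thesis using True m0
          by (simp add: integral_pmf_of_set lessThan_empty_iff field_simps)
      qed simp
    qed
    also have "\<dots> = (p\<^sup>2 + (p - p\<^sup>2) / real m) ^ card Lv"
      using Lv by (simp add: prod.If_cases Int_absorb1)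
    finally show ?thesis .
  qed
  have "measure_pmf.expectation pf (\<lambda>f. (Y f)\<^sup>2) =
      measure_pmf.expectation pf (\<lambda>f. measure_pmf.prob (pair_pmf pV pV) {z. hit f (fst z) \<and> hit f (snd z)})"
    by (simp add: prob_pair_pmf_both Y_def power2_eq_square)
  also have "\<dots> = measure_pmf.prob (pair_pmf pf (pair_pmf pV pV))
      {z. hit (fst z) (fst (snd z)) \<and> hit (fst z) (snd (snd z))}"
    by (rule prob_pair_pmf[symmetric])
  also have "\<dots> = measure_pmf.prob (pair_pmf pV (pair_pmf pf pV))
      {z. hit (fst (snd z)) (fst z) \<and> hit (fst (snd z)) (snd (snd z))}"
    unfolding reorder by (simp add: vimage_def)
  also have "\<dots> = measure_pmf.expectation pV (\<lambda>v.
      measure_pmf.prob (pair_pmf pf pV) {z. hit (fst z) v \<and> hit (fst z) (snd z)})"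
    by (rule prob_pair_pmf)
  also have "\<dots> = measure_pmf.expectation pV (\<lambda>v. (p\<^sup>2 + (p - p\<^sup>2) / real m) ^ card Lv)"
    by (intro integral_cong_AE AE_pmfI) (auto simp: inner)
  finally show ?thesis by simp
qed

text \<open>Chebyshev's inequality at half the mean, which multiplies the relative variance by 4.
  That variance is at most
  \<open>exp (k / (p * m)) - 1 \<le> exp (1 / 160) - 1 \<le> 1 / 80\<close>.\<close>

lemma prob_Y_small:
  assumes p0: "0 < p" and mk: "160 * real k \<le> real m * p"
  shows "measure_pmf.prob pf {f. Y f < p ^ card Lv / 2} \<le> 1 / 20"
proof -
  let ?E = "p ^ card Lv"
  have Y01: "0 \<le> Y f" "Y f \<le> 1" for f by (auto simp: Y_def)
  have intg: "integrable pf (\<lambda>f. (Y f)\<^sup>2)" "integrable pf Y"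
    using Y01 by (auto intro!: measure_pmf.integrable_const_bound[where B = 1] simp: power_le_one)
  have E0: "0 < ?E" using p0 by simp
  have "measure_pmf.prob pf {f. Y f < ?E / 2} \<le>
      measure_pmf.prob pf {f \<in> space pf. ?E / 2 \<le> \<bar>Y f - measure_pmf.expectation pf Y\<bar>}"
  proof -
    have "?E / 2 \<le> \<bar>y - ?E\<bar>" if "y < ?E / 2" for y
      using that abs_ge_minus_self[of "y - ?E"] by linarith
    thus ?thesis unfolding expectation_Y by (intro measure_pmf.finite_measure_mono) auto
  qed
  also have "\<dots> \<le> measure_pmf.variance pf Y / (?E / 2)\<^sup>2"
    using E0 intg by (intro measure_pmf.Chebyshev_inequality) auto
  also have "measure_pmf.variance pf Y = (p\<^sup>2 + (p - p\<^sup>2) / real m) ^ card Lv - ?E\<^sup>2"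
    using measure_pmf.variance_eq[OF intg(2,1)] unfolding expectation_Y expectation_Y_square .
  also have "(p\<^sup>2 + (p - p\<^sup>2) / real m) = p\<^sup>2 * (1 + (1 / p - 1) / real m)"
    using p0 m0 by (simp add: field_simps power2_eq_square)
  also have "(p\<^sup>2 * (1 + (1 / p - 1) / real m)) ^ card Lv =
      ?E\<^sup>2 * (1 + (1 / p - 1) / real m) ^ card Lv"
    by (simp add: power_mult_distrib flip: power_mult) (simp add: mult.commute)
  also have "(?E\<^sup>2 * (1 + (1 / p - 1) / real m) ^ card Lv - ?E\<^sup>2) / (?E / 2)\<^sup>2 =
      4 * ((1 + (1 / p - 1) / real m) ^ card Lv - 1)"
  proof -
    have *: "(e\<^sup>2 * q - e\<^sup>2) / (e / 2)\<^sup>2 = 4 * (q - 1)" if "e \<noteq> 0" for e q :: real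
    proof -
      have "e\<^sup>2 * q - e\<^sup>2 = e\<^sup>2 * (q - 1)" by (simp add: right_diff_distrib)
      moreover have "(e / 2)\<^sup>2 = e\<^sup>2 / 4" by (simp add: power_divide)
      ultimately have "(e\<^sup>2 * q - e\<^sup>2) / (e / 2)\<^sup>2 = e\<^sup>2 * (q - 1) / (e\<^sup>2 / 4)"
        by (simp only:)
      also have "\<dots> = 4 * (q - 1)" using that by simp
      finally show ?thesis .
    qed
    show ?thesis by (rule *) (use p0 in simp)
  qed
  also have "\<dots> \<le> 4 * (1 / 80)"
  proof -
    have "p \<le> 1" by (rule measure_pmf.prob_le_1)
    hence x: "0 \<le> (1 / p - 1) / real m"
      using p0 by (intro divide_nonneg_nonneg) (auto simp: le_divide_eq)
    have "(1 + (1 / p - 1) / real m) ^ card Lv \<le> exp ((1 / p - 1) / real m) ^ card Lv"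
      using x by (intro power_mono exp_ge_add_one_self) auto
    also have "\<dots> = exp (real (card Lv) * ((1 / p - 1) / real m))"
      by (rule exp_of_nat_mult[symmetric])
    also have "real (card Lv) * ((1 / p - 1) / real m) \<le> real k * (1 / (p * real m))"
    proof (rule mult_mono)
      have "card Lv \<le> card {..<k}" using Lv by (intro card_mono) auto
      thus "real (card Lv) \<le> real k" by simp
      have "(1 / p - 1) / real m \<le> (1 / p) / real m" by (intro divide_right_mono) auto
      thus "(1 / p - 1) / real m \<le> 1 / (p * real m)" by simp
    qed (use x in auto)
    also have "\<dots> \<le> 1 / 160"
    proof -
      have "0 < p * real m" using p0 m0 by simp
      hence "real k / (p * real m) \<le> 1 / 160"
        using mk by (simp add: pos_divide_le_eq mult.commute)
      thus ?thesis by simp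
    qed
    finally have "(1 + (1 / p - 1) / real m) ^ card Lv \<le> exp (1 / 160)" by simp
    also have "\<dots> \<le> 1 + 1 / 160 + (1 / 160)\<^sup>2" by (rule exp_bound) auto
    finally show ?thesis by (simp add: power2_eq_square)
  qed
  finally show ?thesis by simp
qed

text \<open>Two sources of failure. Either \<open>Y\<close> is below half its mean, or all rows of
  \<open>Rw\<close>, independent given \<open>f\<close>, miss; the latter has probability at most
  \<open>(1 - Y f) ^ card Rw \<le> exp (- 5)\<close>.\<close>

lemma prob_no_row_hits:
  assumes p0: "0 < p1" "p1 \<le> p" and mk: "160 * real k \<le> real m * p1"
    and Rw: "Rw \<subseteq> {..<nR :: nat}" "10 \<le> real (card Rw) * p1 ^ card Lv"
  shows "measure_pmf.prob (pair_pmf pf (Pi_pmf {..<nR} dv (\<lambda>_. pV)))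
    {z. \<forall>r\<in>Rw. \<not> hit (fst z) (snd z r)} \<le> 1 / 20 + 1 / 20"
proof (rule prob_pair_pmf_le_split)
  have "160 * real k \<le> real m * p"
    using mk p0 mult_left_mono[of p1 p "real m"] by linarith
  thus "measure_pmf.prob pf {f. Y f < p ^ card Lv / 2} \<le> 1 / 20"
    using p0 by (intro prob_Y_small) auto
  fix f assume Y: "\<not> Y f < p ^ card Lv / 2"
  have "measure_pmf.prob (Pi_pmf {..<nR} dv (\<lambda>_. pV)) {idx. \<forall>r\<in>Rw. \<not> hit f (idx r)} =
      measure_pmf.prob pV {v. \<not> hit f v} ^ card Rw"
    using Rw by (intro prob_Pi_pmf_Ball) auto
  also have "measure_pmf.prob pV {v. \<not> hit f v} = 1 - Y f"
    using measure_pmf.prob_compl[of "{v. hit f v}" pV] by (simp add: Y_def Compl_eq_Diff_UNIV[symmetric] Collect_neg_eq)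
  also have "(1 - Y f) ^ card Rw \<le> exp (- Y f) ^ card Rw"
    using exp_ge_add_one_self[of "- Y f"] by (intro power_mono) (auto simp: Y_def)
  also have "\<dots> = exp (- (real (card Rw) * Y f))"
    by (simp flip: exp_of_nat_mult)
  also have "\<dots> \<le> exp (- 5)"
  proof -
    have "p1 ^ card Lv \<le> p ^ card Lv" using p0 by (intro power_mono) auto
    hence "p1 ^ card Lv / 2 \<le> Y f" using Y by simp
    hence "real (card Rw) * (p1 ^ card Lv / 2) \<le> real (card Rw) * Y f"
      by (intro mult_left_mono) auto
    thus ?thesis using Rw(2) by simp
  qed
  \<comment> \<open>\<open>exp 1 \<ge> 2\<close> suffices, since
    \<open>2 ^ 5 = 32 \<ge> 20\<close>.\<close>
  also have "exp (- 5 :: real) \<le> 1 / 20"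
  proof -
    have "(2 :: real) ^ 5 \<le> exp 1 ^ 5"
      using exp_ge_add_one_self[of "1::real"] by (intro power_mono) auto
    also have "\<dots> = exp (5::real)" by (simp flip: exp_of_nat_mult)
    finally show ?thesis by (simp add: exp_minus field_simps)
  qed
  finally show "measure_pmf.prob (Pi_pmf {..<nR} dv (\<lambda>_. pV)) {idx. \<forall>r\<in>Rw. \<not> hit f (idx r)} \<le> 1 / 20" .
qed auto

end

section \<open>Concentration of the one-bit sketches\<close>

context word_hash
begin

text \<open>Two bits differ exactly when they agree after one of them is shifted by 1. This turns a
  mismatch into the event of \<open>unif\<close> with \<open>B = 1\<close> and \<open>s = 1\<close>;
  points that are not separated have equal bits.\<close>

lemma prob_mismatch:
  assumes "1 \<le> w"
  shows "measure_pmf.prob D {y. a y mod 2 \<noteq> b y mod 2} = (1 - pc) / 2"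
proof -
  have "measure_pmf.prob D {y. a y mod 2 \<noteq> b y mod 2} =
      measure_pmf.prob D {y. \<not> c y \<and> (a y + 1) mod 2 ^ 1 = (b y + 0) mod 2 ^ 1}"
  proof (rule measure_eq_AE)
    show "AE y in D. (y \<in> {y. a y mod 2 \<noteq> b y mod 2}) =
       (y \<in> {y. \<not> c y \<and> (a y + 1) mod 2 ^ 1 = (b y + 0) mod 2 ^ 1})"
    proof (rule AE_pmfI)
      fix y assume y: "y \<in> set_pmf D"
      show "(y \<in> {y. a y mod 2 \<noteq> b y mod 2}) =
       (y \<in> {y. \<not> c y \<and> (a y + 1) mod 2 ^ 1 = (b y + 0) mod 2 ^ 1})"
      proof (cases "c y")
        case True
        thus ?thesis using coll[OF y] by simp
      next
        case False
        have "(a y mod 2 \<noteq> b y mod 2) = ((a y + 1) mod 2 = b y mod 2)" by presburger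
        thus ?thesis using False by simp
      qed
    qed
  qed auto
  thus ?thesis using unif[of 1 1 0] assms by simp
qed

text \<open>One-sided Hoeffding bounds around the mean rate \<open>(1 - pc) / 2\<close>. The upper
  tail serves the near point, which must pass the verification, and the lower tail the far points,
  which must fail it.\<close>

lemma prob_mismatches:
  fixes M :: nat
  assumes "1 \<le> w" and Sk: "Sk \<subseteq> {..<M}" "Sk \<noteq> {}" and \<epsilon>: "0 \<le> \<epsilon>"
  defines "N \<equiv> real (card Sk)"
    and "mis \<equiv> \<lambda>f. real (card {i\<in>Sk. a (f i) mod 2 \<noteq> b (f i) mod 2})"
  shows "measure_pmf.prob (Pi_pmf {..<M} d (\<lambda>_. D)) {f. N * ((1 - pc) / 2 + \<epsilon>) \<le> mis f}
      \<le> exp (- 2 * N * \<epsilon>\<^sup>2)"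
    and "measure_pmf.prob (Pi_pmf {..<M} d (\<lambda>_. D)) {f. mis f \<le> N * ((1 - pc) / 2 - \<epsilon>)}
      \<le> exp (- 2 * N * \<epsilon>\<^sup>2)"
proof -
  let ?P = "Pi_pmf {..<M} d (\<lambda>_. D)"
  define X where "X = (\<lambda>(i::nat) f. of_bool (a (f i) mod 2 \<noteq> b (f i) mod 2) :: real)"
  have fin: "finite Sk" using Sk finite_subset by blast
  have N0: "0 < N" using fin Sk by (simp add: N_def card_gt_0_iff)
  have ind0: "prob_space.indep_vars (measure_pmf ?P) (\<lambda>_. count_space UNIV) (\<lambda>i f. f i) Sk"
    by (rule prob_space.indep_vars_subset[OF measure_pmf.prob_space_axioms indep_vars_Pi_pmf Sk(1)]) auto
  have "prob_space.indep_vars (measure_pmf ?P) (\<lambda>_. borel)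
      (\<lambda>i f. of_bool (a (f i) mod 2 \<noteq> b (f i) mod 2) :: real) Sk"
    by (rule prob_space.indep_vars_compose2[OF measure_pmf.prob_space_axioms ind0]) auto
  hence ind: "prob_space.indep_vars (measure_pmf ?P) (\<lambda>_. borel) X Sk" unfolding X_def .
  interpret H: Hoeffding_ineq "measure_pmf ?P" Sk X "\<lambda>_. 0" "\<lambda>_. 1"
      "\<Sum>i\<in>Sk. measure_pmf.expectation ?P (X i)"
    by unfold_locales (use fin ind in \<open>auto simp: X_def\<close>)
  have EX: "measure_pmf.expectation ?P (X i) = (1 - pc) / 2" if "i \<in> Sk" for i
  proof -
    have "X i = indicator {f. a (f i) mod 2 \<noteq> b (f i) mod 2}"
      by (auto simp: X_def indicator_def)
    hence "measure_pmf.expectation ?P (X i) =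
        measure_pmf.prob (map_pmf (\<lambda>f. f i) ?P) {y. a y mod 2 \<noteq> b y mod 2}"
      by (simp add: vimage_def)
    also have "map_pmf (\<lambda>f. f i) ?P = D"
      using that Sk by (subst Pi_pmf_component) auto
    also have "measure_pmf.prob D {y. a y mod 2 \<noteq> b y mod 2} = (1 - pc) / 2"
      by (rule prob_mismatch[OF assms(1)])
    finally show ?thesis .
  qed
  have mu: "(\<Sum>i\<in>Sk. measure_pmf.expectation ?P (X i)) = N * ((1 - pc) / 2)"
    by (simp add: EX N_def)
  have mis: "(\<Sum>i\<in>Sk. X i f) = mis f" for f
    using fin by (simp add: X_def mis_def sum.If_cases of_bool_def Int_def)
  have e: "- 2 * (N * \<epsilon>)\<^sup>2 / (\<Sum>i\<in>Sk. (1 - 0)\<^sup>2) = - 2 * N * \<epsilon>\<^sup>2"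
    using N0 by (simp add: N_def power2_eq_square)
  have pos: "0 < (\<Sum>i\<in>Sk. (1 - 0 :: real)\<^sup>2)" using N0 by (simp add: N_def)
  have e0: "0 \<le> N * \<epsilon>" using N0 \<epsilon> by simp
  show "measure_pmf.prob ?P {f. N * ((1 - pc) / 2 + \<epsilon>) \<le> mis f} \<le> exp (- 2 * N * \<epsilon>\<^sup>2)"
    using H.Hoeffding_ineq_ge[OF e0 pos] unfolding e mu mis by (simp add: ring_distribs)
  show "measure_pmf.prob ?P {f. mis f \<le> N * ((1 - pc) / 2 - \<epsilon>)} \<le> exp (- 2 * N * \<epsilon>\<^sup>2)"
    using H.Hoeffding_ineq_le[OF e0 pos] unfolding e mu mis by (simp add: ring_distribs)
qed

end

section \<open>Success probability of the search\<close>

lemma length_filter_sum: "length (filter P [0..<n]) = (\<Sum>x<n. of_bool (P x))"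
  by (induction n) auto

lemma length_filter_concat_upt:
  "length (filter P (concat (map f [0..<n]))) = (\<Sum>t<n. length (filter P (f t)))"
  by (induction n) (auto simp: filter_concat)

text \<open>Linearity of expectation and Markov's inequality; both hold for dependent events, as
  matches in tables sharing functions are.\<close>

lemma prob_count_ge:
  assumes "finite S" "0 < B" "\<And>s. s \<in> S \<Longrightarrow> measure_pmf.prob p {z. E s z} \<le> \<epsilon>"
  shows "measure_pmf.prob p {z. B \<le> real (\<Sum>s\<in>S. of_bool (E s z))} \<le> real (card S) * \<epsilon> / B"
    and "measure_pmf.expectation p (\<lambda>z. real (\<Sum>s\<in>S. of_bool (E s z))) \<le> real (card S) * \<epsilon>"
proof -
  have X: "real (\<Sum>s\<in>S. of_bool (E s z)) = (\<Sum>s\<in>S. indicator {z. E s z} z)" for z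
    unfolding of_nat_sum by (intro sum.cong) (auto simp: indicator_def)
  have "measure_pmf.expectation p (\<lambda>z. real (\<Sum>s\<in>S. of_bool (E s z))) =
      (\<Sum>s\<in>S. measure_pmf.prob p {z. E s z})"
    unfolding X by (subst Bochner_Integration.integral_sum) (auto simp: measure_pmf.emeasure_eq_measure)
  also have "\<dots> \<le> real (card S) * \<epsilon>"
    using sum_bounded_above[of S "\<lambda>s. measure_pmf.prob p {z. E s z}" \<epsilon>] assms(3) by simp
  finally show E: "measure_pmf.expectation p (\<lambda>z. real (\<Sum>s\<in>S. of_bool (E s z))) \<le> real (card S) * \<epsilon>" .
  have int: "integrable p (\<lambda>z. real (\<Sum>s\<in>S. of_bool (E s z)))"
    unfolding X by (intro Bochner_Integration.integrable_sum) (auto simp: measure_pmf.emeasure_eq_measure)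
  have "measure_pmf.prob p {z \<in> space p. B \<le> real (\<Sum>s\<in>S. of_bool (E s z))} \<le>
      measure_pmf.expectation p (\<lambda>z. real (\<Sum>s\<in>S. of_bool (E s z))) / B"
    using assms(2) by (intro integral_Markov_inequality_measure[OF int, of "{}"]) (auto intro!: AE_pmfI sum_nonneg)
  also have "\<dots> \<le> real (card S) * \<epsilon> / B"
    using E assms(2) by (intro divide_right_mono) auto
  finally show "measure_pmf.prob p {z. B \<le> real (\<Sum>s\<in>S. of_bool (E s z))} \<le> real (card S) * \<epsilon> / B"
    by simp
qed

text \<open>The spurious budget outlasts the list, and an accepted match occurs in it. So the scan
  ends at an accepted match or at the match with number \<open>b1\<close>, and both cases are good
  by assumption.\<close>

lemma scan_good:
  assumes "length (filter (\<lambda>e. \<not> fst e) es) < b2" "0 < b1"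
    and "(True, near) \<in> set es" "acc near"
    and "\<And>x. (True, x) \<in> set es \<Longrightarrow> acc x \<Longrightarrow> G x"
    and "b1 \<le> length (filter fst es) \<Longrightarrow> G (map snd (filter fst es) ! (b1 - 1))"
  shows "G (scan acc es r b1 b2)"
  using assms
proof (induction es arbitrary: r b1 b2)
  case (Cons e es)
  obtain c x where e: "e = (c, x)" by (cases e)
  show ?case
  proof (cases c)
    case False
    have b2: "b2 \<noteq> 1" "0 < b2" using Cons.prems(1) False e by auto
    have "G (scan acc es r b1 (b2 - 1))"
      by (rule Cons.IH) (use Cons.prems False e in auto)
    thus ?thesis using e False b2 by simp
  next
    case True
    show ?thesis
    proof (cases "acc x \<or> b1 = 1")
      case acc: True
      have "G x"
      proof (cases "acc x")
        case True
        thus ?thesis using Cons.prems(5)[of x] e \<open>c\<close> by simp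
      next
        case False
        thus ?thesis using acc Cons.prems(6) e \<open>c\<close> by simp
      qed
      thus ?thesis using acc e \<open>c\<close> by simp
    next
      case False
      have "G (scan acc es x (b1 - 1) b2)"
      proof (rule Cons.IH)
        show "0 < b1 - 1" using False Cons.prems(2) by auto
        show "(True, near) \<in> set es" using Cons.prems(3,4) e False by auto
        show "length (filter (\<lambda>e. \<not> fst e) es) < b2" using Cons.prems(1) e True by simp
        show "acc near" by fact
        show "\<And>x. (True, x) \<in> set es \<Longrightarrow> acc x \<Longrightarrow> G x" using Cons.prems(5) by simp
        show "G (map snd (filter fst es) ! (b1 - 1 - 1))" if "b1 - 1 \<le> length (filter fst es)"
        proof -
          have "G (map snd (filter fst (e # es)) ! (b1 - 1))"
            using that e True by (intro Cons.prems(6)) simp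
          moreover have "b1 - 1 = Suc (b1 - 1 - 1)" using \<open>0 < b1 - 1\<close> by simp
          ultimately show ?thesis using e True by (metis filter.simps(2) fst_conv list.simps(9) nth_Cons_Suc)
        qed
      qed
      thus ?thesis using e True False by simp
    qed
  qed
qed simp

context word_hash
begin

text \<open>Injectivity of \<open>pos\<close> says that a row uses distinct functions, so its sum
  runs over independent coordinates and \<open>sum_collision\<close> applies.\<close>

lemma prob_sum_spurious:
  assumes "finite I" "inj_on pos {..<k :: nat}" "pos ` {..<k} \<subseteq> I" "B \<le> w"
  shows "measure_pmf.prob (Pi_pmf I d (\<lambda>_. D)) {f. \<not> (\<forall>j<k. c (f (pos j))) \<and>
    (\<Sum>j<k. a (f (pos j))) mod 2 ^ B = (\<Sum>j<k. b (f (pos j))) mod 2 ^ B} \<le> 1 / 2 ^ B"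
proof -
  let ?J = "pos ` {..<k}"
  have sa: "(\<Sum>j<k. h (f (pos j))) = (\<Sum>i\<in>?J. h (f i))" for h :: "'y \<Rightarrow> nat" and f
    using assms(2) by (simp add: sum.reindex)
  have ca: "(\<forall>j<k. c (f (pos j))) = (\<forall>i\<in>?J. c (f i))" for f by auto
  have "measure_pmf.prob (Pi_pmf I d (\<lambda>_. D)) {f. \<not> (\<forall>i\<in>?J. c (f i)) \<and>
    ((\<Sum>i\<in>?J. a (f i)) + 0) mod 2 ^ B = ((\<Sum>i\<in>?J. b (f i)) + 0) mod 2 ^ B} =
    measure_pmf.prob (Pi_pmf ?J d (\<lambda>_. D)) {f. \<not> (\<forall>i\<in>?J. c (f i)) \<and>
    ((\<Sum>i\<in>?J. a (f i)) + 0) mod 2 ^ B = ((\<Sum>i\<in>?J. b (f i)) + 0) mod 2 ^ B}"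
  proof (rule prob_Pi_pmf_subset[OF assms(1,3)])
    fix f g :: "_ \<Rightarrow> 'y" assume "\<And>i. i \<in> ?J \<Longrightarrow> f i = g i"
    hence "(\<Sum>i\<in>?J. h (f i)) = (\<Sum>i\<in>?J. h (g i))" "(\<forall>i\<in>?J. c (f i)) = (\<forall>i\<in>?J. c (g i))"
      for h :: "'y \<Rightarrow> nat" by (auto intro!: sum.cong)
    thus "(\<not> (\<forall>i\<in>?J. c (f i)) \<and>
      ((\<Sum>i\<in>?J. a (f i)) + 0) mod 2 ^ B = ((\<Sum>i\<in>?J. b (f i)) + 0) mod 2 ^ B) =
      (\<not> (\<forall>i\<in>?J. c (g i)) \<and>
      ((\<Sum>i\<in>?J. a (g i)) + 0) mod 2 ^ B = ((\<Sum>i\<in>?J. b (g i)) + 0) mod 2 ^ B)"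
      by simp
  qed
  also have "\<dots> \<le> 1 / 2 ^ B"
    by (rule sum_collision) (use assms in auto)
  finally show ?thesis unfolding sa ca by simp
qed

text \<open>Equal sums are either genuine, with agreement at all \<open>k\<close> levels, or
  spurious. At \<open>B = w\<close> this bounds the probability that a point matches the full key of
  a table.\<close>

lemma prob_sum_equal:
  assumes "finite I" "inj_on pos {..<k :: nat}" "pos ` {..<k} \<subseteq> I" "B \<le> w"
  shows "measure_pmf.prob (Pi_pmf I d (\<lambda>_. D)) {f.
    (\<Sum>j<k. a (f (pos j))) mod 2 ^ B = (\<Sum>j<k. b (f (pos j))) mod 2 ^ B} \<le> pc ^ k + 1 / 2 ^ B"
proof -
  let ?P = "Pi_pmf I d (\<lambda>_. D)"
  let ?A = "{f. \<forall>i\<in>pos ` {..<k}. c (f i)}"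
  let ?B = "{f. \<not> (\<forall>j<k. c (f (pos j))) \<and>
    (\<Sum>j<k. a (f (pos j))) mod 2 ^ B = (\<Sum>j<k. b (f (pos j))) mod 2 ^ B}"
  have "measure_pmf.prob ?P {f. (\<Sum>j<k. a (f (pos j))) mod 2 ^ B = (\<Sum>j<k. b (f (pos j))) mod 2 ^ B}
    \<le> measure_pmf.prob ?P (?A \<union> ?B)"
    by (intro measure_pmf.finite_measure_mono) auto
  also have "\<dots> \<le> measure_pmf.prob ?P ?A + measure_pmf.prob ?P ?B"
    by (rule measure_Un_le) auto
  also have "measure_pmf.prob ?P ?A = pc ^ k"
    using assms by (subst prob_Pi_pmf_Ball) (auto simp: card_image)
  also have "measure_pmf.prob ?P ?B \<le> 1 / 2 ^ B" by (rule prob_sum_spurious[OF assms])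
  finally show ?thesis by simp
qed

end

text \<open>The setting for one fixed query: \<open>x0\<close> is a near point, \<open>far\<close>
  marks the points that must not be returned, and \<open>D\<close> is the law of one pair of a
  locality-sensitive and a universal function seen at the relevant points. \<open>thr\<close> is the
  midpoint between the mismatch rates \<open>(1 - p1) / 2\<close> and \<open>(1 - p2) / 2\<close>,
  scaled by the number of sketch bits.\<close>

locale nn_analysis =
  fixes D :: "'y pmf" and d0 :: 'y and c :: "nat \<Rightarrow> 'y \<Rightarrow> bool" and a :: "nat \<Rightarrow> 'y \<Rightarrow> nat"
    and b :: "'y \<Rightarrow> nat" and w n k k1 m nA nB Bb Ns M Q thr bud2 x0 :: nat
    and p1 p2 :: real and far :: "nat \<Rightarrow> bool"
  assumes wh: "\<And>x. x < n \<Longrightarrow> word_hash D (c x) (a x) b w"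
    and near: "x0 < n" "p1 \<le> measure_pmf.prob D {y. c x0 y}"
    and far: "\<And>x. x < n \<Longrightarrow> far x \<Longrightarrow> measure_pmf.prob D {y. c x y} \<le> p2"
    and M_eq: "M = k * m + Ns * Bb"
    and pos: "0 < m" "0 < Bb" "0 < Ns" "0 < nA" "0 < nB" "0 < Q" "k1 \<le> k"
    and w_ge: "Bb \<le> w" and n_le: "n \<le> 2 ^ Bb"
    and p12: "0 < p2" "p2 < p1"
    and mk: "160 * real k \<le> real m * p1"
    and nAB: "10 \<le> real nA * p1 ^ k1" "10 \<le> real nB * p1 ^ (k - k1)"
    and hoeff: "exp (- (real (Ns * Bb) * (p1 - p2)\<^sup>2 / 8)) \<le> 1 / (20 * real n)"
    and thr_eq: "thr = nat \<lfloor>real (Ns * Bb) * ((1 - p1) / 2 + (p1 - p2) / 4)\<rfloor>"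
    and farQ: "real (nA * nB * n) * (p2 ^ k + 1 / 2 ^ w) \<le> real Q / 20"
    and bud2_eq: "bud2 = 20 * (nA * nB)"
begin

text \<open>A table number encodes a pair of half rows in mixed radix: quotient by \<open>nB\<close>
  for the first half of the levels, remainder for the second.\<close>

definition sel :: "(nat \<Rightarrow> nat \<Rightarrow> nat) \<Rightarrow> nat \<Rightarrow> nat \<Rightarrow> nat" where
  "sel idx t j = (if j < k1 then idx (t div nB) j else idx (nA + t mod nB) j)"
definition loc :: "(nat \<Rightarrow> nat \<Rightarrow> nat) \<Rightarrow> nat \<Rightarrow> nat \<Rightarrow> nat" where
  "loc idx t j = j * m + sel idx t j"
definition SG :: "(nat \<Rightarrow> 'y) \<Rightarrow> (nat \<Rightarrow> nat \<Rightarrow> nat) \<Rightarrow> nat \<Rightarrow> nat \<Rightarrow> nat" where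
  "SG f idx t x = (\<Sum>j<k. a x (f (loc idx t j))) mod 2 ^ w"
definition ST :: "(nat \<Rightarrow> 'y) \<Rightarrow> (nat \<Rightarrow> nat \<Rightarrow> nat) \<Rightarrow> nat \<Rightarrow> nat" where
  "ST f idx t = (\<Sum>j<k. b (f (loc idx t j))) mod 2 ^ w"
definition entries :: "(nat \<Rightarrow> 'y) \<Rightarrow> (nat \<Rightarrow> nat \<Rightarrow> nat) \<Rightarrow> (bool \<times> nat) list" where
  "entries f idx = concat (map (\<lambda>t. map (\<lambda>x. (SG f idx t x = ST f idx t, x))
     (filter (\<lambda>x. SG f idx t x mod 2 ^ Bb = ST f idx t mod 2 ^ Bb) [0..<n])) [0..<nA * nB])"
definition mis :: "(nat \<Rightarrow> 'y) \<Rightarrow> nat \<Rightarrow> nat" where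
  "mis f x = card {i \<in> {k * m..<M}. a x (f i) mod 2 \<noteq> b (f i) mod 2}"
definition outcome :: "(nat \<Rightarrow> 'y) \<Rightarrow> (nat \<Rightarrow> nat \<Rightarrow> nat) \<Rightarrow> nat \<Rightarrow> nat" where
  "outcome f idx r = scan (\<lambda>x. mis f x \<le> thr) (entries f idx) 0 r bud2"

definition pF :: "(nat \<Rightarrow> 'y) pmf" where "pF = Pi_pmf {..<M} d0 (\<lambda>_. D)"
definition pV :: "(nat \<Rightarrow> nat) pmf" where "pV = Pi_pmf {..<k} 0 (\<lambda>_. pmf_of_set {..<m})"
definition pI :: "(nat \<Rightarrow> nat \<Rightarrow> nat) pmf" where "pI = Pi_pmf {..<nA + nB} (\<lambda>_. 0) (\<lambda>_. pV)"
definition pR :: "nat pmf" where "pR = pmf_of_set {Q..<2 * Q}"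

abbreviation "P \<equiv> pair_pmf (pair_pmf pF pI) pR"
abbreviation "L \<equiv> nA * nB"

lemma km_le: "k * m \<le> M" using M_eq by simp

lemma idx_less: "idx \<in> set_pmf pI \<Longrightarrow> r < nA + nB \<Longrightarrow> j < k \<Longrightarrow> idx r j < m"
proof -
  assume *: "idx \<in> set_pmf pI" "r < nA + nB" "j < k"
  hence "idx r \<in> set_pmf pV" by (auto simp: pI_def set_Pi_pmf PiE_dflt_def)
  moreover have "set_pmf (pmf_of_set {..<m}) = {..<m}" using pos by (intro set_pmf_of_set) auto
  ultimately show ?thesis using * by (auto simp: pV_def set_Pi_pmf PiE_dflt_def)
qed

lemma F_supp: "f \<in> set_pmf pF \<Longrightarrow> i < M \<Longrightarrow> f i \<in> set_pmf D"
  by (auto simp: pF_def set_Pi_pmf PiE_dflt_def)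

lemma sel_less:
  assumes "idx \<in> set_pmf pI" "t < L" "j < k"
  shows "sel idx t j < m"
proof -
  have "t div nB < nA" using assms(2) by (simp add: less_mult_imp_div_less)
  moreover have "t mod nB < nB" using pos by simp
  ultimately show ?thesis using assms idx_less by (auto simp: sel_def)
qed

lemma loc_props:
  assumes "idx \<in> set_pmf pI" "t < L"
  shows "inj_on (loc idx t) {..<k}" "loc idx t ` {..<k} \<subseteq> {..<M}"
proof -
  have dv: "loc idx t j div m = j" if "j < k" for j
    using sel_less[OF assms that] by (simp add: loc_def)
  thus "inj_on (loc idx t) {..<k}" by (metis inj_onI lessThan_iff)
  show "loc idx t ` {..<k} \<subseteq> {..<M}"
  proof safe
    fix j assume j: "j < k"
    have "Suc j * m \<le> k * m" using j by (intro mult_le_mono1) auto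
    thus "loc idx t j < M" using sel_less[OF assms j] km_le by (simp add: loc_def)
  qed
qed

lemma mod_Bb: "u mod 2 ^ w mod 2 ^ Bb = u mod 2 ^ Bb" for u :: nat
  using w_ge by (simp add: mod_mod_cancel le_imp_power_dvd)

lemma bucket_iff: "SG f idx t x mod 2 ^ Bb = ST f idx t mod 2 ^ Bb \<longleftrightarrow>
    (\<Sum>j<k. a x (f (loc idx t j))) mod 2 ^ Bb = (\<Sum>j<k. b (f (loc idx t j))) mod 2 ^ Bb"
  by (simp add: SG_def ST_def mod_Bb)

lemma all_coll:
  assumes "f \<in> set_pmf pF" "idx \<in> set_pmf pI" "t < L" "x < n" "\<forall>j<k. c x (f (loc idx t j))"
  shows "SG f idx t x = ST f idx t"
proof -
  have "a x (f (loc idx t j)) = b (f (loc idx t j))" if "j < k" for j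
    using word_hash.coll[OF wh[OF assms(4)]] F_supp[OF assms(1)] loc_props(2)[OF assms(2,3)] assms(5) that
    by auto
  thus ?thesis by (simp add: SG_def ST_def)
qed

lemma prob_far_match:
  assumes "t < L" "x < n"
  shows "measure_pmf.prob (pair_pmf pF pI) {z. far x \<and> SG (fst z) (snd z) t x = ST (fst z) (snd z) t}
    \<le> p2 ^ k + 1 / 2 ^ w"
proof (rule prob_pair_pmf_le_snd[where E = "\<lambda>f idx. far x \<and> SG f idx t x = ST f idx t"])
  fix idx assume idx: "idx \<in> set_pmf pI"
  interpret W: word_hash D "c x" "a x" b w by (rule wh[OF assms(2)])
  show "measure_pmf.prob pF {f. far x \<and> SG f idx t x = ST f idx t} \<le> p2 ^ k + 1 / 2 ^ w"
  proof (cases "far x")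
    case True
    have "measure_pmf.prob pF {f. far x \<and> SG f idx t x = ST f idx t} =
        measure_pmf.prob (Pi_pmf {..<M} d0 (\<lambda>_. D)) {f.
          (\<Sum>j<k. a x (f (loc idx t j))) mod 2 ^ w = (\<Sum>j<k. b (f (loc idx t j))) mod 2 ^ w}"
      using True by (simp add: pF_def SG_def ST_def)
    also have "\<dots> \<le> measure_pmf.prob D {y. c x y} ^ k + 1 / 2 ^ w"
      by (rule W.prob_sum_equal) (use loc_props[OF idx assms(1)] in auto)
    also have "measure_pmf.prob D {y. c x y} ^ k \<le> p2 ^ k"
      using far[OF assms(2) True] by (intro power_mono) auto
    finally show ?thesis by simp
  next
    case False
    thus ?thesis using p12 by simp
  qed
qed

text \<open>Unequal keys imply that some level separates the points, because full agreement makes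
  the keys equal. The shared bucket is then an accidental equality of sums modulo
  \<open>2 ^ Bb\<close>.\<close>

lemma prob_spurious:
  assumes "t < L" "x < n"
  shows "measure_pmf.prob (pair_pmf pF pI) {z. SG (fst z) (snd z) t x mod 2 ^ Bb = ST (fst z) (snd z) t mod 2 ^ Bb
      \<and> SG (fst z) (snd z) t x \<noteq> ST (fst z) (snd z) t} \<le> 1 / 2 ^ Bb"
proof (rule prob_pair_pmf_le_snd[where E = "\<lambda>f idx. SG f idx t x mod 2 ^ Bb = ST f idx t mod 2 ^ Bb
      \<and> SG f idx t x \<noteq> ST f idx t"])
  fix idx assume idx: "idx \<in> set_pmf pI"
  interpret W: word_hash D "c x" "a x" b w by (rule wh[OF assms(2)])
  have "measure_pmf.prob pF {f. SG f idx t x mod 2 ^ Bb = ST f idx t mod 2 ^ Bb \<and> SG f idx t x \<noteq> ST f idx t}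
    \<le> measure_pmf.prob pF {f. \<not> (\<forall>j<k. c x (f (loc idx t j))) \<and>
      (\<Sum>j<k. a x (f (loc idx t j))) mod 2 ^ Bb = (\<Sum>j<k. b (f (loc idx t j))) mod 2 ^ Bb}"
  proof (rule measure_pmf.finite_measure_mono_AE)
    show "AE f in pF. f \<in> {f. SG f idx t x mod 2 ^ Bb = ST f idx t mod 2 ^ Bb \<and> SG f idx t x \<noteq> ST f idx t} \<longrightarrow>
      f \<in> {f. \<not> (\<forall>j<k. c x (f (loc idx t j))) \<and>
      (\<Sum>j<k. a x (f (loc idx t j))) mod 2 ^ Bb = (\<Sum>j<k. b (f (loc idx t j))) mod 2 ^ Bb}"
      using all_coll[OF _ idx assms] by (intro AE_pmfI) (auto simp only: bucket_iff mem_Collect_eq)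
  qed auto
  also have "\<dots> \<le> 1 / 2 ^ Bb"
    unfolding pF_def by (rule W.prob_sum_spurious) (use loc_props[OF idx assms(1)] w_ge in auto)
  finally show "measure_pmf.prob pF {f. SG f idx t x mod 2 ^ Bb = ST f idx t mod 2 ^ Bb \<and>
    SG f idx t x \<noteq> ST f idx t} \<le> 1 / 2 ^ Bb" .
qed

lemma length_filter_entries:
  "length (filter R (entries f idx)) = (\<Sum>s\<in>{..<L} \<times> {..<n}.
     of_bool (SG f idx (fst s) (snd s) mod 2 ^ Bb = ST f idx (fst s) mod 2 ^ Bb \<and>
       R (SG f idx (fst s) (snd s) = ST f idx (fst s), snd s)))"
proof -
  have "length (filter R (entries f idx)) = (\<Sum>t<L. \<Sum>x<n.
     of_bool (SG f idx t x mod 2 ^ Bb = ST f idx t mod 2 ^ Bb \<and> R (SG f idx t x = ST f idx t, x)))"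
    unfolding entries_def length_filter_concat_upt
    by (simp add: filter_map o_def length_filter_sum conj_commute)
  also have "\<dots> = (\<Sum>(t, x)\<in>{..<L} \<times> {..<n}.
     of_bool (SG f idx t x mod 2 ^ Bb = ST f idx t mod 2 ^ Bb \<and> R (SG f idx t x = ST f idx t, x)))"
    by (rule sum.cartesian_product)
  finally show ?thesis by (simp add: case_prod_beta)
qed

abbreviation "bad_spurious z \<equiv> bud2 \<le> length (filter (\<lambda>e. \<not> fst e) (entries (fst z) (snd z)))"

text \<open>Since \<open>n \<le> 2 ^ Bb\<close>, at most one spurious entry per table is expected.
  The budget is 20 times the number of tables, and Markov's inequality gives
  \<open>1 / 20\<close>.\<close>

lemma prob_bad_spurious: "measure_pmf.prob (pair_pmf pF pI) {z. bad_spurious z} \<le> 1 / 20"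
proof -
  let ?E = "\<lambda>s z. SG (fst z) (snd z) (fst s) (snd s) mod 2 ^ Bb = ST (fst z) (snd z) (fst s) mod 2 ^ Bb
    \<and> SG (fst z) (snd z) (fst s) (snd s) \<noteq> ST (fst z) (snd z) (fst s)"
  let ?S = "{..<L} \<times> {..<n}"
  have eq: "{z. bad_spurious z} = {z. real bud2 \<le> real (\<Sum>s\<in>?S. of_bool (?E s z))}"
    unfolding length_filter_entries by auto
  have "measure_pmf.prob (pair_pmf pF pI) {z. bad_spurious z} \<le> real (card ?S) * (1 / 2 ^ Bb) / real bud2"
    unfolding eq
  proof (rule prob_count_ge(1))
    show "0 < real bud2" using pos bud2_eq by simp
    fix s assume "s \<in> ?S"
    thus "measure_pmf.prob (pair_pmf pF pI) {z. ?E s z} \<le> 1 / 2 ^ Bb"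
      by (intro prob_spurious) auto
  qed simp
  also have "\<dots> \<le> 1 / 20"
  proof -
    have "real n \<le> real (2 ^ Bb)" using n_le by (rule of_nat_mono)
    hence n: "real n / 2 ^ Bb \<le> 1" by simp
    have "real (card ?S) * (1 / 2 ^ Bb) / real bud2 = (real n / 2 ^ Bb) / 20"
    proof -
      have "real (card ?S) = real L * real n" "real bud2 = 20 * real L"
        using bud2_eq by (simp_all add: card_cartesian_product)
      moreover have "real L \<noteq> 0" using pos by simp
      ultimately show ?thesis by (simp del: of_nat_mult)
    qed
    also have "\<dots> \<le> 1 / 20" using n by (intro divide_right_mono) auto
    finally show ?thesis .
  qed
  finally show ?thesis .
qed

definition matches :: "(nat \<Rightarrow> 'y) \<Rightarrow> (nat \<Rightarrow> nat \<Rightarrow> nat) \<Rightarrow> nat list" where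
  "matches f idx = map snd (filter fst (entries f idx))"

abbreviation "bad_stop z \<equiv> snd z \<le> length (matches (fst (fst z)) (snd (fst z))) \<and>
    far (matches (fst (fst z)) (snd (fst z)) ! (snd z - 1))"

text \<open>The stopping index is uniform on \<open>Q\<close> values and independent of the list of matches, of which
  at most \<open>Q / 20\<close> are far in expectation.\<close>

lemma prob_bad_stop: "measure_pmf.prob P {z. bad_stop z} \<le> 1 / 20"
proof -
  let ?E = "\<lambda>s z. far (snd s) \<and> SG (fst z) (snd z) (fst s) (snd s) = ST (fst z) (snd z) (fst s)"
  let ?S = "{..<L} \<times> {..<n}"
  have cnt: "length (filter far (matches f idx)) = (\<Sum>s\<in>?S. of_bool (?E s (f, idx)))" for f idx
  proof -
    have "length (filter far (matches f idx)) = length (filter (\<lambda>e. fst e \<and> far (snd e)) (entries f idx))"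
      by (simp add: matches_def filter_map o_def conj_commute)
    also have "\<dots> = (\<Sum>s\<in>?S. of_bool (?E s (f, idx)))"
      unfolding length_filter_entries by (intro sum.cong arg_cong[where f = of_bool]) auto
    finally show ?thesis .
  qed
  have step: "measure_pmf.prob pR {r. r \<le> length xs \<and> far (xs ! (r - 1))} \<le>
      real (length (filter far xs)) / real Q" for xs
  proof -
    have "measure_pmf.prob pR {r. r \<le> length xs \<and> far (xs ! (r - 1))} =
        real (card ({Q..<2 * Q} \<inter> {r. r \<le> length xs \<and> far (xs ! (r - 1))})) / real Q"
      unfolding pR_def using pos by (subst measure_pmf_of_set) auto
    also have "card ({Q..<2 * Q} \<inter> {r. r \<le> length xs \<and> far (xs ! (r - 1))}) \<le>
        card {i. i < length xs \<and> far (xs ! i)}"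
      using pos by (intro card_inj_on_le[where f = "\<lambda>r. r - 1"]) (auto simp: inj_on_def)
    also have "\<dots> = length (filter far xs)" by (simp add: length_filter_conv_card)
    finally show ?thesis using pos by (simp add: divide_right_mono)
  qed
  have "measure_pmf.prob P {z. bad_stop z} = measure_pmf.expectation (pair_pmf pF pI) (\<lambda>z.
      measure_pmf.prob pR {r. r \<le> length (matches (fst z) (snd z)) \<and> far (matches (fst z) (snd z) ! (r - 1))})"
    by (rule prob_pair_pmf[where E = "\<lambda>z r. r \<le> length (matches (fst z) (snd z)) \<and>
      far (matches (fst z) (snd z) ! (r - 1))"])
  also have "\<dots> \<le> measure_pmf.expectation (pair_pmf pF pI) (\<lambda>z. real (\<Sum>s\<in>?S. of_bool (?E s z)) / real Q)"
  proof (rule pmf_expectation_mono[where B = "real (card ?S) / real Q"])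
    fix z
    show "measure_pmf.prob pR {r. r \<le> length (matches (fst z) (snd z)) \<and>
        far (matches (fst z) (snd z) ! (r - 1))} \<le> real (\<Sum>s\<in>?S. of_bool (?E s z)) / real Q"
      using step[of "matches (fst z) (snd z)"] unfolding cnt prod.collapse .
    have "(\<Sum>s\<in>?S. of_bool (?E s z)) \<le> (\<Sum>s\<in>?S. 1 :: nat)" by (intro sum_mono) auto
    hence "(\<Sum>s\<in>?S. of_bool (?E s z)) \<le> card ?S" by simp
    thus "real (\<Sum>s\<in>?S. of_bool (?E s z)) / real Q \<le> real (card ?S) / real Q"
      by (intro divide_right_mono of_nat_mono) auto
  qed auto
  also have "\<dots> = measure_pmf.expectation (pair_pmf pF pI) (\<lambda>z. real (\<Sum>s\<in>?S. of_bool (?E s z))) / real Q"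
    by (rule integral_divide_zero)
  also have "\<dots> \<le> (real (card ?S) * (p2 ^ k + 1 / 2 ^ w)) / real Q"
  proof (intro divide_right_mono prob_count_ge(2)[where B = 1])
    fix s assume "s \<in> ?S"
    thus "measure_pmf.prob (pair_pmf pF pI) {z. ?E s z} \<le> p2 ^ k + 1 / 2 ^ w"
      by (intro prob_far_match) auto
  qed auto
  also have "\<dots> \<le> (real Q / 20) / real Q"
    using farQ by (intro divide_right_mono) (auto simp: card_cartesian_product)
  also have "\<dots> = 1 / 20" using pos by simp
  finally show ?thesis .
qed

lemma Sk_props: "{k * m..<M} \<subseteq> {..<M}" "{k * m..<M} \<noteq> {}" "card {k * m..<M} = Ns * Bb"
  using M_eq pos by auto

lemma thr_iff: "j \<le> thr \<longleftrightarrow> real j \<le> real (Ns * Bb) * ((1 - p1) / 2 + (p1 - p2) / 4)"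
proof -
  have "p1 \<le> 1" using near(2) measure_pmf.prob_le_1 order_trans by blast
  hence "0 \<le> real (Ns * Bb) * ((1 - p1) / 2 + (p1 - p2) / 4)" using p12 by simp
  thus ?thesis unfolding thr_eq by (simp add: le_nat_iff le_floor_iff)
qed

text \<open>Both mean rates are at least \<open>(p1 - p2) / 4\<close> away from the threshold; at
  this deviation the Hoeffding exponent is the one in \<open>hoeff\<close>.\<close>

lemma exp_eq: "exp (- 2 * real (card {k * m..<M}) * ((p1 - p2) / 4)\<^sup>2) \<le> 1 / (20 * real n)"
  using hoeff Sk_props(3) by (simp add: power_divide mult_ac)

lemma prob_bad_near: "measure_pmf.prob pF {f. \<not> mis f x0 \<le> thr} \<le> 1 / 20"
proof -
  interpret W: word_hash D "c x0" "a x0" b w by (rule wh[OF near(1)])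
  have "measure_pmf.prob pF {f. \<not> mis f x0 \<le> thr} \<le> measure_pmf.prob pF
    {f. real (card {k * m..<M}) * ((1 - W.pc) / 2 + (p1 - p2) / 4) \<le>
      real (card {i \<in> {k * m..<M}. a x0 (f i) mod 2 \<noteq> b (f i) mod 2})}"
  proof (rule measure_pmf.finite_measure_mono)
    have "real (Ns * Bb) * ((1 - W.pc) / 2 + (p1 - p2) / 4) \<le> real (Ns * Bb) * ((1 - p1) / 2 + (p1 - p2) / 4)"
      using near(2) by (intro mult_left_mono) auto
    thus "{f. \<not> mis f x0 \<le> thr} \<subseteq> {f. real (card {k * m..<M}) * ((1 - W.pc) / 2 + (p1 - p2) / 4) \<le>
      real (card {i \<in> {k * m..<M}. a x0 (f i) mod 2 \<noteq> b (f i) mod 2})}"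
      unfolding thr_iff Sk_props(3) mis_def by auto
  qed auto
  also have "\<dots> \<le> exp (- 2 * real (card {k * m..<M}) * ((p1 - p2) / 4)\<^sup>2)"
    unfolding pF_def by (rule W.prob_mismatches) (use pos w_ge Sk_props p12 in auto)
  also have "\<dots> \<le> 1 / (20 * real n)" by (rule exp_eq)
  also have "\<dots> \<le> 1 / 20" using near(1) by (simp add: divide_le_eq)
  finally show ?thesis .
qed

text \<open>A union bound over all points, for which \<open>hoeff\<close> provides the factor
  \<open>1 / n\<close>. Points at intermediate distance are not covered: they may fail the
  verification or pass it.\<close>

lemma prob_bad_far: "measure_pmf.prob pF {f. \<exists>x<n. far x \<and> mis f x \<le> thr} \<le> 1 / 20"
proof -
  have one: "measure_pmf.prob pF {f. far x \<and> mis f x \<le> thr} \<le> 1 / (20 * real n)" if x: "x < n" for x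
  proof (cases "far x")
    case True
    interpret W: word_hash D "c x" "a x" b w by (rule wh[OF x])
    have "measure_pmf.prob pF {f. far x \<and> mis f x \<le> thr} \<le> measure_pmf.prob pF
      {f. real (card {i \<in> {k * m..<M}. a x (f i) mod 2 \<noteq> b (f i) mod 2})
        \<le> real (card {k * m..<M}) * ((1 - W.pc) / 2 - (p1 - p2) / 4)}"
    proof (rule measure_pmf.finite_measure_mono)
      have "real (Ns * Bb) * ((1 - p1) / 2 + (p1 - p2) / 4) \<le> real (Ns * Bb) * ((1 - W.pc) / 2 - (p1 - p2) / 4)"
      proof (rule mult_left_mono)
        show "(1 - p1) / 2 + (p1 - p2) / 4 \<le> (1 - W.pc) / 2 - (p1 - p2) / 4"
          using far[OF x True] by (simp add: field_simps)
      qed simp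
      thus "{f. far x \<and> mis f x \<le> thr} \<subseteq>
        {f. real (card {i \<in> {k * m..<M}. a x (f i) mod 2 \<noteq> b (f i) mod 2})
        \<le> real (card {k * m..<M}) * ((1 - W.pc) / 2 - (p1 - p2) / 4)}"
        unfolding thr_iff Sk_props(3) mis_def by auto
    qed auto
    also have "\<dots> \<le> exp (- 2 * real (card {k * m..<M}) * ((p1 - p2) / 4)\<^sup>2)"
      unfolding pF_def by (rule W.prob_mismatches) (use pos w_ge Sk_props p12 in auto)
    finally show ?thesis using exp_eq by linarith
  qed simp
  have eq: "{f. \<exists>x<n. far x \<and> mis f x \<le> thr} = (\<Union>x<n. {f. far x \<and> mis f x \<le> thr})" by auto
  have "measure_pmf.prob pF {f. \<exists>x<n. far x \<and> mis f x \<le> thr} \<le>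
      (\<Sum>x<n. measure_pmf.prob pF {f. far x \<and> mis f x \<le> thr})"
    unfolding eq by (rule measure_pmf.finite_measure_subadditive_finite) auto
  also have "\<dots> \<le> (\<Sum>x<n. 1 / (20 * real n))" using one by (intro sum_mono) auto
  also have "\<dots> = 1 / 20" using near(1) by simp
  finally show ?thesis .
qed

abbreviation "bad_row Rw Lv z \<equiv> \<forall>r\<in>Rw. \<not> (\<forall>j\<in>Lv. c x0 (fst z (j * m + snd z r j)))"

lemma prob_bad_rows:
  "measure_pmf.prob (pair_pmf pF pI) {z. bad_row {..<nA} {..<k1} z} \<le> 1 / 10"
  "measure_pmf.prob (pair_pmf pF pI) {z. bad_row {nA..<nA + nB} {k1..<k} z} \<le> 1 / 10"
proof -
  interpret R1: row_selection D "c x0" d0 M k m "{..<k1}" using pos km_le by unfold_locales auto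
  interpret R2: row_selection D "c x0" d0 M k m "{k1..<k}" using pos km_le by unfold_locales auto
  show "measure_pmf.prob (pair_pmf pF pI) {z. bad_row {..<nA} {..<k1} z} \<le> 1 / 10"
    using R1.prob_no_row_hits[of p1 "{..<nA}" "nA + nB" "\<lambda>_. 0"] p12 near mk nAB
    by (simp add: R1.pf_def R1.pV_def R1.hit_def pF_def pI_def pV_def)
  have "{nA..<nA + nB} \<subseteq> {..<nA + nB}" by auto
  thus "measure_pmf.prob (pair_pmf pF pI) {z. bad_row {nA..<nA + nB} {k1..<k} z} \<le> 1 / 10"
    using R2.prob_no_row_hits[of p1 "{nA..<nA + nB}" "nA + nB" "\<lambda>_. 0"] p12 near mk nAB
    by (simp add: R2.pf_def R2.pV_def R2.hit_def pF_def pI_def pV_def)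
qed

text \<open>The deterministic part: an agreeing half row on each side determines one table in which
  the whole row agrees, so \<open>x0\<close> is among its matches and passes the verification. The
  conditions of \<open>scan_good\<close> then hold.\<close>

lemma outcome_good:
  assumes f: "f \<in> set_pmf pF" and idx: "idx \<in> set_pmf pI" and r: "r \<in> set_pmf pR"
    and "\<not> bad_row {..<nA} {..<k1} (f, idx)" "\<not> bad_row {nA..<nA + nB} {k1..<k} (f, idx)"
    and ok: "mis f x0 \<le> thr" "\<not> (\<exists>x<n. far x \<and> mis f x \<le> thr)"
    and "\<not> bad_spurious (f, idx)" "\<not> bad_stop ((f, idx), r)"
  shows "outcome f idx r < n \<and> \<not> far (outcome f idx r)"
proof -
  obtain ra where ra: "ra < nA" "\<forall>j<k1. c x0 (f (j * m + idx ra j))" using assms(4) by auto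
  obtain rb where "rb \<in> {nA..<nA + nB}" "\<forall>j\<in>{k1..<k}. c x0 (f (j * m + idx rb j))" using assms(5) by auto
  then obtain s where s: "s < nB" "\<forall>j\<in>{k1..<k}. c x0 (f (j * m + idx (nA + s) j))"
    by (metis atLeastLessThan_iff le_Suc_ex nat_add_left_cancel_less)
  define t where "t = ra * nB + s"
  have tt: "t div nB = ra" "t mod nB = s" using s(1) by (auto simp: t_def)
  have "Suc ra * nB \<le> nA * nB" using ra by (intro mult_le_mono1) auto
  hence t: "t < L" using s(1) by (simp add: t_def)
  have "\<forall>j<k. c x0 (f (loc idx t j))"
    using ra s tt by (auto simp: loc_def sel_def)
  hence "SG f idx t x0 = ST f idx t" by (rule all_coll[OF f idx t near(1)])
  hence x0: "(True, x0) \<in> set (entries f idx)"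
    using t near(1) by (auto simp: entries_def intro!: bexI[of _ t])
  have es_n: "x < n" if "(u, x) \<in> set (entries f idx)" for u x
    using that by (auto simp: entries_def)
  have r0: "0 < r"
  proof -
    have "set_pmf pR = {Q..<2 * Q}" unfolding pR_def using pos by (intro set_pmf_of_set) auto
    thus ?thesis using r pos by auto
  qed
  show ?thesis unfolding outcome_def
  proof (rule scan_good[where near = x0])
    show "length (filter (\<lambda>e. \<not> fst e) (entries f idx)) < bud2" using assms(8) by simp
    show "0 < r" by fact
    show "(True, x0) \<in> set (entries f idx)" by fact
    show "mis f x0 \<le> thr" by fact
    show "x < n \<and> \<not> far x" if "(True, x) \<in> set (entries f idx)" "mis f x \<le> thr" for x
      using that es_n ok(2) by auto
    show "map snd (filter fst (entries f idx)) ! (r - 1) < n \<and>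
        \<not> far (map snd (filter fst (entries f idx)) ! (r - 1))"
      if "r \<le> length (filter fst (entries f idx))"
    proof -
      have "filter fst (entries f idx) ! (r - 1) \<in> set (filter fst (entries f idx))"
        using that r0 by (intro nth_mem) auto
      hence "snd (filter fst (entries f idx) ! (r - 1)) < n"
        using es_n by (metis filter_is_subset prod.collapse subsetD)
      moreover have "r - 1 < length (filter fst (entries f idx))" using that r0 by simp
      moreover have "\<not> far (matches f idx ! (r - 1))" using assms(9) that by (simp add: matches_def)
      ultimately show ?thesis by (simp add: matches_def)
    qed
  qed
qed

lemma prob_outcome:
  "1 / 2 \<le> measure_pmf.prob (pair_pmf pF (pair_pmf pI pR))
     {z. outcome (fst z) (fst (snd z)) (snd (snd z)) < n \<and> \<not> far (outcome (fst z) (fst (snd z)) (snd (snd z)))}"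
proof -
  let ?G = "\<lambda>z. outcome (fst (fst z)) (snd (fst z)) (snd z) < n \<and> \<not> far (outcome (fst (fst z)) (snd (fst z)) (snd z))"
  have fstE: "measure_pmf.prob P {z. E (fst z)} = measure_pmf.prob (pair_pmf pF pI) {z. E z}" for E
    by (subst (2) map_fst_pair_pmf[of "pair_pmf pF pI" pR, symmetric]) (simp add: vimage_def)
  have fstF: "measure_pmf.prob P {z. E (fst (fst z))} = measure_pmf.prob pF {z. E z}" for E
    unfolding fstE[of "\<lambda>z. E (fst z)"]
    by (subst (2) map_fst_pair_pmf[of pF pI, symmetric]) (simp add: vimage_def)
  let ?B = "{z. bad_row {..<nA} {..<k1} (fst z)} \<union> ({z. bad_row {nA..<nA + nB} {k1..<k} (fst z)} \<union>
    ({z. \<not> mis (fst (fst z)) x0 \<le> thr} \<union> ({z. \<exists>x<n. far x \<and> mis (fst (fst z)) x \<le> thr} \<union>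
    ({z. bad_spurious (fst z)} \<union> {z. bad_stop z}))))"
  have "1 - measure_pmf.prob P {z. ?G z} = measure_pmf.prob P {z. \<not> ?G z}"
    using measure_pmf.prob_compl[of "{z. ?G z}" P] by (simp add: Collect_neg_eq[symmetric] Compl_eq_Diff_UNIV[symmetric])
  also have "\<dots> \<le> measure_pmf.prob P ?B"
  proof (rule measure_pmf.finite_measure_mono_AE)
    show "AE z in P. z \<in> {z. \<not> ?G z} \<longrightarrow> z \<in> ?B"
    proof (rule AE_pmfI, rule impI, rule ccontr)
      fix z assume z: "z \<in> set_pmf P" "z \<in> {z. \<not> ?G z}" "z \<notin> ?B"
      have "?G z" using z(1,3) by (intro outcome_good) auto
      thus False using z(2) by blast
    qed
  qed auto
  also have "\<dots> \<le> measure_pmf.prob P {z. bad_row {..<nA} {..<k1} (fst z)} +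
    (measure_pmf.prob P {z. bad_row {nA..<nA + nB} {k1..<k} (fst z)} +
    (measure_pmf.prob P {z. \<not> mis (fst (fst z)) x0 \<le> thr} +
    (measure_pmf.prob P {z. \<exists>x<n. far x \<and> mis (fst (fst z)) x \<le> thr} +
    (measure_pmf.prob P {z. bad_spurious (fst z)} + measure_pmf.prob P {z. bad_stop z}))))"
    by (intro order_trans[OF measure_Un_le] add_left_mono order_refl) auto
  \<comment> \<open>The six failure probabilities add up to \<open>2 / 5\<close>, below the allowed
    \<open>1 / 2\<close>.\<close>
  also have "\<dots> \<le> 1 / 10 + (1 / 10 + (1 / 20 + (1 / 20 + (1 / 20 + 1 / 20))))"
    unfolding fstE[of "bad_row {..<nA} {..<k1}"] fstE[of "bad_row {nA..<nA + nB} {k1..<k}"]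
      fstF[of "\<lambda>f. \<not> mis f x0 \<le> thr"] fstF[of "\<lambda>f. \<exists>x<n. far x \<and> mis f x \<le> thr"]
      fstE[of "bad_spurious"]
    by (intro add_mono prob_bad_rows prob_bad_near prob_bad_far prob_bad_spurious prob_bad_stop)
  finally have "1 / 2 \<le> measure_pmf.prob P {z. ?G z}" by simp
  also have "pair_pmf pF (pair_pmf pI pR) = map_pmf (\<lambda>z. (fst (fst z), snd (fst z), snd z)) P"
    unfolding pair_pmf_def map_pmf_def by (simp add: bind_assoc_pmf bind_return_pmf)
  hence "measure_pmf.prob P {z. ?G z} = measure_pmf.prob (pair_pmf pF (pair_pmf pI pR))
     {z. outcome (fst z) (fst (snd z)) (snd (snd z)) < n \<and> \<not> far (outcome (fst z) (fst (snd z)) (snd (snd z)))}"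
    by (simp add: vimage_def)
  finally show ?thesis .
qed

end

section \<open>Reduction to discrete hash values\<close>

text \<open>Shifting by \<open>s\<close> permutes the residues, so the condition selects one residue
  \<open>e\<close>, which occurs once in each of the \<open>K\<close> blocks of length
  \<open>2 ^ B\<close>.\<close>

lemma card_shifted_residue:
  fixes K B s c :: nat
  assumes "c < 2 ^ B"
  shows "card {j. j < K * 2 ^ B \<and> (j + s) mod 2 ^ B = c} = K"
proof -
  define M :: nat where "M = 2 ^ B"
  have M: "0 < M" "c < M" using assms by (auto simp: M_def)
  define e where "e = (c + (M - s mod M)) mod M"
  have e: "e < M" using M by (simp add: e_def)
  have es: "(e + s) mod M = c"
  proof -
    have sM: "s mod M < M" using M by simp
    have "(e + s) mod M = (c + (M - s mod M) + s mod M) mod M"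
      by (simp add: e_def mod_simps)
    also have "c + (M - s mod M) + s mod M = c + M" using sM by linarith
    finally show ?thesis using M by simp
  qed
  have uniq: "j mod M = e" if "(j + s) mod M = c" for j
  proof -
    have "(int j + int s) mod int M = (int e + int s) mod int M"
      using that es by (metis of_nat_add of_nat_mod)
    hence "int M dvd (int j + int s) - (int e + int s)" by (simp only: mod_eq_dvd_iff)
    hence "int M dvd int j - int e" by simp
    hence "int j mod int M = int e mod int M" by (simp only: mod_eq_dvd_iff)
    thus ?thesis using e by (metis mod_less of_nat_eq_iff of_nat_mod)
  qed
  have "{j. j < K * M \<and> (j + s) mod M = c} = (\<lambda>q. q * M + e) ` {..<K}"
  proof safe
    fix j assume j: "j < K * M" "c = (j + s) mod M"
    hence "j = (j div M) * M + e" using uniq[of j] by (metis div_mult_mod_eq)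
    moreover have "j div M < K" using j by (simp add: less_mult_imp_div_less)
    ultimately show "j \<in> (\<lambda>q. q * M + e) ` {..<K}" by blast
  next
    fix q assume q: "q < K"
    have "Suc q * M \<le> K * M" using q by (intro mult_le_mono1) auto
    thus "q * M + e < K * M" using e by simp
    have "(q * M + e + s) mod M = (e + s) mod M" by (simp add: add.assoc)
    thus "(q * M + e + s) mod M = c" using es by simp
  qed
  moreover have "inj_on (\<lambda>q. q * M + e) {..<K}" using M by (auto simp: inj_on_def)
  ultimately show ?thesis by (simp add: card_image M_def)
qed

text \<open>The joint law of the two values is uniform on \<open>N^2\<close> pairs, where
  \<open>N = 2 ^ w\<close>. Each first value leaves exactly \<open>2 ^ (w - B)\<close> second
  values, because \<open>2 ^ B\<close> divides \<open>N\<close>. This supplies the assumption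
  \<open>unif\<close> of \<open>word_hash\<close>.\<close>

lemma pairwise_independent_shift:
  assumes U: "pairwise_independent_family R (2 ^ w) U" and ab: "a \<in> R" "b \<in> R" "a \<noteq> b" and B: "B \<le> w"
  shows "measure U {u \<in> space U. (u a + s) mod 2 ^ B = (u b + s') mod 2 ^ B} = 1 / 2 ^ B"
proof -
  interpret prob_space U using U by (simp add: pairwise_independent_family_def)
  define N :: nat where "N = 2 ^ w"
  have meas: "(\<lambda>u. u x) \<in> U \<rightarrow>\<^sub>M count_space {..<N}" if "x \<in> R" for x
    using U that by (simp add: pairwise_independent_family_def N_def)
  have lt: "u x < N" if "u \<in> space U" "x \<in> R" for u x
    using measurable_space[OF meas[OF that(2)] that(1)] by simp
  have single: "{u \<in> space U. u x = i} \<in> sets U" if "x \<in> R" for x i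
  proof (cases "i < N")
    case True
    have "(\<lambda>u. u x) -` {i} \<inter> space U \<in> sets U"
      using True by (intro measurable_sets[OF meas[OF that]]) auto
    also have "(\<lambda>u. u x) -` {i} \<inter> space U = {u \<in> space U. u x = i}" by auto
    finally show ?thesis .
  next
    case False
    hence "{u \<in> space U. u x = i} = {}" using lt that by auto
    thus ?thesis by (simp only: sets.empty_sets)
  qed
  let ?A = "\<lambda>p. {u \<in> space U. u a = fst p \<and> u b = snd p}"
  have A: "?A p \<in> sets U" for p
  proof -
    have "?A p = {u \<in> space U. u a = fst p} \<inter> {u \<in> space U. u b = snd p}" by auto
    thus ?thesis using single ab by auto
  qed
  let ?S = "SIGMA i:{..<N}. {j. j < N \<and> (j + s') mod 2 ^ B = (i + s) mod 2 ^ B}"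
  have finS: "finite ?S" by (intro finite_SigmaI) auto
  have eq: "{u \<in> space U. (u a + s) mod 2 ^ B = (u b + s') mod 2 ^ B} = (\<Union>p\<in>?S. ?A p)"
    using lt ab by auto
  have "measure U (\<Union>p\<in>?S. ?A p) = (\<Sum>p\<in>?S. measure U (?A p))"
    using finS A by (intro finite_measure_finite_Union) (auto simp: disjoint_family_on_def)
  also have "\<dots> = (\<Sum>p\<in>?S. 1 / real N ^ 2)"
    using U ab by (intro sum.cong) (auto simp: pairwise_independent_family_def N_def)
  also have "\<dots> = real (card ?S) / real N ^ 2" by simp
  also have "card ?S = N * 2 ^ (w - B)"
  proof -
    have N: "N = 2 ^ (w - B) * 2 ^ B" using B by (simp add: N_def flip: power_add)
    have "card {j. j < N \<and> (j + s') mod 2 ^ B = (i + s) mod 2 ^ B} = 2 ^ (w - B)" for i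
      unfolding N by (rule card_shifted_residue) simp
    thus ?thesis by (simp add: card_SigmaI)
  qed
  also have "real (N * 2 ^ (w - B)) / real N ^ 2 = 1 / 2 ^ B"
  proof -
    have "real N = 2 ^ (w - B) * 2 ^ B" using B by (simp add: N_def flip: power_add)
    thus ?thesis by (simp add: power2_eq_square)
  qed
  finally show ?thesis unfolding eq .
qed

lemma measure_pair_Times:
  assumes "sigma_finite_measure N" "A \<in> sets M" "B \<in> sets N"
  shows "measure (M \<Otimes>\<^sub>M N) (A \<times> B) = measure M A * measure N B"
  using assms by (simp add: measure_def sigma_finite_measure.emeasure_pair_measure_Times enn2real_mult)

lemma measurable_countable_range:
  assumes "countable C" "\<And>x. x \<in> space M \<Longrightarrow> f x \<in> C" "\<And>c. c \<in> C \<Longrightarrow> f -` {c} \<inter> space M \<in> sets M"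
  shows "f \<in> M \<rightarrow>\<^sub>M count_space UNIV"
proof (rule measurableI)
  fix A
  have "f -` A \<inter> space M = (\<Union>c\<in>A \<inter> C. f -` {c} \<inter> space M)" using assms(2) by auto
  also have "\<dots> \<in> sets M" using assms by (intro sets.countable_UN') auto
  finally show "f -` A \<inter> space M \<in> sets M" .
qed auto

text \<open>A law on a countable set is a probability mass function: the points of \<open>C\<close>
  without mass form a countable union of null sets, hence almost every point has mass.\<close>

lemma discrete_law_pmf:
  assumes "prob_space M" "f \<in> M \<rightarrow>\<^sub>M count_space UNIV" "countable C" "\<And>x. x \<in> space M \<Longrightarrow> f x \<in> C"
  obtains p where "measure_pmf p = distr M (count_space UNIV) f"
proof -
  interpret prob_space M by fact
  let ?D = "distr M (count_space UNIV) f"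
  interpret D: prob_space ?D by (rule prob_space_distr) fact
  have "AE x in ?D. measure ?D {x} \<noteq> 0"
  proof (rule AE_I[where N = "(\<Union>c\<in>{c \<in> C. measure ?D {c} = 0}. {c}) \<union> - C"])
    show "{x \<in> space ?D. \<not> measure ?D {x} \<noteq> 0} \<subseteq> (\<Union>c\<in>{c \<in> C. measure ?D {c} = 0}. {c}) \<union> - C"
      by auto
    have "(\<Union>c\<in>{c \<in> C. measure ?D {c} = 0}. {c}) \<in> null_sets ?D"
      using assms(3) by (intro null_sets_UN') (auto simp: D.emeasure_eq_measure null_sets_def)
    moreover have "- C \<in> null_sets ?D"
    proof -
      have "f -` (- C) \<inter> space M = {}" using assms(4) by auto
      thus ?thesis using assms(2) by (auto simp: null_sets_def emeasure_distr)
    qed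
    ultimately show "emeasure ?D ((\<Union>c\<in>{c \<in> C. measure ?D {c} = 0}. {c}) \<union> - C) = 0"
      by (metis null_setsD1 null_sets.Un)
  qed auto
  hence "measure_pmf (Abs_pmf ?D) = ?D"
    using D.prob_space_axioms by (intro Abs_pmf_inverse) auto
  thus ?thesis using that by blast
qed

text \<open>All that a query sees of a function pair: its values on the finite set \<open>Z\<close>.
  The words \<open>u (h x)\<close> are recorded instead of \<open>u\<close>, so the range is
  countable even for continuous distributions.\<close>

definition hash_values :: "'x set \<Rightarrow> ('x \<Rightarrow> 'r) \<times> ('r \<Rightarrow> nat) \<Rightarrow> ('x \<Rightarrow> 'r) \<times> ('x \<Rightarrow> nat)" where
  "hash_values Z = (\<lambda>(h, u). (restrict h Z, restrict (\<lambda>x. u (h x)) Z))"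

locale hash_setup =
  fixes X :: "'x set" and R :: "'r set" and H :: "('x \<Rightarrow> 'r) measure" and U :: "('r \<Rightarrow> nat) measure"
    and w :: nat and Z :: "'x set"
  assumes H: "hash_distribution X R H" and U: "pairwise_independent_family R (2 ^ w) U"
    and Z: "finite Z" "Z \<subseteq> X"
begin

lemma prob_H: "prob_space H" and R: "countable R"
  and meas_H: "x \<in> X \<Longrightarrow> (\<lambda>h. h x) \<in> H \<rightarrow>\<^sub>M count_space R"
  using H by (auto simp: hash_distribution_def)

lemma prob_U: "prob_space U" and meas_U: "r \<in> R \<Longrightarrow> (\<lambda>u. u r) \<in> U \<rightarrow>\<^sub>M count_space {..<2 ^ w}"
  using U by (auto simp: pairwise_independent_family_def)

lemma H_in: "h \<in> space H \<Longrightarrow> x \<in> X \<Longrightarrow> h x \<in> R"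
  using measurable_space[OF meas_H] by auto

lemma U_less: "u \<in> space U \<Longrightarrow> r \<in> R \<Longrightarrow> u r < 2 ^ w"
  using measurable_space[OF meas_U] by auto

lemma single_H: "x \<in> X \<Longrightarrow> {h \<in> space H. h x = r} \<in> sets H"
proof (cases "r \<in> R")
  case True
  assume x: "x \<in> X"
  have "(\<lambda>h. h x) -` {r} \<inter> space H \<in> sets H"
    using True by (intro measurable_sets[OF meas_H[OF x]]) auto
  also have "(\<lambda>h. h x) -` {r} \<inter> space H = {h \<in> space H. h x = r}" by auto
  finally show ?thesis .
next
  case False
  assume x: "x \<in> X"
  hence "{h \<in> space H. h x = r} = {}" using False H_in by auto
  thus ?thesis by (simp only: sets.empty_sets)
qed

lemma single_U: "r \<in> R \<Longrightarrow> {u \<in> space U. u r = i} \<in> sets U"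
proof (cases "i < 2 ^ w")
  case True
  assume x: "r \<in> R"
  have "(\<lambda>u. u r) -` {i} \<inter> space U \<in> sets U"
    using True by (intro measurable_sets[OF meas_U[OF x]]) auto
  also have "(\<lambda>u. u r) -` {i} \<inter> space U = {u \<in> space U. u r = i}" by auto
  finally show ?thesis .
next
  case False
  assume x: "r \<in> R"
  hence "{u \<in> space U. u r = i} = {}" using False U_less by auto
  thus ?thesis by (simp only: sets.empty_sets)
qed

definition VH :: "('x \<Rightarrow> 'r) \<times> ('x \<Rightarrow> nat) \<Rightarrow> ('x \<Rightarrow> 'r) set" where
  "VH y = {h \<in> space H. restrict h Z = fst y}"
text \<open>Measurability of \<open>u r\<close> is known only for \<open>r\<close> in
  \<open>R\<close>, hence the empty set for any other first component; such values are not attained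
  anyway.\<close>

definition VU :: "('x \<Rightarrow> 'r) \<times> ('x \<Rightarrow> nat) \<Rightarrow> ('r \<Rightarrow> nat) set" where
  "VU y = (if fst y \<in> Z \<rightarrow>\<^sub>E R then {u \<in> space U. restrict (\<lambda>x. u (fst y x)) Z = snd y} else {})"

lemma sets_VH: "VH y \<in> sets H"
proof (cases "fst y \<in> extensional Z")
  case True
  have "VH y = {h \<in> space H. \<forall>x\<in>Z. h x = fst y x}"
    using True by (auto simp: VH_def restrict_def extensional_def fun_eq_iff)
  also have "\<dots> \<in> sets H"
    using Z single_H by (intro sets.sets_Collect_finite_All) auto
  finally show ?thesis .
next
  case False
  hence "VH y = {}" unfolding VH_def by (metis (mono_tags, lifting) Collect_empty_eq restrict_extensional)
  thus ?thesis by simp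
qed

lemma sets_VU: "VU y \<in> sets U"
proof (cases "fst y \<in> Z \<rightarrow>\<^sub>E R \<and> snd y \<in> extensional Z")
  case True
  have "VU y = {u \<in> space U. \<forall>x\<in>Z. u (fst y x) = snd y x}"
    using True by (auto simp: VU_def restrict_def extensional_def fun_eq_iff)
  also have "\<dots> \<in> sets U"
    using Z single_U True by (intro sets.sets_Collect_finite_All) (auto simp: PiE_iff)
  finally show ?thesis .
next
  case False
  hence "VU y = {}" unfolding VU_def
    by (metis (mono_tags, lifting) Collect_empty_eq restrict_extensional)
  thus ?thesis by simp
qed

text \<open>The recorded words depend on both functions, yet the preimage of one value is a
  rectangle: once the value \<open>y\<close> is fixed, \<open>u\<close> is evaluated at the
  constants \<open>fst y x\<close> instead of \<open>h x\<close>.\<close>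

lemma hash_values_eq_iff:
  assumes "h \<in> space H" "u \<in> space U"
  shows "hash_values Z (h, u) = y \<longleftrightarrow> h \<in> VH y \<and> u \<in> VU y"
proof
  assume "hash_values Z (h, u) = y"
  hence y: "y = (restrict h Z, restrict (\<lambda>x. u (h x)) Z)" by (simp add: hash_values_def)
  have "restrict h Z \<in> Z \<rightarrow>\<^sub>E R" using H_in assms(1) Z(2) by auto
  moreover have "restrict (\<lambda>x. u (restrict h Z x)) Z = restrict (\<lambda>x. u (h x)) Z"
    by (auto simp: restrict_def)
  ultimately show "h \<in> VH y \<and> u \<in> VU y" using assms by (simp add: y VH_def VU_def)
next
  assume *: "h \<in> VH y \<and> u \<in> VU y"
  have h: "restrict h Z = fst y" using * by (auto simp: VH_def)
  have "restrict (\<lambda>x. u (fst y x)) Z = snd y" using * by (auto simp: VU_def split: if_splits)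
  moreover have "restrict (\<lambda>x. u (fst y x)) Z = restrict (\<lambda>x. u (h x)) Z"
    unfolding h[symmetric] by (auto simp: restrict_def)
  ultimately show "hash_values Z (h, u) = y" using h by (simp add: hash_values_def prod_eq_iff)
qed

lemma hash_values_preimage: "{z \<in> space (H \<Otimes>\<^sub>M U). hash_values Z z \<in> {y}} = VH y \<times> VU y"
proof (rule set_eqI)
  fix z :: "('x \<Rightarrow> 'r) \<times> ('r \<Rightarrow> nat)"
  obtain h u where z: "z = (h, u)" by (cases z)
  have "VH y \<subseteq> space H" "VU y \<subseteq> space U" by (auto simp: VH_def VU_def)
  thus "z \<in> {z \<in> space (H \<Otimes>\<^sub>M U). hash_values Z z \<in> {y}} \<longleftrightarrow> z \<in> VH y \<times> VU y"
    unfolding z using hash_values_eq_iff[of h u y] by (auto simp only: space_pair_measure mem_Sigma_iff mem_Collect_eq singleton_iff)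
qed

definition vals :: "(('x \<Rightarrow> 'r) \<times> ('x \<Rightarrow> nat)) set" where
  "vals = (Z \<rightarrow>\<^sub>E R) \<times> (Z \<rightarrow>\<^sub>E UNIV)"

lemma countable_vals: "countable vals"
  unfolding vals_def using Z R by (intro countable_SIGMA countable_PiE) auto

lemma hash_values_in: "h \<in> space H \<Longrightarrow> hash_values Z (h, u) \<in> vals"
  using H_in Z(2) by (auto simp: hash_values_def vals_def)

lemma meas_hash_values: "hash_values Z \<in> H \<Otimes>\<^sub>M U \<rightarrow>\<^sub>M count_space UNIV"
proof (rule measurable_countable_range[OF countable_vals])
  show "hash_values Z x \<in> vals" if "x \<in> space (H \<Otimes>\<^sub>M U)" for x
    using that hash_values_in by (cases x) (auto simp: space_pair_measure)
  fix y
  have "hash_values Z -` {y} \<inter> space (H \<Otimes>\<^sub>M U) = VH y \<times> VU y"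
    using hash_values_preimage[of y] by (auto simp only: vimage_def Int_def mem_Collect_eq)
  thus "hash_values Z -` {y} \<inter> space (H \<Otimes>\<^sub>M U) \<in> sets (H \<Otimes>\<^sub>M U)"
    using sets_VH sets_VU by auto
qed

lemma prob_HU: "prob_space (H \<Otimes>\<^sub>M U)"
proof -
  interpret H: prob_space H by (rule prob_H)
  interpret U: prob_space U by (rule prob_U)
  interpret pair_prob_space H U ..
  show ?thesis by unfold_locales
qed

definition D :: "(('x \<Rightarrow> 'r) \<times> ('x \<Rightarrow> nat)) pmf" where
  "D = (SOME p. measure_pmf p = distr (H \<Otimes>\<^sub>M U) (count_space UNIV) (hash_values Z))"

lemma D: "measure_pmf D = distr (H \<Otimes>\<^sub>M U) (count_space UNIV) (hash_values Z)"
proof -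
  have "\<exists>p. measure_pmf p = distr (H \<Otimes>\<^sub>M U) (count_space UNIV) (hash_values Z)"
    by (rule discrete_law_pmf[OF prob_HU meas_hash_values countable_vals])
       (use hash_values_in in \<open>auto simp: space_pair_measure\<close>)
  thus ?thesis unfolding D_def by (rule someI_ex)
qed

lemma prob_D: "measure_pmf.prob D S = measure (H \<Otimes>\<^sub>M U) {z \<in> space (H \<Otimes>\<^sub>M U). hash_values Z z \<in> S}"
  unfolding D using meas_hash_values
  by (subst measure_distr) (auto simp: vimage_def Int_def conj_commute)

lemma pmf_D: "pmf D y = measure H (VH y) * measure U (VU y)"
proof -
  interpret H: prob_space H by (rule prob_H)
  interpret U: prob_space U by (rule prob_U)
  interpret pair_prob_space H U ..
  have "pmf D y = measure (H \<Otimes>\<^sub>M U) {z \<in> space (H \<Otimes>\<^sub>M U). hash_values Z z \<in> {y}}"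
    by (subst prob_D[symmetric]) (simp add: pmf.rep_eq)
  also have "{z \<in> space (H \<Otimes>\<^sub>M U). hash_values Z z \<in> {y}} = VH y \<times> VU y"
    by (rule hash_values_preimage)
  also have "measure (H \<Otimes>\<^sub>M U) (VH y \<times> VU y) = measure H (VH y) * measure U (VU y)"
    using sets_VH sets_VU by (intro measure_pair_Times U.sigma_finite_measure_axioms)
  finally show ?thesis .
qed

lemma set_D: "y \<in> set_pmf D \<Longrightarrow> \<exists>h\<in>space H. \<exists>u\<in>space U. y = hash_values Z (h, u)"
proof -
  assume "y \<in> set_pmf D"
  hence "VH y \<noteq> {}" "VU y \<noteq> {}" using pmf_D[of y] by (auto simp: set_pmf_iff)
  then obtain h u where hu: "h \<in> VH y" "u \<in> VU y" by auto
  moreover have "h \<in> space H" "u \<in> space U" using hu by (auto simp: VH_def VU_def split: if_splits)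
  ultimately show ?thesis using hash_values_eq_iff[of h u y] by metis
qed

lemma prob_coll:
  assumes "x \<in> Z" "q \<in> Z"
  shows "measure_pmf.prob D {y. fst y x = fst y q} = measure H {h \<in> space H. h x = h q}"
proof -
  interpret H: prob_space H by (rule prob_H)
  interpret U: prob_space U by (rule prob_U)
  interpret pair_prob_space H U ..
  have "{h \<in> space H. h x = h q} = (\<Union>r\<in>R. {h \<in> space H. h x = r} \<inter> {h \<in> space H. h q = r})"
    using H_in assms Z by auto
  hence m: "{h \<in> space H. h x = h q} \<in> sets H"
    using R single_H assms Z by (auto intro!: sets.countable_UN' sets.Int)
  have "measure_pmf.prob D {y. fst y x = fst y q} = measure (H \<Otimes>\<^sub>M U) ({h \<in> space H. h x = h q} \<times> space U)"
    unfolding prob_D using assms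
    by (intro arg_cong[where f = "measure _"]) (auto simp: space_pair_measure hash_values_def)
  thus ?thesis using m by (simp add: measure_pair_Times[OF U.sigma_finite_measure_axioms] U.prob_space)
qed

text \<open>Integrate over \<open>h\<close>. When \<open>h\<close> separates the points, their hash
  values are distinct elements of \<open>R\<close> and the section in \<open>u\<close> has
  probability \<open>1 / 2 ^ B\<close> by pairwise independence; otherwise the section is
  empty.\<close>

lemma prob_not_coll:
  assumes x: "x \<in> Z" and q: "q \<in> Z" and B: "B \<le> w"
  shows "measure_pmf.prob D {y. \<not> fst y x = fst y q \<and> (snd y x + s) mod 2 ^ B = (snd y q + s') mod 2 ^ B}
    = (1 - measure_pmf.prob D {y. fst y x = fst y q}) / 2 ^ B"
proof -
  interpret H: prob_space H by (rule prob_H)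
  interpret U: prob_space U by (rule prob_U)
  interpret pair_prob_space H U ..
  let ?S = "{y :: ('x \<Rightarrow> 'r) \<times> ('x \<Rightarrow> nat). \<not> fst y x = fst y q \<and> (snd y x + s) mod 2 ^ B = (snd y q + s') mod 2 ^ B}"
  let ?T = "{z \<in> space (H \<Otimes>\<^sub>M U). hash_values Z z \<in> ?S}"
  have T: "?T \<in> sets (H \<Otimes>\<^sub>M U)"
    using measurable_sets[OF meas_hash_values, of ?S] by (simp add: vimage_def Int_def conj_commute)
  let ?C = "{h \<in> space H. h x = h q}"
  have "?C = (\<Union>r\<in>R. {h \<in> space H. h x = r} \<inter> {h \<in> space H. h q = r})"
    using H_in x q Z by auto
  hence m: "?C \<in> sets H"
    using R single_H x q Z by (auto intro!: sets.countable_UN' sets.Int)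
  have "emeasure (H \<Otimes>\<^sub>M U) ?T = (\<integral>\<^sup>+h. emeasure U (Pair h -` ?T) \<partial>H)"
    by (rule U.emeasure_pair_measure_alt[OF T])
  also have "\<dots> = (\<integral>\<^sup>+h. ennreal (1 / 2 ^ B) * indicator (space H - ?C) h \<partial>H)"
  proof (rule nn_integral_cong)
    fix h assume h: "h \<in> space H"
    have "Pair h -` ?T = (if h x = h q then {} else
        {u \<in> space U. (u (h x) + s) mod 2 ^ B = (u (h q) + s') mod 2 ^ B})"
      using h x q by (auto simp: space_pair_measure hash_values_def)
    thus "emeasure U (Pair h -` ?T) = ennreal (1 / 2 ^ B) * indicator (space H - ?C) h"
      using h x q Z H_in pairwise_independent_shift[OF U _ _ _ B, of "h x" "h q" s s']
      by (auto simp: U.emeasure_eq_measure)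
  qed
  also have "\<dots> = ennreal (1 / 2 ^ B) * emeasure H (space H - ?C)"
    using m by (subst nn_integral_cmult_indicator) auto
  also have "\<dots> = ennreal ((1 - measure H ?C) / 2 ^ B)"
    using m by (simp add: H.emeasure_eq_measure H.prob_compl ennreal_mult' [symmetric])
  finally have "measure (H \<Otimes>\<^sub>M U) ?T = (1 - measure H ?C) / 2 ^ B"
    by (simp add: emeasure_eq_measure)
  thus ?thesis unfolding prob_coll[OF x q] prob_D[of ?S] .
qed

text \<open>The passage from the measure-theoretic sample space to a product of discrete
  distributions. \<open>F\<close> has countable range, so its law is determined by point masses, and
  these factor because preimages of points are boxes. The default \<open>d0\<close> is the one that
  \<open>Pi_pmf\<close> uses outside the index set.\<close>

lemma sample_space_pmf:
  fixes Dst :: "('x, 'r) nn_structure" and d0 :: "('x \<Rightarrow> 'r) \<times> ('x \<Rightarrow> nat)"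
  assumes num: "num_hash Dst = M" "num_univ Dst = M"
  defines "F \<equiv> \<lambda>(hs, us, z). (\<lambda>i. if i < M then hash_values Z (hs i, us i) else d0, z)"
  shows "measure (sample_space H U Dst) {\<omega> \<in> space (sample_space H U Dst). E (F \<omega>)} =
    measure_pmf.prob (pair_pmf (Pi_pmf {..<M} d0 (\<lambda>_. D)) (coins Dst)) {z. E z}"
proof -
  interpret H: prob_space H by (rule prob_H)
  interpret U: prob_space U by (rule prob_U)
  interpret PH: finite_product_prob_space "\<lambda>_. H" "{..<M}" by unfold_locales auto
  interpret PU: finite_product_prob_space "\<lambda>_. U" "{..<M}" by unfold_locales auto
  let ?PH = "\<Pi>\<^sub>M i\<in>{..<M}. H" and ?PU = "\<Pi>\<^sub>M i\<in>{..<M}. U" and ?C = "measure_pmf (coins Dst)"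
  interpret UC: pair_prob_space ?PU ?C ..
  interpret HUC: pair_prob_space ?PH "?PU \<Otimes>\<^sub>M ?C" ..
  have S: "sample_space H U Dst = ?PH \<Otimes>\<^sub>M (?PU \<Otimes>\<^sub>M ?C)" by (simp add: sample_space_def num)
  let ?S = "?PH \<Otimes>\<^sub>M (?PU \<Otimes>\<^sub>M ?C)"
  let ?B = "\<lambda>y z. (PiE {..<M} (\<lambda>i. VH (y i))) \<times> ((PiE {..<M} (\<lambda>i. VU (y i))) \<times> {z})"
  have B_sets: "?B y z \<in> sets ?S" for y z
    using sets_VH sets_VU by (intro pair_measureI sets_PiM_I_finite) auto
  \<comment> \<open>A function that differs from \<open>d0\<close> somewhere outside the index set
    is never attained; any other one has a product of rectangles as its preimage.\<close>
  have pre: "F -` {(y, z)} \<inter> space ?S = (if \<forall>i. i \<notin> {..<M} \<longrightarrow> y i = d0 then ?B y z else {})" for y z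
  proof -
    have iff: "\<omega> \<in> F -` {(y, z)} \<inter> space ?S \<longleftrightarrow> (\<forall>i. i \<notin> {..<M} \<longrightarrow> y i = d0) \<and> \<omega> \<in> ?B y z" for \<omega>
    proof -
      obtain hs us z' where \<omega>: "\<omega> = (hs, us, z')" by (cases \<omega>)
      have "\<omega> \<in> F -` {(y, z)} \<inter> space ?S \<longleftrightarrow>
          hs \<in> space ?PH \<and> us \<in> space ?PU \<and> z' = z \<and>
          (\<forall>i. (if i < M then hash_values Z (hs i, us i) else d0) = y i)"
        by (auto simp: \<omega> F_def space_pair_measure fun_eq_iff)
      also have "\<dots> \<longleftrightarrow> hs \<in> space ?PH \<and> us \<in> space ?PU \<and> z' = z \<and>
          (\<forall>i. i \<notin> {..<M} \<longrightarrow> y i = d0) \<and> (\<forall>i<M. hs i \<in> VH (y i) \<and> us i \<in> VU (y i))"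
      proof (intro conj_cong refl iffI conjI allI impI)
        fix i assume sp: "hs \<in> space ?PH" "us \<in> space ?PU"
        have eq: "hash_values Z (hs i, us i) = y i \<longleftrightarrow> hs i \<in> VH (y i) \<and> us i \<in> VU (y i)" if "i < M"
          using sp that by (intro hash_values_eq_iff) (auto simp: space_PiM PiE_iff)
        {
          assume *: "\<forall>i. (if i < M then hash_values Z (hs i, us i) else d0) = y i"
          show "y i = d0" if "i \<notin> {..<M}" using * that by (metis lessThan_iff)
          show "hs i \<in> VH (y i)" "us i \<in> VU (y i)" if "i < M" using * that eq by metis+
        next
          assume "(\<forall>i. i \<notin> {..<M} \<longrightarrow> y i = d0) \<and> (\<forall>i<M. hs i \<in> VH (y i) \<and> us i \<in> VU (y i))"
          thus "(if i < M then hash_values Z (hs i, us i) else d0) = y i" using eq by auto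
        }
      qed
      also have "\<dots> \<longleftrightarrow> (\<forall>i. i \<notin> {..<M} \<longrightarrow> y i = d0) \<and> \<omega> \<in> ?B y z"
        by (auto simp: \<omega> space_PiM PiE_iff) (auto simp: VH_def VU_def split: if_splits)
      finally show ?thesis .
    qed
    show ?thesis
    proof (cases "\<forall>i. i \<notin> {..<M} \<longrightarrow> y i = d0")
      case True
      have "F -` {(y, z)} \<inter> space ?S = ?B y z" by (rule set_eqI) (use iff True in blast)
      thus ?thesis using if_P[OF True, of "?B y z" "{}"] by (rule trans[OF _ sym])
    next
      case False
      have "F -` {(y, z)} \<inter> space ?S = {}" by (rule set_eqI) (use iff False in blast)
      thus ?thesis using if_not_P[OF False, of "?B y z" "{}"] by (rule trans[OF _ sym])
    qed
  qed
  let ?Y = "(\<lambda>f i. if i < M then f i else d0) ` (({..<M} \<rightarrow>\<^sub>E vals)) \<times> (UNIV :: nat set)"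
  have cY: "countable ?Y" using countable_vals by (intro countable_SIGMA countable_image countable_PiE) auto
  have FY: "F \<omega> \<in> ?Y" if "\<omega> \<in> space ?S" for \<omega>
  proof -
    obtain hs us z where \<omega>: "\<omega> = (hs, us, z)" by (cases \<omega>)
    have in_vals: "restrict (\<lambda>i. hash_values Z (hs i, us i)) {..<M} \<in> {..<M} \<rightarrow>\<^sub>E vals"
      using that hash_values_in by (auto simp: \<omega> space_pair_measure space_PiM PiE_iff)
    have eq: "(\<lambda>i. if i < M then hash_values Z (hs i, us i) else d0) =
      (\<lambda>i. if i < M then restrict (\<lambda>i. hash_values Z (hs i, us i)) {..<M} i else d0)" by auto
    show ?thesis
      unfolding \<omega> F_def prod.case using image_eqI[where f = "\<lambda>f i. if i < M then f i else d0", OF eq in_vals] by (rule SigmaI) (rule UNIV_I)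
  qed
  have mF: "F \<in> ?S \<rightarrow>\<^sub>M count_space UNIV"
  proof (rule measurable_countable_range[OF cY FY])
    fix c
    show "F -` {c} \<inter> space ?S \<in> sets ?S"
      using pre[of "fst c" "snd c"] B_sets[of "fst c" "snd c"] by (auto split: if_splits)
  qed
  obtain p where p: "measure_pmf p = distr ?S (count_space UNIV) F"
    using discrete_law_pmf[OF HUC.prob_space_axioms mF cY FY] by blast
  have prob_p: "measure_pmf.prob p A = measure ?S {\<omega> \<in> space ?S. F \<omega> \<in> A}" for A
    unfolding p using mF by (subst measure_distr) (auto simp: vimage_def Int_def conj_commute)
  have "p = pair_pmf (Pi_pmf {..<M} d0 (\<lambda>_. D)) (coins Dst)"
  proof (rule pmf_eqI)
    fix c :: "(nat \<Rightarrow> ('x \<Rightarrow> 'r) \<times> ('x \<Rightarrow> nat)) \<times> nat"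
    obtain y z where c: "c = (y, z)" by (cases c)
    have "pmf p c = measure ?S (F -` {(y, z)} \<inter> space ?S)"
      unfolding c using prob_p[of "{(y, z)}"] by (simp add: pmf.rep_eq vimage_def Int_def conj_commute)
    also have "\<dots> = (if \<forall>i. i \<notin> {..<M} \<longrightarrow> y i = d0 then
        (\<Prod>i<M. measure H (VH (y i))) * ((\<Prod>i<M. measure U (VU (y i))) * pmf (coins Dst) z) else 0)"
    proof -
      have "measure ?S (?B y z) = measure ?PH (PiE {..<M} (\<lambda>i. VH (y i))) *
          (measure ?PU (PiE {..<M} (\<lambda>i. VU (y i))) * measure ?C {z})"
      proof -
        have s1: "PiE {..<M} (\<lambda>i. VH (y i)) \<in> sets ?PH" "PiE {..<M} (\<lambda>i. VU (y i)) \<in> sets ?PU"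
          using sets_VH sets_VU by (auto intro!: sets_PiM_I_finite)
        thus ?thesis
          by (simp add: measure_pair_Times[OF UC.sigma_finite_measure_axioms]
              measure_pair_Times[OF measure_pmf.sigma_finite_measure_axioms])
      qed
      also have "measure ?PH (PiE {..<M} (\<lambda>i. VH (y i))) = (\<Prod>i<M. measure H (VH (y i)))"
        using sets_VH by (intro PH.prob_times) auto
      also have "measure ?PU (PiE {..<M} (\<lambda>i. VU (y i))) = (\<Prod>i<M. measure U (VU (y i)))"
        using sets_VU by (intro PU.prob_times) auto
      finally show ?thesis unfolding pre by (auto simp: pmf.rep_eq)
    qed
    also have "\<dots> = pmf (pair_pmf (Pi_pmf {..<M} d0 (\<lambda>_. D)) (coins Dst)) c"
      by (auto simp: c pmf_pair pmf_Pi pmf_D prod.distrib mult.assoc)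
    finally show "pmf p c = pmf (pair_pmf (Pi_pmf {..<M} d0 (\<lambda>_. D)) (coins Dst)) c" .
  qed
  thus ?thesis unfolding S using prob_p[of "{z. E z}"] by simp
qed

end

section \<open>Choice of the parameters\<close>

locale nn_params =
  fixes n w :: nat and p1 p2 \<rho> :: real
  assumes n: "2 \<le> n" and p: "0 < p2" "p2 < p1" "p1 \<le> 1"
    and \<rho>: "\<rho> = log 2 (1 / p1) / log 2 (1 / p2)"
    and w: "40 * log 2 (real n / (p1 - p2)) \<le> real w"
begin

text \<open>
  With 160 functions per level and unit of \<open>k / p1\<close>, the relative variance of the fraction of agreeing
  rows is at most 1/80. The expected number of far matches is at most \<open>122 * n powr \<rho>\<close>, and
  2440 is 20 times that constant.
\<close>

definition "\<kappa> = ln (real n) / ln (1 / p2)"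
definition "k = nat \<lceil>\<kappa>\<rceil>"
definition "k1 = k div 2"
definition "m = nat \<lceil>160 * real k / p1\<rceil>"
definition "nA = nat \<lceil>10 / p1 ^ k1\<rceil>"
definition "nB = nat \<lceil>10 / p1 ^ (k - k1)\<rceil>"
definition "Bb = nat \<lceil>log 2 (real n)\<rceil>"
definition "Ns = nat \<lceil>64 / (p1 - p2)\<^sup>2\<rceil>"
definition "Q = nat \<lceil>2440 * real n powr \<rho>\<rceil>"

abbreviation "G \<equiv> real n powr \<rho>"
abbreviation "lg \<equiv> log 2 (real n)"
abbreviation "\<delta> \<equiv> p1 - p2"

lemma lg: "1 \<le> lg" using n by (simp add: le_log_iff)
lemma lnn: "0 < ln (real n)" "ln (real n) \<le> lg"
proof -
  show "0 < ln (real n)" using n by simp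
  have "ln (2::real) \<le> 1" using ln_le_minus_one[of "2::real"] by simp
  moreover have "0 < ln (2::real)" by simp
  moreover have "0 < ln (real n)" using n by simp
  ultimately show "ln (real n) \<le> lg" by (simp add: log_def le_divide_eq mult_left_le)
qed

lemma \<delta>: "0 < \<delta>" "\<delta> \<le> 1" "\<delta> \<le> p1" "0 < p1" "p2 < 1" using p by auto

lemma ln_p2: "0 < ln (1 / p2)" "1 - p2 \<le> ln (1 / p2)"
proof -
  show "0 < ln (1 / p2)" using p by simp
  have "ln p2 \<le> p2 - 1" using p by (intro ln_le_minus_one) auto
  thus "1 - p2 \<le> ln (1 / p2)" using p by (simp add: ln_div)
qed

lemma \<rho>_ln: "\<rho> = ln (1 / p1) / ln (1 / p2)"
  unfolding \<rho> log_def by simp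

lemma \<rho>_bounds: "0 \<le> \<rho>" "\<rho> \<le> 1"
proof -
  have "0 \<le> ln (1 / p1)" using p \<delta> by simp
  thus "0 \<le> \<rho>" unfolding \<rho>_ln using ln_p2 by simp
  have "ln (1 / p1) \<le> ln (1 / p2)" using p \<delta> by (simp add: frac_le)
  thus "\<rho> \<le> 1" unfolding \<rho>_ln using ln_p2 by simp
qed

lemma G: "1 \<le> G" "G \<le> real n"
proof -
  show "1 \<le> G" using n \<rho>_bounds by (simp add: ge_one_powr_ge_zero)
  have "G \<le> real n powr 1" using n \<rho>_bounds by (intro powr_mono) auto
  thus "G \<le> real n" using n by simp
qed

lemma \<kappa>_pos: "0 < \<kappa>" unfolding \<kappa>_def using lnn ln_p2 by simp

lemma k: "1 \<le> k" "\<kappa> \<le> real k" "real k \<le> \<kappa> + 1"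
  using \<kappa>_pos unfolding k_def by linarith+

lemma p1_\<kappa>: "p1 powr \<kappa> = 1 / G"
proof -
  have "\<kappa> * ln p1 = - (\<rho> * ln (real n))"
    unfolding \<kappa>_def \<rho>_ln using \<delta> by (simp add: ln_div)
  thus ?thesis using n \<delta> by (simp add: powr_def exp_minus inverse_eq_divide)
qed

lemma p2_\<kappa>: "p2 powr \<kappa> = 1 / real n"
proof -
  have "\<kappa> * ln p2 = - ln (real n)"
    unfolding \<kappa>_def using ln_p2 p by (simp add: ln_div)
  thus ?thesis using n p by (simp add: powr_def exp_minus inverse_eq_divide)
qed

text \<open>At the exact exponent \<kappa> the power would be \<open>1 / G\<close>; rounding up by
  less than one level loses at most a factor \<open>p1\<close>. This is the origin of
  \<open>1 / p1\<close> in the space bound.\<close>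

lemma inv_p1_k: "1 / p1 ^ k \<le> G / p1"
proof -
  have "p1 powr (\<kappa> + 1) \<le> p1 powr real k"
    using k \<delta> p by (intro powr_mono') auto
  hence "p1 / G \<le> p1 ^ k"
    using \<delta> by (simp add: powr_add p1_\<kappa> powr_realpow)
  moreover have "0 < p1 / G" using \<delta> G by simp
  ultimately have "1 / p1 ^ k \<le> 1 / (p1 / G)" by (intro frac_le) auto
  thus ?thesis by simp
qed

text \<open>Here rounding up helps because \<open>p2 / p1 < 1\<close>. The ratio appears when the
  number of tables, of order \<open>p1 ^ (- k)\<close>, is multiplied by the match probability
  \<open>p2 ^ k\<close> of a far point.\<close>

lemma ratio_k: "(p2 / p1) ^ k \<le> G / real n"
proof -
  have "(p2 / p1) powr real k \<le> (p2 / p1) powr \<kappa>"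
    using k \<delta> p by (intro powr_mono') auto
  also have "\<dots> = G / real n"
    using p \<delta> by (simp add: powr_divide p1_\<kappa> p2_\<kappa>)
  finally show ?thesis using p \<delta> by (simp add: powr_realpow)
qed

text \<open>Bounds the number of functions, \<open>k * m\<close> being of order
  \<open>k^2 / p1\<close>. For \<open>p1 \<ge> 1 / 2\<close> the division is harmless and
  \<open>ln (1 / p2) \<ge> 1 - p2 \<ge> \<delta>\<close>; for smaller \<open>p1\<close> the
  logarithm is at least \<open>1 / 2\<close> and \<open>\<delta>^2 \<le> p1\<close> pays for the
  division. The constant is \<open>2 * 4 + 2\<close>, from the square of
  \<open>\<kappa> + 1\<close>.\<close>

lemma k_square: "(real k)\<^sup>2 / p1 \<le> 10 * (lg\<^sup>2 / \<delta>\<^sup>2)"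
proof -
  have d: "\<delta>\<^sup>2 \<le> 4 * (p1 * (ln (1 / p2))\<^sup>2)"
  proof (cases "p1 \<ge> 1 / 2")
    case True
    have "\<delta>\<^sup>2 \<le> (ln (1 / p2))\<^sup>2" using \<delta> ln_p2 p by (intro power_mono) auto
    also have "\<dots> \<le> (4 * p1) * (ln (1 / p2))\<^sup>2" using True mult_right_mono[of 1 "4 * p1" "(ln (1 / p2))\<^sup>2"] by simp
    finally show ?thesis by simp
  next
    case False
    have "1 / 2 \<le> ln (1 / p2)" using ln_p2 False p by linarith
    hence "(1 / 2)\<^sup>2 \<le> (ln (1 / p2))\<^sup>2" by (intro power_mono) auto
    hence "1 \<le> 4 * (ln (1 / p2))\<^sup>2" by (simp add: power2_eq_square)
    hence "p1 * 1 \<le> p1 * (4 * (ln (1 / p2))\<^sup>2)" using \<delta> by (intro mult_left_mono) auto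
    moreover have "\<delta>\<^sup>2 \<le> p1"
    proof -
      have "\<delta> * \<delta> \<le> p1 * 1" using \<delta> by (intro mult_mono) auto
      thus ?thesis by (simp add: power2_eq_square)
    qed
    ultimately show ?thesis by (simp add: mult_ac)
  qed
  have "\<kappa>\<^sup>2 / p1 = (ln (real n))\<^sup>2 / (p1 * (ln (1 / p2))\<^sup>2)"
    by (simp add: \<kappa>_def power_divide mult.commute)
  also have "\<dots> \<le> (ln (real n))\<^sup>2 / (\<delta>\<^sup>2 / 4)"
    using d \<delta> by (intro divide_left_mono mult_pos_pos) (use ln_p2 in auto)
  also have "\<dots> \<le> lg\<^sup>2 / (\<delta>\<^sup>2 / 4)"
    using lnn by (intro divide_right_mono power_mono) auto
  finally have 1: "\<kappa>\<^sup>2 / p1 \<le> 4 * (lg\<^sup>2 / \<delta>\<^sup>2)" by (simp add: mult.commute)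
  have 2: "1 / p1 \<le> lg\<^sup>2 / \<delta>\<^sup>2"
  proof (rule frac_le)
    show "1 \<le> lg\<^sup>2" by (rule one_le_power[OF lg])
    have "\<delta> * \<delta> \<le> p1 * 1" using \<delta> by (intro mult_mono) auto
    thus "\<delta>\<^sup>2 \<le> p1" by (simp add: power2_eq_square)
  qed (use \<delta> in auto)
  have "(real k)\<^sup>2 \<le> (\<kappa> + 1)\<^sup>2" using k \<kappa>_pos by (intro power_mono) auto
  also have "\<dots> \<le> 2 * \<kappa>\<^sup>2 + 2"
    using zero_le_power2[of "\<kappa> - 1"] by (simp add: power2_eq_square algebra_simps)
  finally have "(real k)\<^sup>2 / p1 \<le> (2 * \<kappa>\<^sup>2 + 2) / p1" using \<delta> by (intro divide_right_mono) auto
  also have "\<dots> = 2 * (\<kappa>\<^sup>2 / p1) + 2 * (1 / p1)" by (simp add: add_divide_distrib)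
  finally show ?thesis using 1 2 by linarith
qed

lemma m: "160 * real k \<le> real m * p1" "0 < m" "real m \<le> 161 * real k / p1"
proof -
  have "0 < 160 * real k / p1" using k \<delta> by simp
  hence m1: "160 * real k / p1 \<le> real m" "real m \<le> 160 * real k / p1 + 1"
    unfolding m_def by linarith+
  thus "160 * real k \<le> real m * p1" using \<delta> by (simp add: pos_divide_le_eq)
  show "0 < m" using \<open>0 < 160 * real k / p1\<close> m1 by linarith
  have "1 \<le> real k / p1" using k \<delta> p by (simp add: le_divide_eq)
  thus "real m \<le> 161 * real k / p1" using m1 by simp
qed

lemma km: "real (k * m) \<le> 1610 * (lg\<^sup>2 / \<delta>\<^sup>2)"
proof -
  have "real (k * m) \<le> real k * (161 * real k / p1)" 
    unfolding of_nat_mult by (intro mult_left_mono m) auto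
  also have "\<dots> = 161 * ((real k)\<^sup>2 / p1)" by (simp add: power2_eq_square)
  finally show ?thesis using k_square by linarith
qed

lemma ceil_10: "10 \<le> real (nat \<lceil>10 / x\<rceil>) * x" "real (nat \<lceil>10 / x\<rceil>) \<le> 11 / x" "0 < nat \<lceil>10 / x\<rceil>"
  if "0 < x" "x \<le> 1" for x :: real
proof -
  have pos: "0 < 10 / x" using that by simp
  have 1: "10 / x \<le> real (nat \<lceil>10 / x\<rceil>)" "real (nat \<lceil>10 / x\<rceil>) \<le> 10 / x + 1"
    using pos by linarith+
  show "10 \<le> real (nat \<lceil>10 / x\<rceil>) * x" by (rule iffD1[OF pos_divide_le_eq[OF that(1)] 1(1)])
  show "0 < nat \<lceil>10 / x\<rceil>" using pos by simp
  have "1 \<le> 1 / x" using that by simp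
  moreover have "11 / x = 10 / x + 1 / x" by (simp add: add_divide_distrib[symmetric])
  ultimately show "real (nat \<lceil>10 / x\<rceil>) \<le> 11 / x" using 1 by linarith
qed

lemma pow_p1: "0 < p1 ^ j" "p1 ^ j \<le> 1"
  using \<delta> p by (auto intro!: power_le_one)

lemmas nA = ceil_10[OF pow_p1, of k1, folded nA_def]
lemmas nB = ceil_10[OF pow_p1, of "k - k1", folded nB_def]

lemma k1: "k1 \<le> k" "1 \<le> k - k1" "k1 \<le> k - k1" "2 * (k - k1) \<le> k + 1"
  using k(1) unfolding k1_def by auto

lemma L_le_inv: "real (nA * nB) \<le> 121 / p1 ^ k"
proof -
  have "real (nA * nB) \<le> (11 / p1 ^ k1) * (11 / p1 ^ (k - k1))"
    unfolding of_nat_mult using nA(2) nB(2) pow_p1[of k1] by (intro mult_mono) auto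
  also have "\<dots> = 121 / p1 ^ k" using k1(1) by (simp flip: power_add)
  finally show ?thesis .
qed

lemma L_le: "real (nA * nB) \<le> 121 * (G / p1)"
  using L_le_inv inv_p1_k by simp

lemma inv_p1: "1 / p1 \<le> 1 / \<delta>" "1 / \<delta> \<le> 1 / \<delta>\<^sup>2" "1 \<le> 1 / p1" "1 \<le> 1 / \<delta>\<^sup>2"
proof -
  show "1 / p1 \<le> 1 / \<delta>" using \<delta> by (intro frac_le) auto
  have "\<delta>\<^sup>2 \<le> \<delta>" using \<delta> by (simp add: power2_eq_square mult_left_le)
  thus "1 / \<delta> \<le> 1 / \<delta>\<^sup>2" using \<delta> by (intro frac_le) auto
  show "1 \<le> 1 / p1" using \<delta> p by simp
  thus "1 \<le> 1 / \<delta>\<^sup>2" using \<open>1 / p1 \<le> 1 / \<delta>\<close> \<open>1 / \<delta> \<le> 1 / \<delta>\<^sup>2\<close> by linarith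
qed

text \<open>With \<open>x\<close> the inverse probability of the longer half,
  \<open>2 * x * j \<le> x^2 + j^2\<close> separates the number of half rows from their length. The
  exponent of \<open>x^2\<close> is at most \<open>k + 1\<close>; the extra level and the rounding
  of \<kappa> cost \<open>1 / p1\<close> each, and \<open>\<delta> \<le> p1\<close> absorbs
  both.\<close>

lemma rows_le: "real ((nA + nB) * (k - k1)) \<le> 220 * (lg\<^sup>2 / \<delta>\<^sup>2 + G / \<delta>\<^sup>2)"
proof -
  define x where "x = 1 / p1 ^ (k - k1)"
  have x0: "0 < x" using pow_p1 by (simp add: x_def)
  have "p1 ^ (k - k1) \<le> p1 ^ k1" using k1 \<delta> p by (intro power_decreasing) auto
  hence "1 / p1 ^ k1 \<le> x" unfolding x_def using pow_p1 by (intro frac_le) auto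
  moreover have "real (nA + nB) \<le> 11 * (1 / p1 ^ k1) + 11 * x"
    using nA(2) nB(2) by (simp add: x_def)
  ultimately have AB: "real (nA + nB) \<le> 22 * x" by linarith
  have "real ((nA + nB) * (k - k1)) \<le> (22 * x) * real (k - k1)"
    unfolding of_nat_mult using AB by (intro mult_right_mono) auto
  also have "\<dots> = 11 * (2 * x * real (k - k1))" by simp
  also have "\<dots> \<le> 11 * (x\<^sup>2 + (real (k - k1))\<^sup>2)"
    using sum_squares_bound[of x "real (k - k1)"] by (intro mult_left_mono) auto
  also have "x\<^sup>2 \<le> G / \<delta>\<^sup>2"
  proof -
    have "p1 * p1 ^ k = p1 ^ (k + 1)" by simp
    also have "\<dots> \<le> p1 ^ (2 * (k - k1))" using k1 \<delta> p by (intro power_decreasing) auto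
    finally have le: "p1 * p1 ^ k \<le> p1 ^ (2 * (k - k1))" .
    have "x\<^sup>2 = 1 / p1 ^ (2 * (k - k1))" by (simp add: x_def power_divide power_mult mult.commute flip: power_mult)
    also have "\<dots> \<le> 1 / (p1 * p1 ^ k)" using le \<delta> by (intro divide_left_mono) auto
    also have "\<dots> = (1 / p1) * (1 / p1 ^ k)" by simp
    also have "\<dots> \<le> (1 / p1) * (G / p1)" using inv_p1_k \<delta> by (intro mult_left_mono) auto
    also have "\<dots> = G * (1 / p1\<^sup>2)" by (simp add: power2_eq_square)
    also have "\<dots> \<le> G * (1 / \<delta>\<^sup>2)"
      using \<delta> G by (intro mult_left_mono frac_le power_mono) auto
    finally show ?thesis by simp
  qed
  also have "(real (k - k1))\<^sup>2 \<le> 10 * (lg\<^sup>2 / \<delta>\<^sup>2)"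
  proof -
    have "(real (k - k1))\<^sup>2 \<le> (real k)\<^sup>2" by (intro power_mono) auto
    also have "\<dots> \<le> (real k)\<^sup>2 / p1"
      using \<delta> p mult_left_mono[OF inv_p1(3), of "(real k)\<^sup>2"] by simp
    finally show ?thesis using k_square by linarith
  qed
  finally have "real ((nA + nB) * (k - k1)) \<le> 11 * (G / \<delta>\<^sup>2 + 10 * (lg\<^sup>2 / \<delta>\<^sup>2))" by simp
  moreover have "0 \<le> G / \<delta>\<^sup>2" "0 \<le> lg\<^sup>2 / \<delta>\<^sup>2" using G by auto
  moreover have "x \<le> 11 * (b + 10 * a) \<Longrightarrow> 0 \<le> b \<Longrightarrow> 0 \<le> a \<Longrightarrow> x \<le> 220 * (a + b)" for x a b :: real
    by argo
  ultimately show ?thesis by blast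
qed

lemma Bb: "0 < Bb" "n \<le> 2 ^ Bb" "2 ^ Bb \<le> 2 * n" "real Bb \<le> 2 * lg" "lg \<le> real Bb"
proof -
  have b: "lg \<le> real Bb" "real Bb \<le> lg + 1" using lg unfolding Bb_def by linarith+
  thus "0 < Bb" "real Bb \<le> 2 * lg" "lg \<le> real Bb" using lg by linarith+
  have n0: "0 < real n" using n by simp
  have "real n = 2 powr lg" using n0 by simp
  also have "\<dots> \<le> 2 powr real Bb" using b by (intro powr_mono) auto
  also have "\<dots> = real (2 ^ Bb)" by (simp add: powr_realpow)
  finally show "n \<le> 2 ^ Bb" by (simp only: of_nat_le_iff)
  have "real (2 ^ Bb) = 2 powr real Bb" by (simp add: powr_realpow)
  also have "\<dots> \<le> 2 powr (lg + 1)" using b by (intro powr_mono) auto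
  also have "\<dots> = real (2 * n)" using n0 by (simp add: powr_add)
  finally show "2 ^ Bb \<le> 2 * n" by (simp only: of_nat_le_iff)
qed

lemma Ns: "0 < Ns" "64 / \<delta>\<^sup>2 \<le> real Ns" "real Ns \<le> 65 / \<delta>\<^sup>2"
proof -
  have "0 < 64 / \<delta>\<^sup>2" using \<delta> by simp
  hence 1: "64 / \<delta>\<^sup>2 \<le> real Ns" "real Ns \<le> 64 / \<delta>\<^sup>2 + 1" unfolding Ns_def by linarith+
  thus "64 / \<delta>\<^sup>2 \<le> real Ns" by simp
  show "0 < Ns" using 1 \<open>0 < 64 / \<delta>\<^sup>2\<close> by linarith
  show "real Ns \<le> 65 / \<delta>\<^sup>2" using 1 inv_p1(4) by simp
qed

lemma NsBb: "real (Ns * Bb) \<le> 130 * (lg\<^sup>2 / \<delta>\<^sup>2)"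
proof -
  have "real (Ns * Bb) \<le> (65 / \<delta>\<^sup>2) * (2 * lg)"
    unfolding of_nat_mult using Ns Bb by (intro mult_mono) auto
  also have "\<dots> = 130 * (lg * 1) / \<delta>\<^sup>2" by simp
  also have "\<dots> \<le> 130 * (lg * lg) / \<delta>\<^sup>2"
    using lg by (intro divide_right_mono mult_left_mono) auto
  finally show ?thesis by (simp add: power2_eq_square)
qed

text \<open>The constant 64 in \<open>Ns\<close> makes the exponent at least \<open>8 * lg\<close>.
  One \<open>lg\<close> gives the factor \<open>n\<close>, and the other seven give
  \<open>exp 7 \<ge> 2 ^ 7 \<ge> 20\<close>.\<close>

lemma hoeff: "exp (- (real (Ns * Bb) * \<delta>\<^sup>2 / 8)) \<le> 1 / (20 * real n)"
proof -
  have n0: "0 < real n" using n by simp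
  have d2: "0 < \<delta>\<^sup>2" using \<delta> by simp
  have "64 * lg \<le> (real Ns * \<delta>\<^sup>2) * real Bb"
    using Ns(2) Bb(5) lg d2 by (intro mult_mono) (auto simp: pos_divide_le_eq)
  hence 1: "8 * lg \<le> real (Ns * Bb) * \<delta>\<^sup>2 / 8" by (simp add: mult_ac)
  have e2: "2 \<le> exp (1::real)" using exp_ge_add_one_self[of "1::real"] by simp
  have "real n = 2 powr lg" using n0 by simp
  also have "\<dots> \<le> exp 1 powr lg" using e2 lg by (intro powr_mono2) auto
  also have "\<dots> = exp lg" by (simp add: powr_def)
  finally have A: "real n \<le> exp lg" .
  have "(2::real) ^ 7 \<le> exp 1 ^ 7" using e2 by (intro power_mono) auto
  also have "\<dots> = exp 7" by (simp flip: exp_of_nat_mult)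
  also have "\<dots> \<le> exp (7 * lg)" using lg by simp
  finally have B: "20 \<le> exp (7 * lg)" by simp
  have "20 * real n \<le> exp (7 * lg) * exp lg" using A B by (intro mult_mono) auto
  also have "\<dots> = exp (8 * lg)" by (simp flip: exp_add)
  also have "\<dots> \<le> exp (real (Ns * Bb) * \<delta>\<^sup>2 / 8)" using 1 by simp
  finally have "20 * real n \<le> exp (real (Ns * Bb) * \<delta>\<^sup>2 / 8)" .
  hence "1 / exp (real (Ns * Bb) * \<delta>\<^sup>2 / 8) \<le> 1 / (20 * real n)" using n0 by (intro divide_left_mono) auto
  thus ?thesis by (simp only: exp_minus inverse_eq_divide)
qed

lemma Q: "0 < Q" "2440 * G \<le> real Q" "real Q \<le> 2441 * G"
  using G(1) unfolding Q_def by linarith+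

text \<open>Lets the storage for the hash words of the query be charged to the term
  \<open>n / \<delta>^2\<close> of the space bound.\<close>

lemma lg_square: "lg\<^sup>2 \<le> 16 * real n"
proof -
  have n0: "0 < real n" using n by simp
  have "ln (real n) = 2 * ln (sqrt (real n))" using n0 by (simp add: ln_sqrt)
  also have "ln (sqrt (real n)) \<le> sqrt (real n)"
    using n0 ln_le_minus_one[of "sqrt (real n)"] by simp
  finally have 1: "ln (real n) \<le> 2 * sqrt (real n)" by simp
  have "1 / 2 \<le> ln (2::real)"
    using ln_le_minus_one[of "1/2::real"] by (simp add: ln_div)
  hence "ln (real n) / ln 2 \<le> (2 * sqrt (real n)) / (1 / 2)"
    using 1 lnn(1) by (intro frac_le) auto
  hence "lg \<le> 4 * sqrt (real n)" by (simp add: log_def)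
  hence "lg\<^sup>2 \<le> (4 * sqrt (real n))\<^sup>2" using lg by (intro power_mono) auto
  thus ?thesis by (simp add: power_mult_distrib)
qed

section \<open>Space, word length and running time\<close>

abbreviation "T1 \<equiv> real n powr (1 + \<rho>) / p1"
abbreviation "T2 \<equiv> real n / \<delta>\<^sup>2"

lemma T1_eq: "T1 = real n * (G / p1)" using n by (simp add: powr_add)

lemma T_ge: "1 \<le> T1" "1 \<le> T2" "G / p1 \<le> T1" "real n \<le> T1" "G / \<delta>\<^sup>2 \<le> T2" "1 / \<delta>\<^sup>2 \<le> T2"
  "lg\<^sup>2 / \<delta>\<^sup>2 \<le> 16 * T2" "G / p1 \<le> G / \<delta>\<^sup>2"
proof -
  have n1: "1 \<le> real n" using n by simp
  have Gp: "1 \<le> G / p1" using mult_mono[OF G(1) inv_p1(3)] by simp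
  show "G / p1 \<le> T1" unfolding T1_eq using n1 Gp mult_right_mono[of 1 "real n" "G / p1"] by simp
  thus "1 \<le> T1" using Gp by linarith
  show "real n \<le> T1" unfolding T1_eq using n1 Gp mult_left_mono[of 1 "G / p1" "real n"] by simp
  show "1 / \<delta>\<^sup>2 \<le> T2" using n1 by (intro divide_right_mono) auto
  thus "1 \<le> T2" using inv_p1(4) by linarith
  show "G / \<delta>\<^sup>2 \<le> T2" using G(2) by (intro divide_right_mono) auto
  show "lg\<^sup>2 / \<delta>\<^sup>2 \<le> 16 * T2" using divide_right_mono[OF lg_square, of "\<delta>\<^sup>2"] by simp
  have "1 / p1 \<le> 1 / \<delta>\<^sup>2" using inv_p1 by linarith
  thus "G / p1 \<le> G / \<delta>\<^sup>2" using G mult_left_mono[of "1 / p1" "1 / \<delta>\<^sup>2" G] by simp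
qed

text \<open>The 30 consists of 24 parameters, the zero cell, three gaps between arrays and two spare
  cells.\<close>

definition "mem_total = 30 + k * m + Ns + (nA + nB) + (nA + nB) * (k - k1) + 2 ^ Bb + (nA * nB) * 2 ^ Bb
  + 2 * ((nA * nB) * n) + n * Ns"

lemma rows_le1: "nA + nB \<le> (nA + nB) * (k - k1)"
  using k1(2) mult_le_mono2[of 1 "k - k1" "nA + nB"] by simp

lemma Ln: "real ((nA * nB) * n) \<le> 121 * T1"
proof -
  have "real (nA * nB * n) = real (nA * nB) * real n" by simp
  also have "\<dots> \<le> (121 * (G / p1)) * real n" using L_le by (intro mult_right_mono) auto
  finally show ?thesis unfolding T1_eq by (simp add: mult_ac)
qed

lemma space_le: "real (mem_total + (k * m + Ns * Bb)) \<le> 100000 * (T1 + T2)"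
proof -
  have km': "real (k * m) \<le> 25760 * T2" using km T_ge(7) by linarith
  have ns: "real Ns \<le> 65 * T2" using Ns(3) T_ge(6) by simp
  have nsb: "real (Ns * Bb) \<le> 2080 * T2" using NsBb T_ge(7) by linarith
  have rows: "real ((nA + nB) * (k - k1)) \<le> 3740 * T2" 
  proof -
    have "x \<le> 220 * (a + b) \<Longrightarrow> b \<le> t \<Longrightarrow> a \<le> 16 * t \<Longrightarrow> x \<le> 3740 * t" for x a b t :: real
      by argo
    thus ?thesis using rows_le T_ge(5,7) by blast
  qed
  have rows1: "real (nA + nB) \<le> 3740 * T2"
    by (rule order_trans[OF of_nat_mono[OF rows_le1] rows])
  have pb: "real (2 ^ Bb) \<le> 2 * T1" using of_nat_mono[OF Bb(3), where 'a = real] T_ge(4) by simp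
  have "(nA * nB) * 2 ^ Bb \<le> 2 * ((nA * nB) * n)" using mult_le_mono2[OF Bb(3), of "nA * nB"] by (simp add: mult_ac)
  hence "real ((nA * nB) * 2 ^ Bb) \<le> real (2 * ((nA * nB) * n))" by (rule of_nat_mono)
  also have "\<dots> = 2 * real ((nA * nB) * n)" by simp
  also have "\<dots> \<le> 2 * (121 * T1)" using Ln by (intro mult_left_mono) auto
  finally have lb: "real ((nA * nB) * 2 ^ Bb) \<le> 242 * T1" by simp
  have nNs: "real (n * Ns) \<le> 65 * T2"
  proof -
    have "real (n * Ns) \<le> real n * (65 / \<delta>\<^sup>2)" 
      unfolding of_nat_mult using Ns(3) by (intro mult_left_mono) auto
    thus ?thesis by (simp add: mult.commute)
  qed
  have "real (mem_total + (k * m + Ns * Bb)) = 30 + real (k * m) + real Ns + real (nA + nB) +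
    real ((nA + nB) * (k - k1)) + real (2 ^ Bb) + real ((nA * nB) * 2 ^ Bb) + 2 * real ((nA * nB) * n) +
    real (n * Ns) + real (k * m) + real (Ns * Bb)"
    unfolding mem_total_def of_nat_add by simp
  also have "\<dots> \<le> 100000 * (T1 + T2)"
  proof -
    have "x1 \<le> 25760 * t2 \<Longrightarrow> x2 \<le> 65 * t2 \<Longrightarrow> x3 \<le> 2080 * t2 \<Longrightarrow> x4 \<le> 3740 * t2 \<Longrightarrow>
      x5 \<le> 3740 * t2 \<Longrightarrow> x6 \<le> 2 * t1 \<Longrightarrow> x7 \<le> 242 * t1 \<Longrightarrow> x8 \<le> 121 * t1 \<Longrightarrow> x9 \<le> 65 * t2 \<Longrightarrow>
      1 \<le> t1 \<Longrightarrow> 1 \<le> t2 \<Longrightarrow>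
      30 + x1 + x2 + x5 + x4 + x6 + x7 + 2 * x8 + x9 + x1 + x3 \<le> 100000 * t1 + 100000 * t2"
      for x1 x2 x3 x4 x5 x6 x7 x8 x9 t1 t2 :: real by linarith
    from this[OF km' ns nsb rows rows1 pb lb Ln nNs T_ge(1,2)] show ?thesis unfolding distrib_left .
  qed
  finally show ?thesis .
qed

lemma T_le: "T1 \<le> (real n / \<delta>)\<^sup>2" "T2 \<le> (real n / \<delta>)\<^sup>2" "G \<le> (real n / \<delta>)\<^sup>2"
proof -
  have n1: "1 \<le> real n" using n by simp
  have nn: "real n \<le> real n * real n" using n1 mult_left_mono[of 1 "real n" "real n"] by simp
  have z: "(real n / \<delta>)\<^sup>2 = (real n * real n) * (1 / \<delta>\<^sup>2)" by (simp add: power_divide power2_eq_square)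
  have "T1 = (real n * G) * (1 / p1)" unfolding T1_eq by simp
  also have "\<dots> \<le> (real n * real n) * (1 / \<delta>\<^sup>2)"
    using G n1 inv_p1 \<delta> by (intro mult_mono mult_left_mono) auto
  finally show "T1 \<le> (real n / \<delta>)\<^sup>2" using z by simp
  have "T2 = real n * (1 / \<delta>\<^sup>2)" by simp
  also have "\<dots> \<le> (real n * real n) * (1 / \<delta>\<^sup>2)" using nn by (intro mult_right_mono) auto
  finally show T2: "T2 \<le> (real n / \<delta>)\<^sup>2" using z by simp
  have "G \<le> real n * 1" using G by simp
  also have "\<dots> \<le> real n * (1 / \<delta>\<^sup>2)" using inv_p1 n1 by (intro mult_left_mono) auto
  finally show "G \<le> (real n / \<delta>)\<^sup>2" using T2 by simp
qed

text \<open>Origin of the factor 40 for the word length: \<open>z = n / \<delta>\<close> is at least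
  2, hence \<open>z ^ 40 \<ge> 2 ^ 38 * z^2\<close>, and every number handled is a constant multiple
  of \<open>z^2\<close>.\<close>

lemma w_large: "2 ^ 38 * (real n / \<delta>)\<^sup>2 \<le> 2 ^ w"
proof -
  define z where "z = real n / \<delta>"
  have "real n * 1 \<le> z" unfolding z_def using n \<delta> by (simp add: le_divide_eq mult_left_le)
  hence z: "2 \<le> z" using n by linarith
  have "2 ^ 38 * z\<^sup>2 \<le> z ^ 38 * z\<^sup>2"
    using z by (intro mult_right_mono power_mono) auto
  also have "\<dots> = z ^ (38 + 2)" by (rule power_add[symmetric])
  also have "\<dots> = (2 powr log 2 z) powr 40" using z by simp
  also have "\<dots> = 2 powr (40 * log 2 z)" by (simp only: powr_powr mult.commute)
  also have "\<dots> \<le> 2 powr real w" using w by (intro powr_mono) (auto simp: z_def)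
  also have "\<dots> = 2 ^ w" by (simp add: powr_realpow)
  finally show ?thesis unfolding z_def .
qed

lemma large_bound:
  assumes "real x \<le> 2 ^ 20 * (T1 + T2 + G)"
  shows "x < 2 ^ w"
proof -
  have z0: "0 < (real n / \<delta>)\<^sup>2" using n \<delta> by simp
  have "real x \<le> 2 ^ 20 * (3 * (real n / \<delta>)\<^sup>2)"
    using order_trans[OF assms] T_le by (intro order_trans[OF assms] mult_left_mono) (linarith, simp)
  also have "\<dots> < 2 ^ 38 * (real n / \<delta>)\<^sup>2" using z0 by simp
  also have "\<dots> \<le> 2 ^ w" by (rule w_large)
  finally have "real x < real (2 ^ w)" by simp
  thus ?thesis by (simp only: of_nat_less_iff)
qed

lemma mem_w: "mem_total + (k * m + Ns * Bb) < 2 ^ w" "2 * Q < 2 ^ w" "20 * (nA * nB) < 2 ^ w"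
  "(nA * nB) * n < 2 ^ w" "Bb < w"
proof -
  have T: "1 \<le> T1" "1 \<le> T2" "1 \<le> G" using T_ge G by auto
  have gen: "x \<le> 2 ^ 20 * (a + b + c)"
    if "1 \<le> a" "1 \<le> b" "1 \<le> c" "x \<le> 100000 * (a + b) \<or> x \<le> 4882 * c \<or> x \<le> 2420 * a \<or> x \<le> 121 * a"
    for x a b c :: real using that by auto
  show "mem_total + (k * m + Ns * Bb) < 2 ^ w" using space_le by (intro large_bound gen[OF T]) blast
  have "real (2 * Q) \<le> 4882 * G" using Q(3) by simp
  thus "2 * Q < 2 ^ w" by (intro large_bound gen[OF T]) blast
  have "real (20 * (nA * nB)) = 20 * real (nA * nB)" by simp
  also have "\<dots> \<le> 20 * (121 * T1)" using order_trans[OF L_le] T_ge(3) by (intro mult_left_mono) auto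
  finally have "real (20 * (nA * nB)) \<le> 2420 * T1" by simp
  thus "20 * (nA * nB) < 2 ^ w" by (intro large_bound gen[OF T]) blast
  show "(nA * nB) * n < 2 ^ w" using Ln by (intro large_bound gen[OF T]) blast
  have "2 ^ Bb \<le> mem_total" by (simp add: mem_total_def)
  hence "(2::nat) ^ Bb < 2 ^ w" using \<open>mem_total + (k * m + Ns * Bb) < 2 ^ w\<close> by linarith
  thus "Bb < w" by simp
qed

text \<open>\<open>L_le_inv\<close> and \<open>ratio_k\<close> bound the genuine far matches by
  \<open>121 * G\<close>. Accidental equalities of whole words add at most 1, since the number of
  pairs of a table and a point is below \<open>2 ^ w\<close>.\<close>

lemma farQ: "real (nA * nB * n) * (p2 ^ k + 1 / 2 ^ w) \<le> real Q / 20"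
proof -
  have n1: "0 < real n" using n by simp
  have "real (nA * nB * n) * p2 ^ k \<le> (121 / p1 ^ k * real n) * p2 ^ k"
    unfolding of_nat_mult[of "nA * nB"] using L_le_inv p by (intro mult_right_mono) auto
  also have "\<dots> = 121 * real n * (p2 / p1) ^ k" by (simp add: power_divide)
  also have "\<dots> \<le> 121 * real n * (G / real n)" using ratio_k by (intro mult_left_mono) auto
  also have "\<dots> = 121 * G" using n1 by simp
  finally have 1: "real (nA * nB * n) * p2 ^ k \<le> 121 * G" .
  have "real (nA * nB * n) \<le> real (2 ^ w)" using mem_w(4) by (intro of_nat_mono) auto
  hence 2: "real (nA * nB * n) / 2 ^ w \<le> 1" by simp
  have "real (nA * nB * n) * (p2 ^ k + 1 / 2 ^ w) = real (nA * nB * n) * p2 ^ k + real (nA * nB * n) / 2 ^ w"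
    by (simp add: distrib_left)
  also have "\<dots> \<le> 122 * G" using 1 2 G(1) by linarith
  also have "\<dots> \<le> real Q / 20" using Q(2) by simp
  finally show ?thesis .
qed

lemma evals_le: "real (k * m + Ns * Bb) \<le> 1740 * (lg\<^sup>2 / \<delta>\<^sup>2)"
  using km NsBb by simp

lemma time_le:
  "real (100 + 6 * (k * m) + Ns * (Bb * 8 + 9) + (nA + nB) * ((k - k1) * 7 + 9) + 20 * (nA * nB) +
     (Ns * 11 + 30) * (2 * Q) + 20 * (20 * (nA * nB))) \<le> 10000000 * (lg\<^sup>2 / \<delta>\<^sup>2 + G / \<delta>\<^sup>2)"
proof -
  let ?a = "lg\<^sup>2 / \<delta>\<^sup>2" and ?b = "G / \<delta>\<^sup>2"
  have a1: "1 \<le> ?a"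
  proof -
    have "1 \<le> lg\<^sup>2" by (rule one_le_power[OF lg])
    thus ?thesis using mult_mono[OF _ inv_p1(4), of 1 "lg\<^sup>2"] by simp
  qed
  have b1: "1 \<le> ?b" using mult_mono[OF G(1) inv_p1(4)] by simp
  have "Ns \<le> Ns * Bb" using Bb(1) by simp
  hence ns: "real Ns \<le> real (Ns * Bb)" by (rule of_nat_mono)
  have L: "real (nA * nB) \<le> 121 * ?b" using L_le T_ge(8) by linarith
  have rows1: "real (nA + nB) \<le> 220 * (?a + ?b)"
    by (rule order_trans[OF of_nat_mono[OF rows_le1] rows_le])
  have q: "real Ns * real Q \<le> 158665 * ?b"
  proof -
    have "real Ns * real Q \<le> (65 / \<delta>\<^sup>2) * (2441 * G)" using Ns Q G by (intro mult_mono) auto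
    thus ?thesis by simp
  qed
  have q1: "real Q \<le> 2441 * ?b"
  proof -
    have "G * 1 \<le> G * (1 / \<delta>\<^sup>2)" using inv_p1(4) G by (intro mult_left_mono) auto
    thus ?thesis using Q(3) by simp
  qed
  have eq: "real (100 + 6 * (k * m) + Ns * (Bb * 8 + 9) + (nA + nB) * (j * 7 + 9) + 20 * (nA * nB) +
     (Ns * 11 + 30) * (2 * Q) + 20 * (20 * (nA * nB))) =
     100 + 6 * real (k * m) + 8 * real (Ns * Bb) + 9 * real Ns + 7 * real ((nA + nB) * j) +
     9 * real (nA + nB) + 420 * real (nA * nB) + 22 * (real Ns * real Q) + 60 * real Q" for j
    by (simp add: algebra_simps)
  have "100 + 6 * real (k * m) + 8 * real (Ns * Bb) + 9 * real Ns + 7 * real ((nA + nB) * (k - k1)) +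
     9 * real (nA + nB) + 420 * real (nA * nB) + 22 * (real Ns * real Q) + 60 * real Q
     \<le> 10000000 * (?a + ?b)"
  proof -
    \<comment> \<open>Stated for fresh variables so that the powers, logarithms and products stay
      opaque and the inequality is purely linear.\<close>
    have "1 \<le> a \<Longrightarrow> 1 \<le> b \<Longrightarrow> x1 \<le> 1610 * a \<Longrightarrow> x2 \<le> 130 * a \<Longrightarrow> x3 \<le> x2 \<Longrightarrow>
      x4 \<le> 220 * a + 220 * b \<Longrightarrow> x5 \<le> 220 * a + 220 * b \<Longrightarrow> x6 \<le> 121 * b \<Longrightarrow> x7 \<le> 158665 * b \<Longrightarrow>
      x8 \<le> 2441 * b \<Longrightarrow>
      100 + 6 * x1 + 8 * x2 + 9 * x3 + 7 * x4 + 9 * x5 + 420 * x6 + 22 * x7 + 60 * x8 \<le> 10000000 * a + 10000000 * b"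
      for a b x1 x2 x3 x4 x5 x6 x7 x8 :: real by linarith
    from this[OF a1 b1 km NsBb ns rows_le[unfolded distrib_left] rows1[unfolded distrib_left] L q q1]
    show ?thesis unfolding distrib_left .
  qed
  thus ?thesis unfolding eq .
qed

end

text \<open>Any positive power dominates the squared logarithm:
  \<open>ln x \<le> x powr a / a\<close> with \<open>a = s / 2\<close>. With
  \<open>s = \<rho>\<close> this absorbs the logarithmic part of the running time into
  \<open>n powr \<rho>\<close>.\<close>

lemma log_square_le_powr:
  fixes n :: nat and s :: real
  assumes "2 \<le> n" "0 < s"
  shows "(log 2 (real n))\<^sup>2 \<le> (2 / (s * ln 2))\<^sup>2 * real n powr s"
proof -
  have "ln (real n) \<le> real n powr (s / 2) / (s / 2)"
    using assms by (intro ln_powr_bound) auto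
  hence "ln (real n) / ln 2 \<le> (real n powr (s / 2) / (s / 2)) / ln 2"
    by (intro divide_right_mono) auto
  hence "log 2 (real n) \<le> 2 / (s * ln 2) * real n powr (s / 2)"
    by (simp add: log_def mult.commute)
  moreover have "0 \<le> log 2 (real n)" using assms by simp
  ultimately have "(log 2 (real n))\<^sup>2 \<le> (2 / (s * ln 2) * real n powr (s / 2))\<^sup>2"
    by (intro power_mono)
  also have "\<dots> = (2 / (s * ln 2))\<^sup>2 * (real n powr (s / 2) * real n powr (s / 2))"
    by (simp add: power_mult_distrib power2_eq_square)
  also have "real n powr (s / 2) * real n powr (s / 2) = real n powr s"
    by (simp flip: powr_add)
  finally show ?thesis .
qed

section \<open>The data structure\<close>

inductive_cases SkipE: "exec w S m g l v Skip s e t s'"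
inductive_cases ConstE: "exec w S m g l v (Const k a) s e t s'"
inductive_cases OpE: "exec w S m g l v (Op f k i j) s e t s'"
inductive_cases LoadE: "exec w S m g l v (Load k i) s e t s'"
inductive_cases StoreE: "exec w S m g l v (Store i j) s e t s'"
inductive_cases HashE: "exec w S m g l v (Hash i) s e t s'"
inductive_cases UnivE: "exec w S m g l v (Univ k i) s e t s'"
inductive_cases SeqE: "exec w S m g l v (Seq c1 c2) s e t s'"
inductive_cases IfE: "exec w S m g l v (If i c1 c2) s e t s'"
inductive_cases WhileE: "exec w S m g l v (While i c) s e t s'"

text \<open>\<open>returns\<close> only asserts that some execution exists. Determinism makes its
  event equal to, and not merely larger than, an event about hash values, which is what transferring
  its measure requires.\<close>

lemma exec_deterministic:
  "exec w S m g l v c s e t s' \<Longrightarrow> exec w S m g l v c s e2 t2 s2 \<Longrightarrow> s2 = s'"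
proof (induction arbitrary: e2 t2 s2 rule: exec.induct)
  case (Skip s)
  thus ?case by (auto elim: SkipE)
next
  case (Const k a s)
  thus ?case by (auto elim: ConstE)
next
  case (Op f k i j s)
  thus ?case by (auto elim: OpE)
next
  case (Load s i k)
  thus ?case by (auto elim: LoadE)
next
  case (Store s i j)
  thus ?case by (auto elim: StoreE)
next
  case (Hash s i)
  thus ?case by (auto elim: HashE)
next
  case (Univ s i a k)
  thus ?case by (auto elim: UnivE)
next
  case (Seq c1 s e1 t1 s1 c2 e2' t2' s2')
  from Seq.prems obtain e1' t1' s1' e2'' t2'' where
    ex: "exec w S m g l v c1 s e1' t1' s1'" "exec w S m g l v c2 s1' e2'' t2'' s2"
    by (elim SeqE)
  have "s1' = s1" using ex(1) by (rule Seq.IH(1))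
  thus ?case using ex(2) by (intro Seq.IH(2)) simp
next
  case (IfTrue s i c1 e t s' c2)
  from IfTrue.prems obtain t' where "exec w S m g l v c1 s e2 t' s2"
    by (rule IfE) (use IfTrue.hyps in auto)
  thus ?case by (rule IfTrue.IH)
next
  case (IfFalse s i c2 e t s' c1)
  from IfFalse.prems obtain t' where "exec w S m g l v c2 s e2 t' s2"
    by (rule IfE) (use IfFalse.hyps in auto)
  thus ?case by (rule IfFalse.IH)
next
  case (WhileFalse s i c)
  thus ?case by (auto elim: WhileE)
next
  case (WhileTrue s i c e1 t1 s1 e2' t2' s2')
  have "\<exists>e1' t1' s1' e2'' t2''. exec w S m g l v c s e1' t1' s1' \<and>
      exec w S m g l v (While i c) s1' e2'' t2'' s2"
    using WhileTrue.prems
  proof (rule WhileE)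
    assume "regs s i = 0"
    thus ?thesis using WhileTrue.hyps(1) by simp
  next
    fix e1' t1' s1' e2'' t2''
    assume "exec w S m g l v c s e1' t1' s1'" "exec w S m g l v (While i c) s1' e2'' t2'' s2"
    thus ?thesis by (intro exI conjI)
  qed
  then obtain e1' t1' s1' e2'' t2'' where
    ex: "exec w S m g l v c s e1' t1' s1'" "exec w S m g l v (While i c) s1' e2'' t2'' s2"
    by (elim exE conjE)
  have "s1' = s1" using ex(1) by (rule WhileTrue.IH(1))
  thus ?case using ex(2) by (intro WhileTrue.IH(2)) simp
qed

locale nn_data = nn_params n w p1 p2 \<rho> for n w :: nat and p1 p2 \<rho> :: real +
  fixes pts :: "'x list"
  assumes len: "length pts = n"
begin

definition rowP :: "(nat \<Rightarrow> nat \<Rightarrow> nat) pmf" where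
  "rowP = Pi_pmf {..<nA + nB} (\<lambda>_. 0) (\<lambda>_. Pi_pmf {..<k} 0 (\<lambda>_. pmf_of_set {..<m}))"

definition coinP :: "((nat \<Rightarrow> nat \<Rightarrow> nat) \<times> nat) pmf" where
  "coinP = pair_pmf rowP (pmf_of_set {Q..<2 * Q})"

text \<open>Preprocessing receives its random data as one number, so half rows and stopping rank are
  encoded by an enumeration of the support. Every number decodes to an element of the support;
  therefore the cost bounds hold at all sample points and not just almost everywhere.\<close>

definition dec :: "nat \<Rightarrow> (nat \<Rightarrow> nat \<Rightarrow> nat) \<times> nat" where
  "dec = from_nat_into (set_pmf coinP)"

definition "thr = nat \<lfloor>real (Ns * Bb) * ((1 - p1) / 2 + (p1 - p2) / 4)\<rfloor>"

abbreviation "nW \<equiv> k * m"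
abbreviation "nR \<equiv> nA + nB"
abbreviation "K2 \<equiv> k - k1"
abbreviation "L \<equiv> nA * nB"
abbreviation "K \<equiv> (2::nat) ^ Bb"
abbreviation "M \<equiv> nW + Ns * Bb"

definition "oQ = 25 + nW"
definition "oS = oQ + Ns"
definition "oI = oS + nR"
definition "oP = oI + nR * K2 + 1"
definition "oH = oP + K"
definition "oSg = oH + L * K"
definition "oNx = oSg + L * n + 1"
definition "oSk = oNx + L * n + 1"

lemmas offsets = oQ_def oS_def oI_def oP_def oH_def oSg_def oNx_def oSk_def

text \<open>Half rows of the first kind have only \<open>k1\<close> levels and are padded with
  \<open>nW\<close>, the position of the zero cell, up to the length \<open>K2\<close> of the second
  kind.\<close>

definition ix :: "(nat \<Rightarrow> nat \<Rightarrow> nat) \<Rightarrow> nat \<Rightarrow> nat \<Rightarrow> nat" where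
  "ix idx r j = (if r < nA then if j < k1 then j * m + idx r j else nW
     else (k1 + j) * m + idx r (k1 + j))"

definition sel :: "(nat \<Rightarrow> nat \<Rightarrow> nat) \<Rightarrow> nat \<Rightarrow> nat \<Rightarrow> nat" where
  "sel idx t j = (if j < k1 then idx (t div nB) j else idx (nA + t mod nB) j)"

definition sg :: "(nat \<Rightarrow> nat \<Rightarrow> nat) \<Rightarrow> (nat \<Rightarrow> nat \<Rightarrow> nat) \<Rightarrow> nat \<Rightarrow> nat \<Rightarrow> nat" where
  "sg V idx t x = (\<Sum>j<k. V x (j * m + sel idx t j)) mod 2 ^ w"

definition sk :: "(nat \<Rightarrow> nat \<Rightarrow> nat) \<Rightarrow> nat \<Rightarrow> nat \<Rightarrow> nat" where
  "sk V x j = horner (\<lambda>b. V x (nW + j * Bb + b) mod 2) Bb"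

definition par :: "nat \<Rightarrow> nat \<Rightarrow> nat" where
  "par r i = [0, 1, nW, 24, Ns, Bb, oQ, nR, K2, oI, oS, L, nB, oS + nA, oH, K, n, oSg, oNx, oSk, oP,
     thr, r, 20 * L] ! i"

text \<open>The initial memory, decoded from the address. The region between 24 and
  \<open>oI\<close> is working space, including the zero cell. The subtraction of 1 in the key and
  link arrays undoes the encoding of entry \<open>x\<close> as \<open>Suc x\<close>, so quotient and
  remainder by \<open>n\<close> recover table and point.\<close>

definition cell :: "(nat \<Rightarrow> nat \<Rightarrow> nat) \<Rightarrow> (nat \<Rightarrow> nat \<Rightarrow> nat) \<Rightarrow> nat \<Rightarrow> nat \<Rightarrow> nat" where
  "cell V idx r a =
     (if a < 24 then par r a
      else if a < oI then 0
      else if a < oP then 24 + ix idx ((a - oI) div K2) ((a - oI) mod K2)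
      else if a < oH then popcount (a - oP)
      else if a < oSg then
        next_entry (\<lambda>x. sg V idx ((a - oH) div K) x mod K = (a - oH) mod K) 0 n
      else if a < oNx then sg V idx ((a - oSg - 1) div n) ((a - oSg - 1) mod n)
      else if a < oSk then
        next_entry (\<lambda>y. sg V idx ((a - oNx - 1) div n) y mod K =
          sg V idx ((a - oNx - 1) div n) ((a - oNx - 1) mod n) mod K) (Suc ((a - oNx - 1) mod n)) n
      else sk V ((a - oSk) div Ns) ((a - oSk) mod Ns))"

definition words :: "(nat \<Rightarrow> 'x \<Rightarrow> 'r) \<Rightarrow> (nat \<Rightarrow> 'r \<Rightarrow> nat) \<Rightarrow> nat \<Rightarrow> nat \<Rightarrow> nat" where
  "words hs us x i = (if x < n \<and> i < M then us i (hs i (pts ! x)) else 0)"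

text \<open>The reduction modulo \<open>2 ^ w\<close> makes every cell a word by construction; that
  it changes none of the values the query relies on is part of \<open>layout\<close>.\<close>

definition nn_struct :: "('x, 'r) nn_structure" where
  "nn_struct = \<lparr>points = pts, num_hash = M, num_univ = M,
     coins = map_pmf (to_nat_on (set_pmf coinP)) coinP, mem_size = mem_total,
     build = (\<lambda>hs us z a. cell (words hs us) (fst (dec z)) (snd (dec z)) a mod 2 ^ w)\<rparr>"

lemma dec_in: "dec z \<in> set_pmf coinP"
  unfolding dec_def by (intro from_nat_into set_pmf_not_empty)

lemma dec_enc: "c \<in> set_pmf coinP \<Longrightarrow> dec (to_nat_on (set_pmf coinP) c) = c"
  unfolding dec_def by (intro from_nat_into_to_nat_on) auto

lemma row_less: "idx \<in> set_pmf rowP \<Longrightarrow> r < nR \<Longrightarrow> j < k \<Longrightarrow> idx r j < m"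
proof -
  assume *: "idx \<in> set_pmf rowP" "r < nR" "j < k"
  have "set_pmf (pmf_of_set {..<m}) = {..<m}" using m(2) by (intro set_pmf_of_set) auto
  thus ?thesis using * by (auto simp: rowP_def set_Pi_pmf PiE_dflt_def)
qed

lemma stop_range: "r \<in> set_pmf (pmf_of_set {Q..<2 * Q}) \<Longrightarrow> Q \<le> r \<and> r < 2 * Q"
  using Q(1) by (subst (asm) set_pmf_of_set) auto

lemma mem_total_eq: "mem_total = oSk + n * Ns + 2"
  by (simp add: mem_total_def offsets algebra_simps)

lemma layout:
  assumes idx: "idx \<in> set_pmf rowP" and r: "Q \<le> r" "r < 2 * Q"
    and less: "\<And>i. i < M \<Longrightarrow> v i (g i) < 2 ^ w"
  shows "nn_layout w mem_total M g v (par r) (\<lambda>a. cell V idx r a mod 2 ^ w) (ix idx) (sg V idx) (sk V) nA oI"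
proof -
  have n0: "0 < n" using n by simp
  have K2: "0 < K2" using k1 by simp
  have Mw: "mem_total + M < 2 ^ w" by (rule mem_w(1))
  have bounds: "mem_total < 2 ^ w" "M < 2 ^ w" "oSk + n * Ns + 2 < 2 ^ w"
    using Mw mem_total_eq by linarith+
  have ofs: "24 + nW < oQ" "oQ + Ns = oS" "oS + nR = oI" "oI + nR * K2 < oP" "oP + K = oH"
    "oH + L * K = oSg" "oSg + L * n < oNx" "oNx + L * n < oSk"
    by (simp_all add: offsets)
  have thr: "thr \<le> Ns * Bb"
  proof -
    have "(1 - p1) / 2 + (p1 - p2) / 4 \<le> 1" using p by argo
    hence "real (Ns * Bb) * ((1 - p1) / 2 + (p1 - p2) / 4) \<le> real (Ns * Bb) * 1"
      by (intro mult_left_mono) auto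
    thus ?thesis unfolding thr_def by linarith
  qed
  have nn: "n \<le> L * n" using nA(3) nB(3) by simp
  have LL: "L \<le> L * n" using n0 by simp
  have k2r: "K2 \<le> nR * K2" using nA(3) by simp
  \<comment> \<open>Every parameter is dominated by the end of the memory, by the number of sketch
    functions or by one of the budgets, all of which fit into a word.\<close>
  have par_less: "par r i < 2 ^ w" if "i < 24" for i
  proof -
    have "list_all (\<lambda>x. x < 2 ^ w) [0, 1, nW, 24, Ns, Bb, oQ, nR, K2, oI, oS, L, nB, oS + nA, oH, K, n,
       oSg, oNx, oSk, oP, thr, r, 20 * L]"
      using bounds ofs thr mem_w(2,3,5) r nn LL k2r less_exp[of w] K2
      by (simp only: list.pred_inject) (intro conjI TrueI; linarith)
    thus ?thesis using that unfolding par_def by (auto simp only: list_all_length) simp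
  qed
  have ix_le: "ix idx r j \<le> nW" if "r < nR" "j < K2" for r j
  proof -
    have *: "j' * m + idx r j' \<le> nW" if "j' < k" for j'
    proof -
      have "Suc j' * m \<le> k * m" using that by (intro mult_le_mono1) auto
      thus ?thesis using row_less[OF idx \<open>r < nR\<close> that] by simp
    qed
    have "k1 + j < k" using that by simp
    thus ?thesis using *[of j] *[of "k1 + j"] that k1 by (auto simp: ix_def)
  qed
  have sk_less: "sk V x j < 2 ^ Bb" for x j
    unfolding sk_def by (intro horner_less) auto
  have Kw: "2 ^ Bb < (2::nat) ^ w" using mem_w(5) by simp
  show ?thesis
  proof (unfold_locales, goal_cases)
    case (1 i) thus ?case using par_less[of i] by (simp add: cell_def)
  next
    case 5 thus ?case using bounds by simp
  next
    case (6 i) thus ?case by (rule less)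
  next
    case 8 thus ?case using mem_w(5) by (simp add: par_def)
  next
    case 9 thus ?case using bounds by simp
  next
    case 14 show ?case using ofs mem_total_eq by linarith
  next
    case 27 show ?case using par_less[of 11] by simp
  next
    case 28 show ?case using par_less[of 8] by simp
  next
    case 29 show ?case using ofs by (simp add: par_def cell_def)
  next
    case 31 show ?case using nB by (simp add: par_def)
  next
    case 34 show ?case using r Q by (simp add: par_def)
  next
    case 35 show ?case using nA nB by (simp add: par_def)
  next
    case 36 show ?case using par_less[of 22] by simp
  next
    case 37 show ?case using par_less[of 23] by simp
  next
    case (38 r j) thus ?case using ix_le by (simp add: par_def)
  next
    case (39 x j) show ?case using sk_less by (simp add: par_def)
  next
    case (40 i j)
    hence ij: "i < nR" "j < K2" by (simp_all add: par_def)
    have "Suc i * K2 \<le> nR * K2" using ij by (intro mult_le_mono1) auto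
    hence "oI + (i * K2 + j) < oP" using ij ofs by simp
    moreover have "24 + ix idx i j < 2 ^ w" using ix_le[OF ij] ofs bounds by linarith
    moreover have "24 \<le> oI" using ofs by linarith
    ultimately show ?case using ij by (simp add: par_def cell_def)
  next
    case (41 a)
    hence a: "a < K" by (simp add: par_def)
    have "popcount a \<le> Bb" using a by (rule popcount_less)
    hence "popcount a < 2 ^ w" using mem_w(5) less_exp[of w] by linarith
    moreover have "\<not> oP + a < 24" "\<not> oP + a < oI" "\<not> oP + a < oP" "oP + a < oH" using ofs a by linarith+
    ultimately show ?case by (simp add: par_def cell_def)
  next
    case (42 t b)
    hence tb: "t < L" "b < K" by (simp_all add: par_def)
    have "Suc t * K \<le> L * K" using tb by (intro mult_le_mono1) auto
    hence "\<not> oH + (t * K + b) < 24" "\<not> oH + (t * K + b) < oI" "\<not> oH + (t * K + b) < oP"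
      "\<not> oH + (t * K + b) < oH" "oH + (t * K + b) < oSg" using ofs tb by simp_all
    moreover have "next_entry P 0 n < 2 ^ w" for P
      using next_entry_le[of P 0 n] nn ofs bounds by linarith
    ultimately show ?case using tb by (simp add: par_def cell_def)
  next
    case (43 t x)
    hence tx: "t < L" "x < n" by (simp_all add: par_def)
    have "Suc t * n \<le> L * n" using tx by (intro mult_le_mono1) auto
    hence "\<not> oSg + (t * n + Suc x) < 24" "\<not> oSg + (t * n + Suc x) < oI" "\<not> oSg + (t * n + Suc x) < oP"
      "\<not> oSg + (t * n + Suc x) < oH" "\<not> oSg + (t * n + Suc x) < oSg" "oSg + (t * n + Suc x) < oNx"
      using ofs tx by simp_all
    thus ?case using tx by (simp add: par_def cell_def) (simp add: sg_def)
  next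
    case (44 t x)
    hence tx: "t < L" "x < n" by (simp_all add: par_def)
    have "Suc t * n \<le> L * n" using tx by (intro mult_le_mono1) auto
    hence "\<not> oNx + (t * n + Suc x) < 24" "\<not> oNx + (t * n + Suc x) < oI" "\<not> oNx + (t * n + Suc x) < oP"
      "\<not> oNx + (t * n + Suc x) < oH" "\<not> oNx + (t * n + Suc x) < oSg" "\<not> oNx + (t * n + Suc x) < oNx"
      "oNx + (t * n + Suc x) < oSk"
      using ofs tx by simp_all
    moreover have "next_entry P y n < 2 ^ w" for P y
      using next_entry_le[of P y n] nn ofs bounds by linarith
    ultimately show ?case using tx by (simp add: par_def cell_def)
  next
    case (45 x j)
    hence xj: "x < n" "j < Ns" by (simp_all add: par_def)
    have "\<not> oSk + (x * Ns + j) < 24" "\<not> oSk + (x * Ns + j) < oI" "\<not> oSk + (x * Ns + j) < oP"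
      "\<not> oSk + (x * Ns + j) < oH" "\<not> oSk + (x * Ns + j) < oSg" "\<not> oSk + (x * Ns + j) < oNx"
      "\<not> oSk + (x * Ns + j) < oSk" using ofs by linarith+
    moreover have "sk V x j < 2 ^ w" using sk_less[of x j] Kw by linarith
    ultimately show ?case using xj by (simp add: par_def cell_def)
  qed (use ofs mem_total_eq in \<open>simp_all add: par_def\<close>)
qed

end

lemma horner_cong: "(\<And>b. b < n \<Longrightarrow> f b = h b) \<Longrightarrow> horner f n = horner h n"
  by (induction n) auto

section \<open>Agreement of the machine search with the probabilistic model\<close>

context nn_data
begin

definition sq :: "(nat \<Rightarrow> nat) \<Rightarrow> (nat \<Rightarrow> nat \<Rightarrow> nat) \<Rightarrow> nat \<Rightarrow> nat" where
  "sq V idx t = (\<Sum>j<k. V (j * m + sel idx t j)) mod 2 ^ w"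

definition ents :: "(nat \<Rightarrow> nat \<Rightarrow> nat) \<Rightarrow> (nat \<Rightarrow> nat) \<Rightarrow> (nat \<Rightarrow> nat \<Rightarrow> nat) \<Rightarrow> (bool \<times> nat) list" where
  "ents V Vq idx = concat (map (\<lambda>t. map (\<lambda>x. (sg V idx t x = sq Vq idx t, x))
     (filter (\<lambda>x. sg V idx t x mod K = sq Vq idx t mod K) [0..<n])) [0..<L])"

definition mis :: "(nat \<Rightarrow> nat \<Rightarrow> nat) \<Rightarrow> (nat \<Rightarrow> nat) \<Rightarrow> nat \<Rightarrow> nat" where
  "mis V Vq x = card {i \<in> {nW..<M}. V x i mod 2 \<noteq> Vq i mod 2}"

text \<open>The answer as a function of the words of the points, the words of the query and the
  coins alone. It is the meeting point of program verification and probabilistic analysis.\<close>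

definition res :: "(nat \<Rightarrow> nat \<Rightarrow> nat) \<Rightarrow> (nat \<Rightarrow> nat) \<Rightarrow> (nat \<Rightarrow> nat \<Rightarrow> nat) \<Rightarrow> nat \<Rightarrow> nat" where
  "res V Vq idx r = scan (\<lambda>x. mis V Vq x \<le> thr) (ents V Vq idx) 0 r (20 * L)"

lemma par_simps:
  "par r 2 = nW" "par r 3 = 24" "par r 4 = Ns" "par r 5 = Bb" "par r 7 = nR" "par r 8 = K2"
  "par r 11 = L" "par r 12 = nB" "par r 15 = K" "par r 16 = n" "par r 21 = thr" "par r 22 = r"
  "par r 23 = 20 * L"
  by (simp_all add: par_def)

lemma sum_sketch_blocks:
  fixes h :: "nat \<Rightarrow> nat"
  shows "(\<Sum>j<Ns. \<Sum>b<Bb. h (nW + j * Bb + b)) = sum h {nW..<M}"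
proof -
  have "(\<Sum>j<Ns. \<Sum>b<Bb. h (nW + j * Bb + b)) = (\<Sum>j<Ns. sum (\<lambda>i. h (nW + i)) {j * Bb..<j * Bb + Bb})"
  proof (rule sum.cong[OF refl])
    fix j
    show "(\<Sum>b<Bb. h (nW + j * Bb + b)) = sum (\<lambda>i. h (nW + i)) {j * Bb..<j * Bb + Bb}"
      by (simp add: sum.atLeastLessThan_shift_0[of _ "j * Bb"] lessThan_atLeast0 add.assoc)
  qed
  also have "\<dots> = (\<Sum>i<Ns * Bb. h (nW + i))" by (rule sum.nat_group)
  also have "\<dots> = sum h {nW..<M}"
    by (simp add: sum.atLeastLessThan_shift_0[of _ nW] lessThan_atLeast0)
  finally show ?thesis .
qed

text \<open>The program adds two half-row signatures, the model sums over a full row; the sum splits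
  at \<open>k1\<close> and reduction modulo \<open>2 ^ w\<close> commutes with addition. Likewise,
  popcounts over sketch words regroup into a count over single functions.\<close>

lemma search_result_eq:
  assumes idx: "idx \<in> set_pmf rowP" and r: "Q \<le> r" "r < 2 * Q"
    and less: "\<And>i. i < M \<Longrightarrow> v i (g i) < 2 ^ w"
    and Vq: "\<And>i. i < M \<Longrightarrow> Vq i = v i (g i)"
  shows "nn_layout.search_result w g v (par r) (ix idx) (sg V idx) (sk V) nA = res V Vq idx r"
proof -
  interpret Lay: nn_layout w mem_total M g v "par r" "\<lambda>a. cell V idx r a mod 2 ^ w" "ix idx" "sg V idx" "sk V" nA oI
    by (rule layout[OF idx r]) (rule less)
  have W: "Lay.W i = Vq i" if "i < M" for i using Vq that by (simp add: Lay.W_def)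
  have pos: "j * m + idx r' j < nW" if "r' < nR" "j < k" for r' j
  proof -
    have "Suc j * m \<le> k * m" using that by (intro mult_le_mono1) auto
    thus ?thesis using row_less[OF idx that] by simp
  qed
  have Wz: "Lay.Wz i = (if i < nW then Vq i else 0)" for i
    using W[of i] by (simp add: Lay.Wz_def par_simps)
  have sigA: "Lay.sigq a = (\<Sum>j<k1. Vq (j * m + idx a j)) mod 2 ^ w" if a: "a < nA" for a
  proof -
    \<comment> \<open>The padded levels contribute 0, so the sum shrinks to the \<open>k1\<close>
      levels of the first half.\<close>
    have "(\<Sum>j<K2. Lay.Wz (ix idx a j)) = (\<Sum>j<k1. Vq (j * m + idx a j))"
    proof (rule sum.mono_neutral_cong_right)
      show "{..<k1} \<subseteq> {..<K2}" using k1(3) by auto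
      show "\<forall>i\<in>{..<K2} - {..<k1}. Lay.Wz (ix idx a i) = 0" using a by (auto simp: Wz ix_def)
      show "Lay.Wz (ix idx a j) = Vq (j * m + idx a j)" if "j \<in> {..<k1}" for j
        using that a pos[of a j] k1(1) by (simp add: Wz ix_def)
    qed simp
    thus ?thesis by (simp add: Lay.sigq_def par_simps)
  qed
  have sigB: "Lay.sigq (nA + s) = (\<Sum>j=k1..<k. Vq (j * m + idx (nA + s) j)) mod 2 ^ w" if s: "s < nB" for s
  proof -
    have "(\<Sum>j<K2. Lay.Wz (ix idx (nA + s) j)) = (\<Sum>j<K2. Vq ((k1 + j) * m + idx (nA + s) (k1 + j)))"
      using s pos[of "nA + s"] by (intro sum.cong) (auto simp: Wz ix_def)
    also have "\<dots> = (\<Sum>j=k1..<k. Vq (j * m + idx (nA + s) j))"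
      by (simp add: sum.atLeastLessThan_shift_0[of _ k1] lessThan_atLeast0)
    finally show ?thesis by (simp add: Lay.sigq_def par_simps)
  qed
  have st: "Lay.st t = sq Vq idx t" if t: "t < L" for t
  proof -
    have dA: "t div nB < nA" using t by (simp add: less_mult_imp_div_less)
    have mB: "t mod nB < nB" using nB(3) by simp
    have "(\<Sum>j<k. Vq (j * m + sel idx t j)) =
        (\<Sum>j<k1. Vq (j * m + sel idx t j)) + (\<Sum>j=k1..<k. Vq (j * m + sel idx t j))"
      using k1(1) sum.atLeastLessThan_concat[of 0 k1 k "\<lambda>j. Vq (j * m + sel idx t j)"]
      by (simp add: lessThan_atLeast0)
    also have "(\<Sum>j<k1. Vq (j * m + sel idx t j)) = (\<Sum>j<k1. Vq (j * m + idx (t div nB) j))"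
      by (intro sum.cong) (auto simp: sel_def)
    also have "(\<Sum>j=k1..<k. Vq (j * m + sel idx t j)) = (\<Sum>j=k1..<k. Vq (j * m + idx (nA + t mod nB) j))"
      by (intro sum.cong) (auto simp: sel_def)
    finally show ?thesis
      unfolding Lay.st_def sq_def par_simps sigA[OF dA] sigB[OF mB] by (simp add: mod_add_eq)
  qed
  have es: "Lay.all_es 0 = ents V Vq idx"
    unfolding Lay.all_es_def ents_def par_simps
    by (intro arg_cong[where f = concat] map_cong refl) (simp add: Lay.es_def par_simps st)
  have mism: "Lay.mism x = mis V Vq x" for x
  proof -
    have "Lay.mism x = (\<Sum>j<Ns. \<Sum>b<Bb. of_bool (V x (nW + j * Bb + b) mod 2 \<noteq> Vq (nW + j * Bb + b) mod 2))"
      unfolding Lay.mism_def par_simps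
    proof (rule sum.cong[OF refl])
      fix j assume "j \<in> {..<Ns}"
      hence j: "Suc j * Bb \<le> Ns * Bb" by (intro mult_le_mono1) auto
      have q: "Lay.qsk j = horner (\<lambda>b. Vq (nW + j * Bb + b) mod 2) Bb"
        unfolding Lay.qsk_def par_simps using j by (intro horner_cong) (simp add: W)
      have "popcount (sk V x j XOR Lay.qsk j) =
          card {b. b < Bb \<and> V x (nW + j * Bb + b) mod 2 \<noteq> Vq (nW + j * Bb + b) mod 2}"
        unfolding q sk_def by (rule popcount_xor_horner) auto
      also have "\<dots> = (\<Sum>b<Bb. of_bool (V x (nW + j * Bb + b) mod 2 \<noteq> Vq (nW + j * Bb + b) mod 2))"
        by (simp add: sum.If_cases of_bool_def Int_def lessThan_def)
      finally show "popcount (sk V x j XOR Lay.qsk j) =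
        (\<Sum>b<Bb. of_bool (V x (nW + j * Bb + b) mod 2 \<noteq> Vq (nW + j * Bb + b) mod 2))" .
    qed
    also have "\<dots> = (\<Sum>i\<in>{nW..<M}. of_bool (V x i mod 2 \<noteq> Vq i mod 2))"
      by (rule sum_sketch_blocks)
    also have "\<dots> = mis V Vq x"
      by (simp add: mis_def sum.If_cases of_bool_def Int_def)
    finally show ?thesis .
  qed
  show ?thesis unfolding Lay.search_result_def es mism res_def par_simps ..
qed

abbreviation "vq hs us q \<equiv> \<lambda>i. if i < M then us i (hs i q) else 0"

lemma sample_spaceD:
  fixes hs :: "nat \<Rightarrow> 'x \<Rightarrow> 'r"
  assumes "(hs, us, z) \<in> space (sample_space H U nn_struct)" "i < M"
  shows "hs i \<in> space H" "us i \<in> space U"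
  using assms by (auto simp: sample_space_def nn_struct_def space_pair_measure space_PiM)

lemma query_runs:
  fixes hs :: "nat \<Rightarrow> 'x \<Rightarrow> 'r"
  assumes H: "hash_distribution X R H" and U: "pairwise_independent_family R (2 ^ w) U"
    and \<omega>: "(hs, us, z) \<in> space (sample_space H U nn_struct)" and q: "q \<in> X"
  shows "\<exists>e t. query w query_prog nn_struct (hs, us, z) q e t
      (res (words hs us) (vq hs us q) (fst (dec z)) (snd (dec z))) \<and>
      real e \<le> 1740 * (lg\<^sup>2 / \<delta>\<^sup>2) \<and> real t \<le> 10000000 * (lg\<^sup>2 / \<delta>\<^sup>2 + G / \<delta>\<^sup>2)"
proof -
  define idx where "idx = fst (dec z)"
  define r where "r = snd (dec z)"
  have dz: "idx \<in> set_pmf rowP" "r \<in> set_pmf (pmf_of_set {Q..<2 * Q})"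
    using dec_in[of z] by (auto simp: coinP_def idx_def r_def)
  have r: "Q \<le> r" "r < 2 * Q" using stop_range[OF dz(2)] by auto
  have less: "us i (hs i q) < 2 ^ w" if "i < M" for i
  proof -
    have "hs i q \<in> R"
      using H q sample_spaceD(1)[OF \<omega> that] measurable_space[of "\<lambda>h. h q" H "count_space R"]
      by (auto simp: hash_distribution_def)
    thus ?thesis
      using U sample_spaceD(2)[OF \<omega> that] measurable_space[of "\<lambda>u. u (hs i q)" U "count_space {..<2 ^ w}"]
      by (auto simp: pairwise_independent_family_def)
  qed
  let ?g = "\<lambda>j. hs j q"
  interpret Lay: nn_layout w mem_total M ?g us "par r" "\<lambda>a. cell (words hs us) idx r a mod 2 ^ w"
      "ix idx" "sg (words hs us) idx" "sk (words hs us)" nA oI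
    by (rule layout[OF dz(1) r]) (rule less)
  let ?s = "\<lparr>regs = (\<lambda>_. 0), mem = build nn_struct hs us z, hval = None\<rparr> :: 'r ram_state"
  have "Lay.cp query_prog ?s (\<lambda>e t s'. e \<le> nW + Ns * Bb \<and>
    t \<le> 100 + 6 * nW + Ns * (Bb * 8 + 9) + nR * (K2 * 7 + 9) + 20 * L +
      (Ns * 11 + 30) * r + 20 * (20 * L) \<and> regs s' 0 = Lay.search_result)"
    using Lay.cp_query_prog[of ?s] by (simp add: par_simps nn_struct_def idx_def r_def)
  then obtain e t s' where ex: "exec w mem_total M ?g M us query_prog ?s e t s'"
    and e: "e \<le> M" and t: "t \<le> 100 + 6 * nW + Ns * (Bb * 8 + 9) + nR * (K2 * 7 + 9) + 20 * L +
      (Ns * 11 + 30) * r + 20 * (20 * L)" and s': "regs s' 0 = Lay.search_result"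
    unfolding Lay.cp_def by blast
  have "Lay.search_result = res (words hs us) (vq hs us q) idx r"
    by (rule search_result_eq[OF dz(1) r]) (use less in auto)
  hence "query w query_prog nn_struct (hs, us, z) q e t (res (words hs us) (vq hs us q) idx r)"
    using ex s' by (auto simp: query_def nn_struct_def)
  moreover have "real e \<le> 1740 * (lg\<^sup>2 / \<delta>\<^sup>2)"
    by (rule order_trans[OF of_nat_mono[OF e] evals_le])
  moreover have "real t \<le> 10000000 * (lg\<^sup>2 / \<delta>\<^sup>2 + G / \<delta>\<^sup>2)"
  proof (rule order_trans[OF of_nat_mono time_le])
    have "(Ns * 11 + 30) * r \<le> (Ns * 11 + 30) * (2 * Q)" using r by (intro mult_le_mono2) auto
    thus "t \<le> 100 + 6 * nW + Ns * (Bb * 8 + 9) + nR * (K2 * 7 + 9) + 20 * L +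
      (Ns * 11 + 30) * (2 * Q) + 20 * (20 * L)" using t by linarith
  qed
  ultimately show ?thesis unfolding idx_def r_def by blast
qed

lemma returns_iff:
  fixes hs :: "nat \<Rightarrow> 'x \<Rightarrow> 'r"
  assumes H: "hash_distribution X R H" and U: "pairwise_independent_family R (2 ^ w) U"
    and \<omega>: "(hs, us, z) \<in> space (sample_space H U nn_struct)" and q: "q \<in> X"
  defines "ans \<equiv> res (words hs us) (vq hs us q) (fst (dec z)) (snd (dec z))"
  shows "returns w query_prog nn_struct (hs, us, z) q x \<longleftrightarrow> ans < n \<and> pts ! ans = x"
proof -
  obtain e t where qu: "query w query_prog nn_struct (hs, us, z) q e t ans"
    using query_runs[OF H U \<omega> q] unfolding ans_def by blast
  have uniq: "i = ans" if qi: "query w query_prog nn_struct (hs, us, z) q e' t' i" for e' t' i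
  proof -
    let ?X = "exec w (mem_size (nn_struct :: ('x, 'r) nn_structure)) (num_hash (nn_struct :: ('x, 'r) nn_structure))
      (\<lambda>j. hs j q) (num_univ (nn_struct :: ('x, 'r) nn_structure)) us query_prog
      \<lparr>regs = (\<lambda>_. 0), mem = build nn_struct hs us z, hval = None\<rparr>"
    obtain s1 where s1: "?X e t s1" "regs s1 0 = ans" using qu by (auto simp: query_def)
    obtain s2 where s2: "?X e' t' s2" "regs s2 0 = i" using qi by (auto simp: query_def)
    have "s2 = s1" using s1(1) s2(1) by (rule exec_deterministic)
    thus ?thesis using s1 s2 by simp
  qed
  have pts: "points (nn_struct :: ('x, 'r) nn_structure) = pts"
    by (simp add: nn_struct_def)
  show ?thesis unfolding returns_def pts len
  proof (intro iffI; elim exE conjE)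
    fix e' t' i
    assume i: "query w query_prog nn_struct (hs, us, z) q e' t' i" "i < n" "pts ! i = x"
    have "i = ans" using i(1) by (rule uniq)
    thus "ans < n \<and> pts ! ans = x" using i by simp
  next
    assume "ans < n" "pts ! ans = x"
    thus "\<exists>e t i. query w query_prog nn_struct (hs, us, z) q e t i \<and> i < n \<and> pts ! i = x"
      using qu by (intro exI conjI)
  qed
qed

text \<open>Everything about one query depends on the hash values at the data points and at
  \<open>q\<close>; with \<open>Z\<close> consisting of these, the success event becomes an event in
  the discrete product to which \<open>prob_outcome\<close> applies.\<close>

lemma prob_solution:
  fixes H :: "('x \<Rightarrow> 'r) measure"
  assumes H: "hash_distribution X R H" and U: "pairwise_independent_family R (2 ^ w) U"
    and sens: "sensitive X d H r1 r2 p1 p2" and P: "set pts \<subseteq> X" and q: "q \<in> X"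
    and near: "x0 < n" "d q (pts ! x0) \<le> r1"
  shows "1 / 2 \<le> measure (sample_space H U nn_struct)
    {\<omega> \<in> space (sample_space H U nn_struct). \<exists>x'\<in>set pts. d q x' < r2 \<and> returns w query_prog nn_struct \<omega> q x'}"
proof -
  define Z where "Z = insert q (set pts)"
  have ptsX: "pts ! x \<in> X" "pts ! x \<in> Z" if "x < n" for x
    using P that len by (auto simp: Z_def)
  have qZ: "q \<in> Z" by (simp add: Z_def)
  interpret HS: hash_setup X R H U w Z
    using H U P q by unfold_locales (auto simp: Z_def)
  \<comment> \<open>The zero words of the default agree with the value 0 that \<open>words\<close>
    and the query words take at indices beyond \<open>M\<close>.\<close>
  define d0 :: "('x \<Rightarrow> 'r) \<times> ('x \<Rightarrow> nat)" where "d0 = (\<lambda>_. undefined, \<lambda>_. 0)"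
  define c :: "nat \<Rightarrow> ('x \<Rightarrow> 'r) \<times> ('x \<Rightarrow> nat) \<Rightarrow> bool" where "c = (\<lambda>x y. fst y (pts ! x) = fst y q)"
  define a :: "nat \<Rightarrow> ('x \<Rightarrow> 'r) \<times> ('x \<Rightarrow> nat) \<Rightarrow> nat"
    where "a = (\<lambda>x y. if x < n then snd y (pts ! x) else 0)"
  define b :: "('x \<Rightarrow> 'r) \<times> ('x \<Rightarrow> nat) \<Rightarrow> nat" where "b = (\<lambda>y. snd y q)"
  define far where "far = (\<lambda>x. r2 \<le> d q (pts ! x))"
  have coll: "measure_pmf.prob HS.D {y. c x y} = measure H {h \<in> space H. h q = h (pts ! x)}" if "x < n" for x
    using HS.prob_coll[OF ptsX(2)[OF that] qZ] by (simp add: c_def eq_commute)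
  interpret An: nn_analysis HS.D d0 c a b w n k k1 m nA nB Bb Ns M Q thr "20 * L" x0 p1 p2 far
  proof (rule nn_analysis.intro, goal_cases)
    case (1 x)
    show ?case
    proof (rule word_hash.intro)
      fix y assume y: "y \<in> set_pmf HS.D" "c x y"
      then obtain h u where "y = hash_values Z (h, u)" using HS.set_D by blast
      thus "a x y = b y" using y(2) qZ ptsX(2)[OF 1] 1 by (simp add: a_def b_def c_def hash_values_def)
    next
      fix B s s' :: nat assume "B \<le> w"
      thus "measure_pmf.prob HS.D {y. \<not> c x y \<and> (a x y + s) mod 2 ^ B = (b y + s') mod 2 ^ B} =
        (1 - measure_pmf.prob HS.D {y. c x y}) / 2 ^ B"
        using HS.prob_not_coll[OF ptsX(2)[OF 1] qZ, of B s s'] 1 by (simp add: a_def b_def c_def)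
    qed
  next
    case 3 show ?case using sens q ptsX(1)[OF near(1)] near coll by (auto simp: sensitive_def)
  next
    case (4 x) thus ?case using sens q ptsX(1) coll by (auto simp: sensitive_def far_def)
  next
    case 13 show ?case using mem_w(5) by simp
  next
    case 20 show ?case by (rule hoeff)
  next
    case 22 show ?case by (rule farQ)
  qed (use near m Bb Ns nA nB Q k1 p in \<open>auto simp: thr_def\<close>)
  \<comment> \<open>The definitions of the data structure mirror those of the analysis, so unfolding
    both sides leaves identical terms.\<close>
  have outcome: "An.outcome f idx r = res (\<lambda>x i. a x (f i)) (\<lambda>i. b (f i)) idx r" for f idx r
    unfolding An.outcome_def An.entries_def An.mis_def An.SG_def An.ST_def An.loc_def An.sel_def
      res_def ents_def mis_def sg_def sq_def sel_def by (rule refl)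
  define E where "E = (\<lambda>z. An.outcome (fst z) (fst (dec (snd z))) (snd (dec (snd z))) < n \<and>
    \<not> far (An.outcome (fst z) (fst (dec (snd z))) (snd (dec (snd z)))))"
  define F where "F = (\<lambda>(hs, us, z :: nat). (\<lambda>i. if i < M then hash_values Z (hs i, us i) else d0, z))"
  have ev: "(\<exists>x'\<in>set pts. d q x' < r2 \<and> returns w query_prog nn_struct \<omega> q x') \<longleftrightarrow> E (F \<omega>)"
    if \<omega>: "\<omega> \<in> space (sample_space H U nn_struct)" for \<omega>
  proof -
    obtain hs us z where hs: "\<omega> = (hs, us, z)" by (cases \<omega>)
    let ?f = "\<lambda>i. if i < M then hash_values Z (hs i, us i) else d0"
    have V: "(\<lambda>x i. a x (?f i)) = words hs us"
      using ptsX(2) by (auto simp: fun_eq_iff a_def words_def hash_values_def d0_def)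
    have Vq: "(\<lambda>i. b (?f i)) = vq hs us q"
      using qZ by (auto simp: fun_eq_iff b_def hash_values_def d0_def)
    let ?ans = "res (words hs us) (vq hs us q) (fst (dec z)) (snd (dec z))"
    have "E (F \<omega>) \<longleftrightarrow> ?ans < n \<and> \<not> far ?ans"
      unfolding E_def F_def hs prod.case fst_conv snd_conv outcome V Vq by (rule refl)
    moreover have "(\<exists>x'\<in>set pts. d q x' < r2 \<and> returns w query_prog nn_struct \<omega> q x') \<longleftrightarrow> ?ans < n \<and> \<not> far ?ans"
      unfolding hs returns_iff[OF H U \<omega>[unfolded hs] q] far_def using len by (auto simp: not_le)
    ultimately show ?thesis by simp
  qed
  have "measure (sample_space H U nn_struct)
    {\<omega> \<in> space (sample_space H U nn_struct). \<exists>x'\<in>set pts. d q x' < r2 \<and> returns w query_prog nn_struct \<omega> q x'} =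
    measure (sample_space H U nn_struct) {\<omega> \<in> space (sample_space H U nn_struct). E (F \<omega>)}"
    using ev by (intro arg_cong[where f = "measure _"]) auto
  also have "\<dots> = measure_pmf.prob (pair_pmf (Pi_pmf {..<M} d0 (\<lambda>_. HS.D)) (coins (nn_struct :: ('x, 'r) nn_structure))) {z. E z}"
    unfolding F_def by (rule HS.sample_space_pmf) (simp_all add: nn_struct_def)
  also have "\<dots> = measure_pmf.prob (pair_pmf An.pF coinP)
      {z. E (fst z, to_nat_on (set_pmf coinP) (snd z))}"
    by (simp add: nn_struct_def pair_map_pmf2 An.pF_def vimage_def apsnd_def map_prod_def case_prod_beta)
  also have "\<dots> = measure_pmf.prob (pair_pmf An.pF (pair_pmf An.pI An.pR))
     {z. An.outcome (fst z) (fst (snd z)) (snd (snd z)) < n \<and> \<not> far (An.outcome (fst z) (fst (snd z)) (snd (snd z)))}"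
  proof -
    have cP: "coinP = pair_pmf An.pI An.pR"
      by (simp add: coinP_def rowP_def An.pI_def An.pV_def An.pR_def)
    have "measure_pmf.prob (pair_pmf An.pF coinP) {z. E (fst z, to_nat_on (set_pmf coinP) (snd z))} =
      measure_pmf.prob (pair_pmf An.pF coinP)
      {z. An.outcome (fst z) (fst (snd z)) (snd (snd z)) < n \<and> \<not> far (An.outcome (fst z) (fst (snd z)) (snd (snd z)))}"
      \<comment> \<open>Decoding inverts the encoding only on the support of the coins, hence
        equality almost everywhere.\<close>
      by (rule measure_eq_AE) (auto intro!: AE_pmfI simp: E_def dec_enc)
    thus ?thesis unfolding cP .
  qed
  finally show ?thesis using An.prob_outcome by simp
qed

lemma solution:
  fixes H :: "('x \<Rightarrow> 'r) measure"
  assumes H: "hash_distribution X R H" and U: "pairwise_independent_family R (2 ^ w) U"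
    and sens: "sensitive X d H r1 r2 p1 p2" and P: "set pts = P" "distinct pts" "P \<subseteq> X"
  shows "near_neighbor_solution X d P r1 r2 H U w query_prog nn_struct"
proof -
  have "1 / 2 \<le> measure (sample_space H U nn_struct)
    {\<omega> \<in> space (sample_space H U nn_struct). \<exists>x'\<in>P. d q x' < r2 \<and> returns w query_prog nn_struct \<omega> q x'}"
    if q: "q \<in> X" and x: "x \<in> P" "d q x \<le> r1" for q x
  proof -
    obtain x0 where "x0 < n" "pts ! x0 = x" using x P len by (auto simp: in_set_conv_nth)
    thus ?thesis using prob_solution[OF H U sens _ q, of x0] x P by simp
  qed
  thus ?thesis using P unfolding near_neighbor_solution_def by (auto simp: nn_struct_def)
qed

end

text \<open>Program and constants are chosen before the space, the data and the word length. For
  \<open>p1 = 1\<close> the exponent \<rho> is 0 and the squared logarithm cannot be absorbed into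
  \<open>n powr \<rho>\<close>; the time bound without it is therefore claimed for
  \<open>p1 < 1\<close>, with a factor depending only on \<open>p1\<close> and
  \<open>p2\<close>.\<close>

theorem theorem2p6:
  "\<exists>(prog :: com) (c :: real) (C :: real) (K :: real \<Rightarrow> real \<Rightarrow> real).
     \<forall>(X :: 'x set) (d :: 'x \<Rightarrow> 'x \<Rightarrow> real) (P :: 'x set) (n :: nat) (R :: 'r set)
      (H :: ('x \<Rightarrow> 'r) measure) (U :: ('r \<Rightarrow> nat) measure)
      (r1 :: real) (r2 :: real) (p1 :: real) (p2 :: real) (\<rho> :: real) (w :: nat).
       distance_space X d \<and> P \<subseteq> X \<and> finite P \<and> card P = n \<and> 2 \<le> n \<and>
       0 < r1 \<and> r1 < r2 \<and> 0 < p2 \<and> p2 < p1 \<and> p1 \<le> 1 \<and>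
       hash_distribution X R H \<and> sensitive X d H r1 r2 p1 p2 \<and>
       \<rho> = log 2 (1 / p1) / log 2 (1 / p2) \<and>
       c * log 2 (real n / (p1 - p2)) \<le> real w \<and>
       pairwise_independent_family R (2 ^ w) U
       \<longrightarrow>
       (\<exists>D :: ('x, 'r) nn_structure.
          near_neighbor_solution X d P r1 r2 H U w prog D \<and>
          (\<forall>\<omega> \<in> space (sample_space H U D). \<forall>q\<in>X. \<exists>e t i.
             query w prog D \<omega> q e t i \<and>
             real e \<le> C * ((log 2 (real n))\<^sup>2 / (p1 - p2)\<^sup>2) \<and>
             real t \<le> C * ((log 2 (real n))\<^sup>2 / (p1 - p2)\<^sup>2 + real n powr \<rho> / (p1 - p2)\<^sup>2) \<and>
             (p1 < 1 \<longrightarrow> real t \<le> K p1 p2 * (real n powr \<rho> / (p1 - p2)\<^sup>2))) \<and>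
          real (space_words D) \<le> C * (real n powr (1 + \<rho>) / p1 + real n / (p1 - p2)\<^sup>2) \<and>
          real (num_hash D) \<le> C * ((log 2 (real n))\<^sup>2 / (p1 - p2)\<^sup>2))"
proof (rule exI[of _ query_prog], rule exI[of _ 40], rule exI[of _ 10000000],
    rule exI[of _ "\<lambda>p1 p2. 10000000 * ((2 / (log 2 (1 / p1) / log 2 (1 / p2) * ln 2))\<^sup>2 + 1)"],
    intro allI impI, elim conjE)
  fix X :: "'x set" and d :: "'x \<Rightarrow> 'x \<Rightarrow> real" and P :: "'x set" and n :: nat and R :: "'r set"
    and H :: "('x \<Rightarrow> 'r) measure" and U :: "('r \<Rightarrow> nat) measure" and r1 r2 p1 p2 \<rho> :: real and w :: nat
  assume P: "P \<subseteq> X" "finite P" "card P = n" and n: "2 \<le> n" and p: "0 < p2" "p2 < p1" "p1 \<le> 1"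
    and H: "hash_distribution X R H" and sens: "sensitive X d H r1 r2 p1 p2"
    and \<rho>: "\<rho> = log 2 (1 / p1) / log 2 (1 / p2)"
    and w: "40 * log 2 (real n / (p1 - p2)) \<le> real w"
    and U: "pairwise_independent_family R (2 ^ w) U"
  obtain pts where pts: "set pts = P" "distinct pts" using finite_distinct_list[OF P(2)] by blast
  interpret nn_data n w p1 p2 \<rho> pts
    using n p \<rho> w P(3) pts distinct_card[of pts] by unfold_locales auto
  let ?a = "(log 2 (real n))\<^sup>2 / (p1 - p2)\<^sup>2" and ?b = "real n powr \<rho> / (p1 - p2)\<^sup>2"
  have ab: "0 \<le> ?a" "0 \<le> ?b" by auto
  have scale: "x \<le> 10000000 * y" if "x \<le> C * y" "C \<le> 10000000" "0 \<le> y" for x y C :: real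
    using that mult_right_mono[of C 10000000 y] by linarith
  show "\<exists>D :: ('x, 'r) nn_structure.
          near_neighbor_solution X d P r1 r2 H U w query_prog D \<and>
          (\<forall>\<omega> \<in> space (sample_space H U D). \<forall>q\<in>X. \<exists>e t i.
             query w query_prog D \<omega> q e t i \<and> real e \<le> 10000000 * ?a \<and>
             real t \<le> 10000000 * (?a + ?b) \<and>
             (p1 < 1 \<longrightarrow> real t \<le> 10000000 * ((2 / (log 2 (1 / p1) / log 2 (1 / p2) * ln 2))\<^sup>2 + 1) * ?b)) \<and>
          real (space_words D) \<le> 10000000 * (real n powr (1 + \<rho>) / p1 + real n / (p1 - p2)\<^sup>2) \<and>
          real (num_hash D) \<le> 10000000 * ?a"
  proof (intro exI[of _ nn_struct] conjI ballI)
    show "near_neighbor_solution X d P r1 r2 H U w query_prog nn_struct"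
      by (rule solution[OF H U sens pts P(1)])
    show "real (num_hash (nn_struct :: ('x, 'r) nn_structure)) \<le> 10000000 * ?a"
      using scale[OF evals_le _ ab(1)] by (simp add: nn_struct_def)
    show "real (space_words (nn_struct :: ('x, 'r) nn_structure)) \<le>
        10000000 * (real n powr (1 + \<rho>) / p1 + real n / (p1 - p2)\<^sup>2)"
      using scale[OF space_le] T_ge(1,2) by (simp add: nn_struct_def space_words_def)
    fix \<omega> :: "('x, 'r) sample" and q
    assume \<omega>: "\<omega> \<in> space (sample_space H U nn_struct)" and q: "q \<in> X"
    obtain hs us z where hs: "\<omega> = (hs, us, z)" by (cases \<omega>)
    obtain e t i where et: "query w query_prog nn_struct (hs, us, z) q e t i" "real e \<le> 1740 * ?a"
      "real t \<le> 10000000 * (?a + ?b)"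
      using query_runs[OF H U \<omega>[unfolded hs] q] by blast
    have "real t \<le> 10000000 * ((2 / (log 2 (1 / p1) / log 2 (1 / p2) * ln 2))\<^sup>2 + 1) * ?b" if "p1 < 1"
    proof -
      \<comment> \<open>Positivity of \<rho> makes the squared logarithm
        \<open>O(n powr \<rho>)\<close>; the summand 1 in the witness for \<open>K\<close> accounts
        for the term \<open>n powr \<rho>\<close> itself.\<close>
      have "0 < \<rho>" unfolding \<rho>_ln using that p ln_p2 \<delta> by simp
      hence "(log 2 (real n))\<^sup>2 / (p1 - p2)\<^sup>2 \<le> ((2 / (\<rho> * ln 2))\<^sup>2 * real n powr \<rho>) / (p1 - p2)\<^sup>2"
        using log_square_le_powr[OF n] by (intro divide_right_mono) auto
      moreover have "((2 / (\<rho> * ln 2))\<^sup>2 + 1) * ?b = ((2 / (\<rho> * ln 2))\<^sup>2 * real n powr \<rho>) / (p1 - p2)\<^sup>2 + ?b"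
        by (simp only: distrib_right mult_1_left times_divide_eq_right add_divide_distrib)
      ultimately have "?a + ?b \<le> ((2 / (\<rho> * ln 2))\<^sup>2 + 1) * ?b" by linarith
      hence "10000000 * (?a + ?b) \<le> 10000000 * (((2 / (\<rho> * ln 2))\<^sup>2 + 1) * ?b)"
        by (intro mult_left_mono) auto
      thus ?thesis using et(3) unfolding \<rho>[symmetric] by (simp only: mult.assoc)
    qed
    thus "\<exists>e t i. query w query_prog nn_struct \<omega> q e t i \<and> real e \<le> 10000000 * ?a \<and>
             real t \<le> 10000000 * (?a + ?b) \<and>
             (p1 < 1 \<longrightarrow> real t \<le> 10000000 * ((2 / (log 2 (1 / p1) / log 2 (1 / p2) * ln 2))\<^sup>2 + 1) * ?b)"
      using et(1,3) scale[OF et(2) _ ab(1)] unfolding hs by auto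
  qed
qed

end
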